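(* Let $d\ge1$ be an integer. (i) If condition $\mathfrak S_{23d}$ holds, the upper bound $K^{\mathscr S}_{\ell,2\ell,3\ell,d}$ is such that $$K^{\mathscr S}_{\ell,2\ell,3\ell,d}=\frac{1+O(1/\ell)}{(20\pi\ell)^{d/4}}\qquad(\ell\to+\infty).$$ (ii) Let $\Delta_{23}:=\{(\xi,\eta)\in(0,\frac12)\times(0,\frac13):\ \xi+\eta<1\}$ and $D_{23}(\xi,\eta):=\frac{(1-\xi-\eta)(\xi+\eta)}{\xi\eta(1-2\xi)(1-3\eta)}$ on $\Delta_{23}$. Then $D_{23}(1/5,1/7)=23$, and the corresponding lower bound satisfies $$\mathscr K^F_{\ell,2\ell,3\ell,d}\Big(\frac1{5\ell},\frac1{7\ell}\Big)=\frac{1+O(1/\ell)}{(23\pi\ell)^{d/4}}\qquad(\ell\to+\infty).$$ (iii) Summing up, for $\ell\to+\infty$, $$\frac{1+O(1/\ell)}{(23\pi\ell)^{d/4}}\le K_{\ell,2\ell,3\ell,d},$$ and, if condition $\mathfrak S_{23d}$ holds, $$K_{\ell,2\ell,3\ell,d}\le\frac{1+O(1/\ell)}{(20\pi\ell)^{d/4}}.$$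
   Context: Here $\ell$ is a real variable. The Fourier transform $\mathcal F$ is normalized so that $\mathcal F f(k)=(2\pi)^{-d/2}\int_{\mathbb R^d}e^{-ik\cdot x}f(x)\,dx$. For real $\ell\ge0$, $H^\ell(\mathbb R^d,\mathbb C)=\{f\in S'(\mathbb R^d,\mathbb C): (1+|k|^2)^{\ell/2}\mathcal F f\in L^2\}$, $\|f\|_\ell=\|(1+|k|^2)^{\ell/2}\mathcal F f\|_{L^2}$. For real $0\le\ell\le m\le n$ with $m+n-\ell>d/2$, the sharp constant is $$K_{\ell mnd}:=\min\{K\in[0,+\infty):\ \|fg\|_\ell\le K\|f\|_m\|g\|_n\ \text{ for all } f\in H^m(\mathbb R^d,\mathbb C),\ g\in H^n(\mathbb R^d,\mathbb C)\}.$$ The upper bound $K^{\mathscr S}_{\ell mnd}$ for $K_{\ell mnd}$ is $K^{\mathscr S}_{\ell mnd}:=\sqrt{\sup_{u\in[0,+\infty)}\mathscr S_{\ell mnd}(u)}$, where $$\mathscr S_{\ell mnd}(u):=\frac{\Gamma(m+n-d/2)}{(4\pi)^{d/2}\Gamma(m+n)}(1+4u)^\ell\,{}_3F_2\Big(m+n-\tfrac d2,m,n;\tfrac{m+n}2,\tfrac{m+n+1}2;-u\Big),$$ ${}_3F_2$ being the generalized hypergeometric function, real-analytically continued from $(-1,1)$ to $(-\infty,1)$ in its argument. Condition $\mathfrak S_{23d}$ is the statement that $\sup_{u\in[0,+\infty)}\Sigma_{23d\ell}(u)=1+O(1/\ell)$ for $\ell\to+\infty$, where $$\Sigma_{23d\ell}(u):=(1+4u)^\ell\,{}_3F_2\Big(5\ell-\tfrac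 d2,2\ell,3\ell;\tfrac{5\ell}2,\tfrac{5\ell+1}2;-u\Big).$$ For $\sigma,\tau>0$, the lower bound $\mathscr K^F_{\ell mnd}(\sigma,\tau)$ for $K_{\ell mnd}$ is $$\mathscr K^F_{\ell mnd}(\sigma,\tau):=\frac{\|f_{\sigma+\tau,d}\|_\ell}{\|f_{\sigma d}\|_m\|f_{\tau d}\|_n},\qquad f_{\sigma d}(x):=e^{-\sigma|x|^2/2}\ \ (x\in\mathbb R^d).$$ An inequality such as $\frac{1+O(1/\ell)}{(c\ell)^{d/4}}\le K$ means that $K$ is bounded below by some function of $\ell$ of the form $\frac{1+O(1/\ell)}{(c\ell)^{d/4}}$ for $\ell\to+\infty$; similarly for upper bounds. *)

theory Defs
  imports "HOL-Analysis.Analysis" "HOL-Library.Landau_Symbols"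
begin

section \<open>Schwartz functions and tempered distributions on \<open>\<real>\<^sup>d\<close>\<close>

text \<open>
  The space \<open>\<real>\<^sup>d\<close> is \<^typ>\<open>real ^ 'd\<close>, with \<open>d = CARD('d) \<ge> 1\<close>. Iterated partial derivatives are
  indexed by lists of coordinates instead of multi-indices.
\<close>

definition partial :: "'d::finite \<Rightarrow> (real ^ 'd \<Rightarrow> complex) \<Rightarrow> real ^ 'd \<Rightarrow> complex" where
  "partial i f x = frechet_derivative f (at x) (axis i 1)"

definition partials :: "'d::finite list \<Rightarrow> (real ^ 'd \<Rightarrow> complex) \<Rightarrow> real ^ 'd \<Rightarrow> complex" where
  "partials is f = foldr partial is f"

text \<open>
  Differentiability of all the iterated partial derivatives is smoothness; in particular
  \<^const>\<open>frechet_derivative\<close> is only used for functions that are differentiable.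
\<close>

definition schwartz :: "(real ^ 'd::finite \<Rightarrow> complex) set" where
  "schwartz = {\<phi>. \<forall>is. (\<forall>x. partials is \<phi> differentiable (at x)) \<and>
     (\<forall>N::nat. bounded (range (\<lambda>x. (1 + norm x) ^ N *\<^sub>R partials is \<phi> x)))}"

definition schwartz_norm :: "nat \<Rightarrow> (real ^ 'd::finite \<Rightarrow> complex) \<Rightarrow> real" where
  "schwartz_norm N \<phi> =
     (SUP is\<in>{is. length is \<le> N}. SUP x. (1 + norm x) ^ N * norm (partials is \<phi> x))"

text \<open>
  A distribution is a functional on all functions of which only the values on \<^const>\<open>schwartz\<close>
  matter. Continuity with respect to the Schwartz topology is expressed through the increasing
  family of norms that generates it.
\<close>

type_synonym 'd distribution = "(real ^ 'd \<Rightarrow> complex) \<Rightarrow> complex"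

definition tempered :: "'d::finite distribution set" where
  "tempered = {T.
     (\<forall>\<phi>\<in>schwartz. \<forall>\<psi>\<in>schwartz. T (\<lambda>x. \<phi> x + \<psi> x) = T \<phi> + T \<psi>) \<and>
     (\<forall>c. \<forall>\<phi>\<in>schwartz. T (\<lambda>x. c * \<phi> x) = c * T \<phi>) \<and>
     (\<exists>C N. \<forall>\<phi>\<in>schwartz. norm (T \<phi>) \<le> C * schwartz_norm N \<phi>)}"

definition dist_of_fun :: "(real ^ 'd::finite \<Rightarrow> complex) \<Rightarrow> 'd distribution" where
  "dist_of_fun f \<phi> = (LINT x|lborel. f x * \<phi> x)"

definition is_fun_of :: "(real ^ 'd::finite \<Rightarrow> complex) \<Rightarrow> 'd distribution \<Rightarrow> bool" where
  "is_fun_of f T \<longleftrightarrow> f \<in> borel_measurable lborel \<and>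
     (\<forall>\<phi>\<in>schwartz. integrable lborel (\<lambda>x. f x * \<phi> x) \<and> T \<phi> = dist_of_fun f \<phi>)"

text \<open>
  The function that a regular distribution is identified with (unique almost everywhere).
\<close>

definition fun_of_dist :: "'d::finite distribution \<Rightarrow> real ^ 'd \<Rightarrow> complex" where
  "fun_of_dist T = (SOME f. is_fun_of f T)"

definition fourier :: "(real ^ 'd::finite \<Rightarrow> complex) \<Rightarrow> real ^ 'd \<Rightarrow> complex" where
  "fourier f k = complex_of_real ((2 * pi) powr (- (real CARD('d) / 2))) *
     (LINT x|lborel. exp (- \<i> * complex_of_real (k \<bullet> x)) * f x)"

definition fourier_dist :: "'d::finite distribution \<Rightarrow> 'd distribution" where
  "fourier_dist T \<phi> = T (fourier \<phi>)"


section \<open>Sobolev spaces and the sharp constant\<close>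

definition in_L2 :: "(real ^ 'd::finite \<Rightarrow> complex) \<Rightarrow> bool" where
  "in_L2 h \<longleftrightarrow> h \<in> borel_measurable lborel \<and> integrable lborel (\<lambda>x. (norm (h x))\<^sup>2)"

definition L2_norm :: "(real ^ 'd::finite \<Rightarrow> complex) \<Rightarrow> real" where
  "L2_norm h = sqrt (LINT x|lborel. (norm (h x))\<^sup>2)"

definition weighted_fourier :: "real \<Rightarrow> 'd::finite distribution \<Rightarrow> real ^ 'd \<Rightarrow> complex" where
  "weighted_fourier l T k = (1 + (norm k)\<^sup>2) powr (l / 2) *\<^sub>R fun_of_dist (fourier_dist T) k"

definition sobolev :: "real \<Rightarrow> 'd::finite distribution set" where
  "sobolev l = {T \<in> tempered. (\<exists>h. is_fun_of h (fourier_dist T)) \<and> in_L2 (weighted_fourier l T)}"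

definition sobolev_norm :: "real \<Rightarrow> 'd::finite distribution \<Rightarrow> real" where
  "sobolev_norm l T = L2_norm (weighted_fourier l T)"

text \<open>
  The pointwise product. For \<open>m, n \<ge> 0\<close> the elements of \<open>sobolev m\<close> and \<open>sobolev n\<close> are
  square-integrable functions, so that their product is an integrable function and thus again a
  tempered distribution.
\<close>

definition dist_times :: "'d::finite distribution \<Rightarrow> 'd distribution \<Rightarrow> 'd distribution" where
  "dist_times F G = dist_of_fun (\<lambda>x. fun_of_dist F x * fun_of_dist G x)"

text \<open>
  The inequality \<open>\<parallel>fg\<parallel>\<^sub>l \<le> K \<parallel>f\<parallel>\<^sub>m \<parallel>g\<parallel>\<^sub>n\<close> includes that \<open>fg\<close> has a norm of order \<open>l\<close>, that is, that
  it belongs to \<open>sobolev l\<close>. The set of these \<open>K\<close> is nonempty and has a minimum if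
  \<open>0 \<le> l \<le> m \<le> n\<close> and \<open>m + n - l > d / 2\<close>; otherwise the value is not meaningful.
\<close>

definition sharp_const :: "'d::finite itself \<Rightarrow> real \<Rightarrow> real \<Rightarrow> real \<Rightarrow> real" where
  "sharp_const _ l m n = (LEAST K. 0 \<le> K \<and>
     (\<forall>F \<in> (sobolev m :: 'd distribution set). \<forall>G \<in> sobolev n.
        dist_times F G \<in> sobolev l \<and>
        sobolev_norm l (dist_times F G) \<le> K * sobolev_norm m F * sobolev_norm n G))"


section \<open>The hypergeometric upper bound\<close>

definition real_analytic_on :: "(real \<Rightarrow> real) \<Rightarrow> real set \<Rightarrow> bool" where
  "real_analytic_on f S \<longleftrightarrow> (\<forall>x\<in>S. \<exists>F. (\<lambda>h. f (x + h)) has_fps_expansion F)"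

text \<open>
  The continuation to \<open>(-\<infinity>, 1)\<close> is unique there by the identity theorem; the choice only affects
  the values at arguments \<open>\<ge> 1\<close>.
\<close>

definition hyp3F2 :: "real \<Rightarrow> real \<Rightarrow> real \<Rightarrow> real \<Rightarrow> real \<Rightarrow> real \<Rightarrow> real" where
  "hyp3F2 a1 a2 a3 b1 b2 = (SOME g. real_analytic_on g {..<1} \<and>
     (\<forall>w\<in>{-1<..<1}. (\<lambda>k. pochhammer a1 k * pochhammer a2 k * pochhammer a3 k /
        (pochhammer b1 k * pochhammer b2 k * fact k) * w ^ k) sums g w))"

definition scrS :: "real \<Rightarrow> real \<Rightarrow> real \<Rightarrow> nat \<Rightarrow> real \<Rightarrow> real" where
  "scrS l m n d u =
     Gamma (m + n - d / 2) / ((4 * pi) powr (d / 2) * Gamma (m + n)) * (1 + 4 * u) powr l *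
     hyp3F2 (m + n - d / 2) m n ((m + n) / 2) ((m + n + 1) / 2) (- u)"

text \<open>
  The suprema over \<open>u\<close> below are taken in the reals. The functions are bounded on \<open>[0, \<infinity>)\<close> if
  \<open>0 \<le> l \<le> m \<le> n\<close> and \<open>m + n - l > d / 2\<close>, which holds for \<open>(l, 2l, 3l)\<close> and large \<open>l\<close>.
\<close>

definition upper_KS :: "real \<Rightarrow> real \<Rightarrow> real \<Rightarrow> nat \<Rightarrow> real" where
  "upper_KS l m n d = sqrt (SUP u\<in>{0..}. scrS l m n d u)"

definition Sigma23 :: "nat \<Rightarrow> real \<Rightarrow> real \<Rightarrow> real" where
  "Sigma23 d l u = (1 + 4 * u) powr l *
     hyp3F2 (5 * l - d / 2) (2 * l) (3 * l) (5 * l / 2) ((5 * l + 1) / 2) (- u)"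

definition condition_S23 :: "nat \<Rightarrow> bool" where
  "condition_S23 d \<longleftrightarrow> (\<exists>\<epsilon>\<in>O[at_top](\<lambda>l. 1 / l). \<forall>\<^sub>F l in at_top.
     (SUP u\<in>{0..}. Sigma23 d l u) = 1 + \<epsilon> l)"


section \<open>The Gaussian lower bound\<close>

definition gaussian :: "real \<Rightarrow> real ^ 'd::finite \<Rightarrow> complex" where
  "gaussian \<sigma> x = complex_of_real (exp (- (\<sigma> * (norm x)\<^sup>2 / 2)))"

definition lower_KF :: "'d::finite itself \<Rightarrow> real \<Rightarrow> real \<Rightarrow> real \<Rightarrow> real \<Rightarrow> real \<Rightarrow> real" where
  "lower_KF _ l m n \<sigma> \<tau> =
     sobolev_norm l (dist_of_fun (gaussian (\<sigma> + \<tau>) :: real ^ 'd \<Rightarrow> complex)) /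
     (sobolev_norm m (dist_of_fun (gaussian \<sigma> :: real ^ 'd \<Rightarrow> complex)) *
      sobolev_norm n (dist_of_fun (gaussian \<tau> :: real ^ 'd \<Rightarrow> complex)))"

definition Delta23 :: "(real \<times> real) set" where
  "Delta23 = {(\<xi>, \<eta>). 0 < \<xi> \<and> \<xi> < 1 / 2 \<and> 0 < \<eta> \<and> \<eta> < 1 / 3 \<and> \<xi> + \<eta> < 1}"

definition D23 :: "real \<Rightarrow> real \<Rightarrow> real" where
  "D23 \<xi> \<eta> = ((1 - \<xi> - \<eta>) * (\<xi> + \<eta>)) / (\<xi> * \<eta> * (1 - 2 * \<xi>) * (1 - 3 * \<eta>))"

end

theory Submission
  imports Defs "HOL-Probability.Probability"
begin

text \<open>
  The upper and the lower bound for the sharp constant have different origins.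

  For the upper bound, the product of two functions becomes the convolution of their Fourier
  transforms. Cauchy-Schwarz with the weights \<open>(1 + |k|\<^sup>2)\<^sup>m\<close> and \<open>(1 + |k|\<^sup>2)\<^sup>n\<close> bounds the norm of order
  \<open>l\<close> of the product by \<open>\<parallel>f\<parallel>\<^sub>m \<parallel>g\<parallel>\<^sub>n\<close> times the square root of the supremum over \<open>k\<close> of
  \<open>(2\<pi>)\<^sup>-\<^sup>d (1 + |k|\<^sup>2)\<^sup>l \<integral> (1 + |k - h|\<^sup>2)\<^sup>-\<^sup>m (1 + |h|\<^sup>2)\<^sup>-\<^sup>n dh\<close>
  (\<open>sobolev_product\<close>). A Feynman parametrisation reduces this integral to one over \<open>[0, 1]\<close>
  (\<open>conv_kernel_eq\<close>), which is an Euler integral for the continued hypergeometric function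
  (\<open>hyp3F2_eq_integral\<close>). Hence the expression is \<open>scrS\<close> at \<open>u = |k|\<^sup>2 / 4\<close>, and \<open>upper_KS\<close> is
  admissible in the definition of \<open>sharp_const\<close> (\<open>upper_KS_product_bound\<close>). This also shows that
  the least constant exists. Under the condition on the supremum only the quotient
  \<open>Gamma (5l - d/2) / Gamma (5l)\<close> is left, whose asymptotics follow from log-convexity of Gamma.

  For the lower bound, the least constant is tested with two Gaussians, whose product is a Gaussian.
  The squared Sobolev norms are integrals of \<open>(1 + |k|\<^sup>2)\<close> to the power \<open>al\<close> against \<open>exp (- b l |k|\<^sup>2)\<close>, and
  replacing the power by \<open>exp (a l |k|\<^sup>2)\<close> changes them by a factor \<open>1 + O(1/l)\<close>
  (\<open>gauss_moment_bounds\<close>).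

  The definitions speak about tempered distributions, so both arguments rest on two facts about
  Schwartz functions. The Fourier transform maps them onto themselves with the usual inverse
  (\<open>schwartz_fourier\<close>, \<open>fourier_inversion\<close>); hence for \<open>m \<ge> d\<close> the elements of the Sobolev space of
  order \<open>m\<close> are continuous functions with integrable transform. And a distribution is represented
  by at most one function up to null sets (\<open>is_fun_of_unique\<close>), so that \<open>fun_of_dist\<close> selects the
  expected function.
\<close>


section \<open>Lebesgue integrals and Gaussians on \<open>\<real>\<^sup>d\<close>\<close>

lemma Basis_vec_image: "(Basis :: (real^'d::finite) set) = (\<lambda>i. axis i 1) ` UNIV"
  by (auto simp: Basis_vec_def)

text \<open>
  Lebesgue measure is the image of the product of one-dimensional Lebesgue measures, indexed by the
  basis vectors; the proof only moves this index set to \<open>'d\<close>.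
\<close>

lemma integral_vec_prod:
  fixes f :: "'d::finite \<Rightarrow> real \<Rightarrow> complex"
  assumes int: "\<And>i. integrable lborel (f i)"
  shows "has_bochner_integral lborel (\<lambda>x::real^'d. \<Prod>i\<in>UNIV. f i (x $ i)) (\<Prod>i\<in>UNIV. LBINT t. f i t)"
proof -
  interpret product_sigma_finite "\<lambda>_::real^'d. lborel :: real measure" ..
  define ix :: "real^'d \<Rightarrow> 'd" where "ix = inv (\<lambda>i. axis i 1)"
  have inj: "inj (\<lambda>i::'d. axis i (1::real))"
    by (auto simp: inj_def axis_eq_axis)
  have ix: "ix (axis i 1) = i" for i
    unfolding ix_def by (rule inv_f_f[OF inj])
  have reindex: "(\<Prod>b\<in>Basis. h (ix b) (g b)) = (\<Prod>i\<in>UNIV. h i (g (axis i 1)))" for h g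
    unfolding Basis_vec_image by (subst prod.reindex) (auto simp: inj ix)
  have reindex': "(\<Prod>b\<in>Basis. h (ix b)) = (\<Prod>i\<in>UNIV. h i)" for h
    unfolding Basis_vec_image by (subst prod.reindex) (auto simp: inj ix)
  have comp: "(\<Sum>b\<in>Basis. g b *\<^sub>R b) $ i = g (axis i 1)" for g :: "real^'d \<Rightarrow> real" and i
    using inner_sum_left_Basis[of "axis i 1" g]
    by (simp add: inner_axis axis_in_Basis_iff)
  have m[measurable]: "f i \<in> borel_measurable borel" for i
    using borel_measurable_integrable[OF int[of i]] by simp
  have Tm: "(\<lambda>f. \<Sum>b\<in>Basis. f b *\<^sub>R b) \<in> (Pi\<^sub>M Basis (\<lambda>b. lborel)) \<rightarrow>\<^sub>M (borel :: (real^'d) measure)"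
    by measurable
  have "integrable (Pi\<^sub>M Basis (\<lambda>_::real^'d. lborel)) (\<lambda>g. \<Prod>b\<in>Basis. f (ix b) (g b))"
    by (intro product_integrable_prod) (auto simp: int)
  moreover have "integral\<^sup>L (Pi\<^sub>M Basis (\<lambda>_::real^'d. lborel)) (\<lambda>g. \<Prod>b\<in>Basis. f (ix b) (g b)) =
      (\<Prod>b\<in>Basis. LBINT t. f (ix b) t)"
    by (intro product_integral_prod) (auto simp: int)
  ultimately have *: "has_bochner_integral (Pi\<^sub>M Basis (\<lambda>_::real^'d. lborel))
     (\<lambda>g. \<Prod>i\<in>UNIV. f i (g (axis i 1))) (\<Prod>i\<in>UNIV. LBINT t. f i t)"
    by (simp add: has_bochner_integral_iff reindex reindex'[of "\<lambda>i. integral\<^sup>L lborel (f i)"])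
  show ?thesis
    by (subst lborel_eq, subst has_bochner_integral_distr[OF _ Tm]) (use * comp in \<open>simp_all\<close>)
qed

lemma nn_integral_vec_affine:
  fixes f :: "real^'d::finite \<Rightarrow> ennreal"
  assumes [measurable]: "f \<in> borel_measurable borel" and "c \<noteq> 0"
  shows "(\<integral>\<^sup>+x. f x \<partial>lborel) = ennreal (\<bar>c\<bar> ^ CARD('d)) * (\<integral>\<^sup>+x. f (t + c *\<^sub>R x) \<partial>lborel)"
  by (subst lborel_affine[OF \<open>c \<noteq> 0\<close>, of t]) (simp add: nn_integral_density nn_integral_distr nn_integral_cmult)

lemma integral_vec_affine:
  fixes f :: "real^'d::finite \<Rightarrow> 'b::{banach, second_countable_topology}"
  assumes [measurable]: "f \<in> borel_measurable borel" and "c \<noteq> 0"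
  shows "(LBINT x. f x) = \<bar>c\<bar> ^ CARD('d) *\<^sub>R (LBINT x. f (t + c *\<^sub>R x))"
  by (subst lborel_affine[OF \<open>c \<noteq> 0\<close>, of t]) (simp add: integral_density integral_distr)

lemma integrable_vec_affine:
  fixes f :: "real^'d::finite \<Rightarrow> 'b::{banach, second_countable_topology}"
  assumes f: "integrable lborel f" and "c \<noteq> 0"
  shows "integrable lborel (\<lambda>x. f (t + c *\<^sub>R x))"
proof -
  have [measurable]: "f \<in> borel_measurable borel" using f by auto
  have "integrable (density (distr lborel borel (\<lambda>x. t + c *\<^sub>R x)) (\<lambda>_. ennreal (\<bar>c\<bar>^CARD('d)))) f"
    using f by (subst (asm) lborel_affine[OF \<open>c \<noteq> 0\<close>, of t]) simp
  then have "integrable lborel (\<lambda>x. \<bar>c\<bar> ^ CARD('d) *\<^sub>R f (t + c *\<^sub>R x))"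
    by (simp add: integrable_density integrable_distr_eq)
  from integrable_scaleR_right[OF this, of "1 / \<bar>c\<bar> ^ CARD('d)"] show ?thesis
    using \<open>c \<noteq> 0\<close> by simp
qed

lemma integral_vec_uminus:
  fixes f :: "real^'d::finite \<Rightarrow> 'b::{banach, second_countable_topology}"
  assumes "f \<in> borel_measurable borel"
  shows "(LBINT x. f (- x)) = (LBINT x. f x)"
  using integral_vec_affine[OF assms, of "-1" 0] by simp

lemma integral_vec_translate:
  fixes f :: "real^'d::finite \<Rightarrow> 'b::{banach, second_countable_topology}"
  assumes "f \<in> borel_measurable borel"
  shows "(LBINT x. f (t + x)) = (LBINT x. f x)"
  using integral_vec_affine[OF assms, of 1 t] by simp

text \<open>
  In one dimension this is the characteristic function of the standard normal distribution. The
  \<open>d\<close>-dimensional integral factors over the coordinates, and a dilation gives the general width.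
\<close>

lemma gaussian_char_1dim:
  "has_bochner_integral lborel (\<lambda>x. exp (- \<i> * complex_of_real (k * x)) * complex_of_real (exp (- x\<^sup>2 / 2)))
     (complex_of_real (sqrt (2 * pi) * exp (- k\<^sup>2 / 2)))"
proof -
  have int: "integrable lborel (\<lambda>x. exp (- \<i> * complex_of_real (k * x)) * complex_of_real (exp (- x\<^sup>2 / 2)))"
  proof (rule Bochner_Integration.integrable_bound[OF integrable_mult_left[OF integrable_std_normal_moment[of 0], of "sqrt (2 * pi)"]])
    show "AE x in lborel. cmod (exp (- \<i> * complex_of_real (k * x)) * complex_of_real (exp (- x\<^sup>2 / 2))) \<le> norm (std_normal_density x * x ^ 0 * sqrt (2 * pi))"
      by (auto simp: norm_mult std_normal_density_def)
  qed auto
  have "char std_normal_distribution (-k) = 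
     (LBINT x. std_normal_density x *\<^sub>R iexp (-k * x))"
    unfolding char_def by (subst integral_density) auto
  also have "\<dots> = (LBINT x. exp (- \<i> * complex_of_real (k * x)) * complex_of_real (exp (- x\<^sup>2 / 2)) / complex_of_real (sqrt (2 * pi)))"
    by (intro Bochner_Integration.integral_cong) (auto simp: std_normal_density_def scaleR_conv_of_real)
  also have "\<dots> = (LBINT x. exp (- \<i> * complex_of_real (k * x)) * complex_of_real (exp (- x\<^sup>2 / 2))) / complex_of_real (sqrt (2 * pi))"
    by (rule integral_divide_zero)
  finally have *: "(LBINT x. exp (- \<i> * complex_of_real (k * x)) * complex_of_real (exp (- x\<^sup>2 / 2))) / complex_of_real (sqrt (2 * pi)) = complex_of_real (exp (- k\<^sup>2 / 2))"
    unfolding char_std_normal_distribution by simp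
  have nz: "complex_of_real (sqrt (2 * pi)) \<noteq> 0"
    by simp
  have "(LBINT x. exp (- \<i> * complex_of_real (k * x)) * complex_of_real (exp (- x\<^sup>2 / 2))) = 
     complex_of_real (exp (- k\<^sup>2 / 2)) * complex_of_real (sqrt (2 * pi))"
    by (rule iffD1[OF nonzero_divide_eq_eq[OF nz] *])
  then show ?thesis using int by (simp add: has_bochner_integral_iff mult.commute)
qed

lemma norm_vec_power2: "(norm (x::real^'d::finite))\<^sup>2 = (\<Sum>i\<in>UNIV. (x $ i)\<^sup>2)"
  by (simp add: norm_vec_def L2_set_def sum_nonneg)

lemma gaussian_char_std:
  "has_bochner_integral lborel (\<lambda>x::real^'d::finite. exp (- \<i> * complex_of_real (k \<bullet> x)) * complex_of_real (exp (- (norm x)\<^sup>2 / 2)))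
     (complex_of_real ((2 * pi) powr (CARD('d) / 2) * exp (- (norm k)\<^sup>2 / 2)))"
proof -
  have e: "(\<Prod>i\<in>UNIV. exp (- \<i> * complex_of_real (k$i * x$i)) * complex_of_real (exp (- (x$i)\<^sup>2 / 2))) =
     exp (- \<i> * complex_of_real (k \<bullet> x)) * complex_of_real (exp (- (norm x)\<^sup>2 / 2))" for x :: "real^'d"
  proof -
    have "- \<i> * complex_of_real (k \<bullet> x) = (\<Sum>i\<in>UNIV. - \<i> * complex_of_real (k$i * x$i))"
      unfolding inner_vec_def by (simp only: sum_distrib_left of_real_sum inner_real_def)
    moreover have "- (norm x)\<^sup>2 / 2 = (\<Sum>i\<in>UNIV. - (x$i)\<^sup>2 / 2)"
      unfolding norm_vec_power2 sum_negf[symmetric] sum_divide_distrib ..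
    ultimately show ?thesis
      by (simp only: prod.distrib exp_sum finite of_real_prod)
  qed
  have "sqrt (2 * pi) ^ CARD('d) = (2 * pi) powr (CARD('d) / 2)"
    by (simp add: powr_half_sqrt [symmetric] powr_powr flip: powr_realpow)
  moreover have "- (norm k)\<^sup>2 / 2 = (\<Sum>i\<in>UNIV. - (k$i)\<^sup>2 / 2)"
      unfolding norm_vec_power2 sum_negf[symmetric] sum_divide_distrib ..
  ultimately have "(\<Prod>i\<in>UNIV. sqrt (2 * pi) * exp (- (k$i)\<^sup>2 / 2)) = (2 * pi) powr (CARD('d) / 2) * exp (- (norm k)\<^sup>2 / 2)"
    by (simp only: prod.distrib prod_constant exp_sum finite)
  then have e': "(\<Prod>i\<in>UNIV. complex_of_real (sqrt (2 * pi) * exp (- (k$i)\<^sup>2 / 2))) = complex_of_real ((2 * pi) powr (CARD('d) / 2) * exp (- (norm k)\<^sup>2 / 2))"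
    by (metis of_real_prod)
  show ?thesis
    using integral_vec_prod[of "\<lambda>i t. exp (- \<i> * complex_of_real (k$i * t)) * complex_of_real (exp (- t\<^sup>2 / 2))"]
      gaussian_char_1dim[of "k $ i" for i]
    unfolding has_bochner_integral_iff e by (simp only: e')
qed

lemma gaussian_char:
  fixes k :: "real^'d::finite"
  assumes "\<sigma> > 0"
  shows "has_bochner_integral lborel (\<lambda>x. exp (- \<i> * complex_of_real (k \<bullet> x)) * gaussian \<sigma> x)
     (complex_of_real ((2 * pi / \<sigma>) powr (CARD('d) / 2)) * gaussian (1 / \<sigma>) k)"
proof -
  define c where "c = 1 / sqrt \<sigma>"
  have c: "c > 0" "c * sqrt \<sigma> = 1" "c\<^sup>2 = 1 / \<sigma>" "sqrt \<sigma> > 0" "(sqrt \<sigma>)\<^sup>2 = \<sigma>"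
    using assms by (auto simp: c_def power_divide)
  define f where "f = (\<lambda>x::real^'d. exp (- \<i> * complex_of_real ((c *\<^sub>R k) \<bullet> x)) * complex_of_real (exp (- (norm x)\<^sup>2 / 2)))"
  have F: "integrable lborel f" "integral\<^sup>L lborel f = complex_of_real ((2 * pi) powr (CARD('d) / 2) * exp (- (norm (c *\<^sub>R k))\<^sup>2 / 2))"
    using gaussian_char_std[of "c *\<^sub>R k"] by (simp_all only: f_def has_bochner_integral_iff)
  have m: "f \<in> borel_measurable borel" using F(1) by auto
  have e: "f (0 + sqrt \<sigma> *\<^sub>R x) = exp (- \<i> * complex_of_real (k \<bullet> x)) * gaussian \<sigma> x" for x
  proof -
    have "(c *\<^sub>R k) \<bullet> (sqrt \<sigma> *\<^sub>R x) = k \<bullet> x"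
      using c(2) by (simp add: mult.commute flip: mult.assoc)
    moreover have "(norm (sqrt \<sigma> *\<^sub>R x))\<^sup>2 = \<sigma> * (norm x)\<^sup>2"
      using c(5) by (simp add: power_mult_distrib)
    ultimately show ?thesis by (simp only: f_def gaussian_def add_0_left minus_divide_left)
  qed
  have int: "integrable lborel (\<lambda>x. exp (- \<i> * complex_of_real (k \<bullet> x)) * gaussian \<sigma> x)"
    using integrable_vec_affine[OF F(1), of "sqrt \<sigma>" 0] c(4) unfolding e by simp
  have "\<bar>sqrt \<sigma>\<bar> ^ CARD('d) = \<sigma> powr (CARD('d) / 2)"
    using assms by (simp add: powr_half_sqrt [symmetric] powr_powr flip: powr_realpow)
  with integral_vec_affine[OF m, of "sqrt \<sigma>" 0] c(4) F(2)
  have 1: "\<sigma> powr (CARD('d) / 2) *\<^sub>R (LBINT x. exp (- \<i> * complex_of_real (k \<bullet> x)) * gaussian \<sigma> x) =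
      complex_of_real ((2 * pi) powr (CARD('d) / 2) * exp (- (norm (c *\<^sub>R k))\<^sup>2 / 2))"
    unfolding e by simp
  have 2: "(norm (c *\<^sub>R k))\<^sup>2 = 1 / \<sigma> * (norm k)\<^sup>2"
    using c(3) by (simp add: power_mult_distrib)
  have 3: "(2 * pi / \<sigma>) powr (CARD('d) / 2) = (2 * pi) powr (CARD('d) / 2) / \<sigma> powr (CARD('d) / 2)"
    using assms by (intro powr_divide)
  have 4: "gaussian (1 / \<sigma>) k = complex_of_real (exp (- (1 / \<sigma> * (norm k)\<^sup>2) / 2))"
    unfolding gaussian_def by simp
  have 5: "\<sigma> powr (CARD('d) / 2) > 0" using assms by simp
  have 6: "I = complex_of_real (T / S) * complex_of_real E"
    if "S *\<^sub>R I = complex_of_real (T * E)" "S > 0" for S T E :: real and I :: complex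
    using that by (simp add: scaleR_conv_of_real field_simps)
  have "(LBINT x. exp (- \<i> * complex_of_real (k \<bullet> x)) * gaussian \<sigma> x) = complex_of_real ((2 * pi / \<sigma>) powr (CARD('d) / 2)) * gaussian (1 / \<sigma>) k"
    unfolding 3 4 by (rule 6[OF 1[unfolded 2] 5])
  with int show ?thesis by (simp only: has_bochner_integral_iff simp_thms)
qed

lemma fourier_gaussian:
  fixes k :: "real^'d::finite"
  assumes "\<sigma> > 0"
  shows "fourier (gaussian \<sigma>) k = complex_of_real (\<sigma> powr (- real CARD('d) / 2)) * gaussian (1 / \<sigma>) k"
proof -
  have "fourier (gaussian \<sigma>) k = complex_of_real ((2 * pi) powr - (CARD('d) / 2) * (2 * pi / \<sigma>) powr (CARD('d) / 2)) * gaussian (1 / \<sigma>) k"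
    using gaussian_char[OF assms, of k] by (simp add: fourier_def has_bochner_integral_iff)
  also have "(2 * pi) powr - (CARD('d) / 2) * (2 * pi / \<sigma>) powr (CARD('d) / 2) = \<sigma> powr (- real CARD('d) / 2)"
    using assms by (simp add: powr_divide powr_minus field_simps)
  finally show ?thesis .
qed

lemma integral_gaussian:
  assumes "\<sigma> > 0"
  shows "has_bochner_integral lborel (\<lambda>x::real^'d::finite. exp (- \<sigma> * (norm x)\<^sup>2)) ((pi / \<sigma>) powr (CARD('d) / 2))"
proof -
  have "has_bochner_integral lborel (\<lambda>x::real^'d. Re (exp (- \<i> * complex_of_real (0 \<bullet> x)) * gaussian (2 * \<sigma>) x))
     (Re (complex_of_real ((2 * pi / (2 * \<sigma>)) powr (CARD('d) / 2)) * gaussian (1 / (2 * \<sigma>)) (0::real^'d)))"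
    using gaussian_char[of "2 * \<sigma>" "0 :: real^'d"] assms
    by (auto simp only: has_bochner_integral_iff integral_Re integrable_Re)
  then show ?thesis using assms by (simp add: gaussian_def)
qed

section \<open>Schwartz functions\<close>

definition rapid :: "(real^'d::finite \<Rightarrow> complex) \<Rightarrow> bool" where
  "rapid f \<longleftrightarrow> (\<forall>N::nat. \<exists>C. \<forall>x. (1 + norm x) ^ N * norm (f x) \<le> C)"

lemma rapid_bounded_iff:
  "rapid f \<longleftrightarrow> (\<forall>N::nat. bounded (range (\<lambda>x. (1 + norm x) ^ N *\<^sub>R f x)))"
  by (simp add: rapid_def bounded_iff)

lemma partials_Nil [simp]: "partials [] f = f"
  and partials_Cons [simp]: "partials (i # is) f = partial i (partials is f)"
  and partials_snoc: "partials (is @ [i]) f = partials is (partial i f)"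
  by (simp_all add: partials_def)

text \<open>
  The Schwartz functions are the greatest set of differentiable, rapidly decreasing functions that is
  closed under partial derivatives. All closure properties below are instances of this coinduction,
  which avoids any computation with iterated derivatives.
\<close>

lemma schwartz_coinduct:
  assumes "f \<in> S"
    and "\<And>g x. g \<in> S \<Longrightarrow> g differentiable (at x)"
    and "\<And>g. g \<in> S \<Longrightarrow> rapid g"
    and "\<And>g i. g \<in> S \<Longrightarrow> partial i g \<in> S"
  shows "f \<in> schwartz"
proof -
  have "partials is f \<in> S" for "is"
    by (induction "is") (auto intro: assms)
  then show ?thesis
    using assms(2,3) by (auto simp: schwartz_def rapid_bounded_iff)
qed

lemma schwartz_differentiable: "f \<in> schwartz \<Longrightarrow> f differentiable (at x)"
  by (auto simp: schwartz_def dest!: spec[of _ "[]"])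

lemma schwartz_rapid: "f \<in> schwartz \<Longrightarrow> rapid f"
  by (auto simp: schwartz_def rapid_bounded_iff dest!: spec[of _ "[]"])

lemma schwartz_partial: 
  assumes "f \<in> schwartz" shows "partial i f \<in> schwartz"
  unfolding schwartz_def using assms
  by (auto simp: schwartz_def partials_snoc[symmetric])

lemma partial_eqI: "(f has_derivative f') (at x) \<Longrightarrow> partial i f x = f' (axis i 1)"
  unfolding partial_def using frechet_derivative_at by metis

lemma schwartz_has_derivative:
  "f \<in> schwartz \<Longrightarrow> (f has_derivative frechet_derivative f (at x)) (at x)"
  using schwartz_differentiable frechet_derivative_works by blast

lemma schwartz_continuous: "f \<in> schwartz \<Longrightarrow> continuous_on UNIV f"
  by (intro differentiable_imp_continuous_on)
     (auto simp: differentiable_on_def schwartz_differentiable)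

lemma schwartz_measurable [measurable_dest]: "f \<in> schwartz \<Longrightarrow> f \<in> borel_measurable borel"
  by (intro borel_measurable_continuous_onI schwartz_continuous)

lemma rapid_add:
  assumes "rapid f" "rapid g" shows "rapid (\<lambda>x. f x + g x)"
  unfolding rapid_def
proof
  fix N :: nat
  obtain C D where C: "\<And>x. (1 + norm x) ^ N * norm (f x) \<le> C"
    and D: "\<And>x. (1 + norm x) ^ N * norm (g x) \<le> D"
    using assms unfolding rapid_def by metis
  have "(1 + norm x) ^ N * norm (f x + g x) \<le> C + D" for x
    using C[of x] D[of x] mult_left_mono[OF norm_triangle_ineq[of "f x" "g x"], of "(1 + norm x) ^ N"]
    by (simp add: distrib_left)
  then show "\<exists>C. \<forall>x. (1 + norm x) ^ N * norm (f x + g x) \<le> C" by blast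
qed

lemma rapid_le_poly:
  assumes "rapid f" "\<And>x. norm (g x) \<le> K * (1 + norm x) ^ M * norm (f x)" "K \<ge> 0"
  shows "rapid g"
  unfolding rapid_def
proof
  fix N :: nat
  obtain C where C: "\<And>x. (1 + norm x) ^ (N + M) * norm (f x) \<le> C"
    using assms unfolding rapid_def by metis
  have "(1 + norm x) ^ N * norm (g x) \<le> K * C" for x
  proof -
    have "(1 + norm x) ^ N * norm (g x) \<le> (1 + norm x) ^ N * (K * (1 + norm x) ^ M * norm (f x))"
      by (intro mult_left_mono assms) auto
    also have "\<dots> = K * ((1 + norm x) ^ (N + M) * norm (f x))"
      by (simp add: power_add mult_ac)
    also have "\<dots> \<le> K * C" by (intro mult_left_mono C assms)
    finally show ?thesis .
  qed
  then show "\<exists>C. \<forall>x. (1 + norm x) ^ N * norm (g x) \<le> C" by blast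
qed

lemma rapid_cmult: 
  fixes c :: complex
  shows "rapid f \<Longrightarrow> rapid (\<lambda>x. c * f x)"
  by (rule rapid_le_poly[where K="norm c" and M=0]) (auto simp: norm_mult)

lemma rapid_coord:
  fixes f :: "real^'d::finite \<Rightarrow> complex"
  shows "rapid f \<Longrightarrow> rapid (\<lambda>x. complex_of_real (x $ i) * f x)"
proof (rule rapid_le_poly[where K=1 and M=1])
  fix x :: "real^'d"
  have "\<bar>x $ i\<bar> \<le> 1 + norm x" using component_le_norm_cart[of x i] by simp
  then show "norm (complex_of_real (x $ i) * f x) \<le> 1 * (1 + norm x) ^ 1 * norm (f x)"
    by (simp add: norm_mult mult_right_mono)
qed auto

lemma schwartz_zero: "(\<lambda>x. 0) \<in> schwartz"
proof (rule schwartz_coinduct[of _ "{\<lambda>x. 0}"])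
  show "partial i g \<in> {\<lambda>x. 0}" if "g \<in> {\<lambda>x. 0}" for i and g :: "real^'a \<Rightarrow> complex"
    proof -
    have "g = (\<lambda>x. 0)" using that by simp
    moreover have "partial i (\<lambda>x::real^'a. 0 :: complex) = (\<lambda>x. 0)"
      using partial_eqI[of "\<lambda>_. 0" "\<lambda>_. 0" _ i] by (intro ext) simp
    ultimately show ?thesis by simp
  qed
qed (auto simp: rapid_def)

lemma partial_lincomb:
  assumes "f differentiable (at x)" "g differentiable (at x)"
  shows "(\<lambda>x. c * f x + g x) differentiable (at x)"
    and "partial i (\<lambda>x. c * f x + g x) x = c * partial i f x + partial i g x"
proof -
  have "((\<lambda>x. c * f x + g x) has_derivative
    (\<lambda>h. c * frechet_derivative f (at x) h + frechet_derivative g (at x) h)) (at x)"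
    using assms by (intro derivative_intros) (auto simp: frechet_derivative_works)
  then show "(\<lambda>x. c * f x + g x) differentiable (at x)"
    "partial i (\<lambda>x. c * f x + g x) x = c * partial i f x + partial i g x"
    using partial_eqI by (auto simp: differentiable_def partial_def)
qed

lemma partial_coord:
  fixes f :: "real^'d::finite \<Rightarrow> complex"
  assumes "f differentiable (at x)"
  shows "(\<lambda>x. complex_of_real (x $ j) * f x) differentiable (at x)"
    and "partial i (\<lambda>x. complex_of_real (x $ j) * f x) x
      = complex_of_real (axis i 1 $ j) * f x + complex_of_real (x $ j) * partial i f x"
proof -
  have "((\<lambda>x::real^'d. complex_of_real (x $ j)) has_derivative (\<lambda>h. complex_of_real (h $ j))) (at x)"
    by (intro bounded_linear_imp_has_derivative
        bounded_linear_compose[OF bounded_linear_of_real bounded_linear_vec_nth])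
  then have der: "((\<lambda>x. complex_of_real (x $ j) * f x) has_derivative (\<lambda>h. complex_of_real (x $ j) *
      frechet_derivative f (at x) h + complex_of_real (h $ j) * f x)) (at x)"
    using assms by (intro has_derivative_mult) (simp_all add: frechet_derivative_works[symmetric])
  then show "(\<lambda>x. complex_of_real (x $ j) * f x) differentiable (at x)"
    unfolding differentiable_def by blast
  show "partial i (\<lambda>x. complex_of_real (x $ j) * f x) x
      = complex_of_real (axis i 1 $ j) * f x + complex_of_real (x $ j) * partial i f x"
    using partial_eqI[OF der, of i] by (simp add: partial_def)
qed

lemma schwartz_lincomb:
  assumes "f \<in> schwartz" "g \<in> schwartz"
  shows "(\<lambda>x. c * f x + g x) \<in> schwartz"
proof -
  let ?S = "{\<lambda>x. c * f x + g x | f g. f \<in> schwartz \<and> g \<in> schwartz}"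
  have S: "(\<lambda>x. c * f x + g x) \<in> ?S" if "f \<in> schwartz" "g \<in> schwartz" for f g :: "real^'a \<Rightarrow> complex"
    using that by blast
  show ?thesis
  proof (rule schwartz_coinduct[of _ ?S])
    fix h :: "real^'a \<Rightarrow> complex" assume "h \<in> ?S"
    then obtain f g where h: "h = (\<lambda>x. c * f x + g x)" "f \<in> schwartz" "g \<in> schwartz" by blast
    show "h differentiable (at x)" for x
      unfolding h(1) by (intro partial_lincomb schwartz_differentiable h)
    show "rapid h" unfolding h(1) by (intro rapid_add rapid_cmult schwartz_rapid h)
    have "partial i h = (\<lambda>x. c * partial i f x + partial i g x)" for i
      unfolding h(1) by (intro ext partial_lincomb schwartz_differentiable h)
    then show "partial i h \<in> ?S" for i using S[OF schwartz_partial schwartz_partial] h by simp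
  qed (rule S[OF assms])
qed

lemma schwartz_add: "f \<in> schwartz \<Longrightarrow> g \<in> schwartz \<Longrightarrow> (\<lambda>x. f x + g x) \<in> schwartz"
  using schwartz_lincomb[of f g 1] by simp

lemma schwartz_cmult: "f \<in> schwartz \<Longrightarrow> (\<lambda>x. c * f x) \<in> schwartz"
  using schwartz_lincomb[of f "\<lambda>_. 0" c] schwartz_zero by simp

lemma schwartz_coord:
  fixes f :: "real^'d::finite \<Rightarrow> complex"
  assumes "f \<in> schwartz"
  shows "(\<lambda>x. complex_of_real (x $ j) * f x) \<in> schwartz"
proof -
  \<comment> \<open>Differentiating a multiple of a coordinate leaves a Schwartz remainder, so the coinduction
    needs the sums of such multiples and Schwartz functions.\<close>
  let ?m = "\<lambda>f x. complex_of_real (x $ j) * f x"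
  let ?S = "{\<lambda>x. 1 * ?m f x + g x | f g. f \<in> schwartz \<and> g \<in> schwartz}"
  have S: "(\<lambda>x. 1 * ?m f x + g x) \<in> ?S" if "f \<in> schwartz" "g \<in> schwartz" for f g :: "real^'d \<Rightarrow> complex"
    using that by blast
  show ?thesis
  proof (rule schwartz_coinduct[of _ ?S])
    fix h :: "real^'d \<Rightarrow> complex" assume "h \<in> ?S"
    then obtain f g where h: "h = (\<lambda>x. 1 * ?m f x + g x)" "f \<in> schwartz" "g \<in> schwartz" by blast
    show "h differentiable (at x)" for x
      unfolding h(1) by (intro partial_lincomb partial_coord schwartz_differentiable h)
    show "rapid h" unfolding h(1) by (intro rapid_add rapid_cmult rapid_coord schwartz_rapid h)
    have "partial i h x = 1 * ?m (partial i f) x + (complex_of_real (axis i 1 $ j) * f x + partial i g x)" for i x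
      unfolding h(1) using h(2,3)
      by (simp only: partial_lincomb partial_coord schwartz_differentiable) (simp add: algebra_simps)
    then have "partial i h = (\<lambda>x. 1 * ?m (partial i f) x + (complex_of_real (axis i 1 $ j) * f x + partial i g x))" for i
      by (intro ext)
    then show "partial i h \<in> ?S" for i
      using S[OF schwartz_partial schwartz_lincomb[OF _ schwartz_partial]] h(2,3) by simp
  qed (use S[OF assms schwartz_zero] in simp)
qed

lemma schwartz_uminus:
  assumes "f \<in> schwartz"
  shows "(\<lambda>x. f (- x)) \<in> schwartz"
proof (rule schwartz_coinduct[of _ "{\<lambda>x. f (- x) | f. f \<in> schwartz}"])
  have der: "((\<lambda>x. f (- x)) has_derivative
    (\<lambda>h. frechet_derivative f (at (- x)) (- h))) (at x)"
    if "f \<in> schwartz" for f :: "real^'a \<Rightarrow> complex" and x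
    using has_derivative_compose[OF has_derivative_minus[OF has_derivative_ident] schwartz_has_derivative[OF that]]
    by simp
  fix h :: "real^'a \<Rightarrow> complex" assume "h \<in> {\<lambda>x. f (- x) | f. f \<in> schwartz}"
  then obtain f where h: "h = (\<lambda>x. f (- x))" "f \<in> schwartz" by blast
  show "h differentiable (at x)" for x
    using der[OF h(2)] unfolding h(1) differentiable_def by blast
  show "rapid h" unfolding h(1) rapid_def
  proof
    fix N :: nat
    obtain C where C: "\<And>x. (1 + norm x) ^ N * norm (f x) \<le> C"
      using schwartz_rapid[OF h(2)] unfolding rapid_def by metis
    show "\<exists>C. \<forall>x. (1 + norm x) ^ N * norm (f (- x)) \<le> C"
      using C[of "- x" for x] by auto
  qed
  have "linear (frechet_derivative f (at x))" for x
    using schwartz_has_derivative[OF h(2)] has_derivative_linear by blast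
  then have "partial i h = (\<lambda>x. - 1 * partial i f (- x))" for i
    using partial_eqI[OF der[OF h(2)]] unfolding h(1) by (auto simp: partial_def linear_neg)
  moreover have "(\<lambda>x. - 1 * partial i f x) \<in> schwartz" for i
    using schwartz_cmult[OF schwartz_partial[OF h(2)], of "-1" i] .
  ultimately show "partial i h \<in> {\<lambda>x. f (- x) | f. f \<in> schwartz}" for i
    by (intro CollectI exI[of _ "\<lambda>x. - 1 * partial i f x"]) simp
qed (use assms in blast)

lemma integrable_inverse_square: "integrable lborel (\<lambda>t::real. 1 / (1 + t\<^sup>2))"
proof -
  have "set_integrable lborel (einterval (- \<infinity>) \<infinity>) (\<lambda>x. inverse (1 + x\<^sup>2))"
    by (rule integrable_inverse_1_plus_square)
  then show ?thesis by (simp add: set_integrable_def einterval_def inverse_eq_divide)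
qed

lemma one_plus_norm_power_ge:
  "(\<Prod>i\<in>UNIV. 1 + (x $ i)\<^sup>2) \<le> (1 + norm (x::real^'d::finite)) ^ (2 * CARD('d))"
proof -
  have "1 + (x $ i)\<^sup>2 \<le> (1 + norm x)\<^sup>2" for i
  proof -
    have "(x $ i)\<^sup>2 \<le> (norm x)\<^sup>2" using component_le_norm_cart[of x i]
      by (metis abs_norm_cancel abs_le_square_iff)
    then show ?thesis by (simp add: power2_sum add_increasing2)
  qed
  then have "(\<Prod>i\<in>UNIV. 1 + (x $ i)\<^sup>2) \<le> (\<Prod>i\<in>(UNIV::'d set). (1 + norm x)\<^sup>2)"
    by (intro prod_mono) auto
  then show ?thesis by (simp add: power_mult)
qed

text \<open>
  A convenient integrable majorant: it is a product over the coordinates, and it dominates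
  \<open>(1 + |x|)\<close> to the power \<open>-2d\<close>.
\<close>

definition decay :: "real^'d::finite \<Rightarrow> real" where
  "decay x = (\<Prod>i\<in>UNIV. 1 / (1 + (x $ i)\<^sup>2))"

lemma integrable_decay: "integrable lborel (decay :: real^'d::finite \<Rightarrow> real)"
proof -
  have "integrable lborel (\<lambda>t::real. complex_of_real (1 / (1 + t\<^sup>2)))"
    by (intro integrable_of_real integrable_inverse_square)
  then have "integrable lborel (\<lambda>x::real^'d. \<Prod>i\<in>UNIV. complex_of_real (1 / (1 + (x $ i)\<^sup>2)))"
    using integral_vec_prod[of "\<lambda>i::'d. \<lambda>t. complex_of_real (1 / (1 + t\<^sup>2))"]
    by (auto simp only: has_bochner_integral_iff)
  then have "integrable lborel (\<lambda>x::real^'d. complex_of_real (decay x))"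
    by (simp only: decay_def of_real_prod)
  from integrable_Re[OF this] show ?thesis by simp
qed

lemma decay_pos: "decay x > 0"
  unfolding decay_def by (intro prod_pos) (auto intro!: divide_pos_pos add_pos_nonneg)

lemma norm_le_decay:
  fixes f :: "real^'d::finite \<Rightarrow> complex"
  assumes "(1 + norm x) ^ (2 * CARD('d)) * norm (f x) \<le> C"
  shows "norm (f x) \<le> C * decay x"
proof -
  have pos: "(\<Prod>i\<in>UNIV. 1 + (x $ i)\<^sup>2) > 0" by (intro prod_pos) (auto intro: add_pos_nonneg)
  have "(\<Prod>i\<in>UNIV. 1 + (x $ i)\<^sup>2) * norm (f x) \<le> (1 + norm x) ^ (2 * CARD('d)) * norm (f x)"
    by (intro mult_right_mono one_plus_norm_power_ge) auto
  also have "\<dots> \<le> C" by (rule assms)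
  finally show ?thesis using pos by (simp add: decay_def prod_dividef field_simps)
qed

lemma rapid_integrable:
  fixes f :: "real^'d::finite \<Rightarrow> complex"
  assumes [measurable]: "f \<in> borel_measurable borel" and "rapid f"
  shows "integrable lborel f"
proof -
  obtain C where C: "\<And>x. (1 + norm x) ^ (2 * CARD('d)) * norm (f x) \<le> C"
    using assms(2) unfolding rapid_def by metis
  show ?thesis
    by (rule Bochner_Integration.integrable_bound[OF integrable_mult_right[OF integrable_decay, of C]])
       (auto intro!: order.trans[OF norm_le_decay[OF C]])
qed

lemma schwartz_integrable: "f \<in> schwartz \<Longrightarrow> integrable lborel f"
  by (intro rapid_integrable schwartz_measurable schwartz_rapid)

lemma schwartz_bounded: "f \<in> schwartz \<Longrightarrow> \<exists>C. \<forall>x. norm (f x) \<le> C"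
  using schwartz_rapid[of f] unfolding rapid_def by (metis power_0 mult_1)

lemma power_le_fact_exp:
  assumes "x \<ge> (0::real)" shows "x ^ n \<le> fact n * exp x"
proof -
  have "sum (\<lambda>k. x ^ k /\<^sub>R fact k) {n} \<le> (\<Sum>k. x ^ k /\<^sub>R fact k)"
    using assms by (intro sum_le_suminf summable_exp_generic) auto
  then show ?thesis by (simp add: exp_def field_simps)
qed

text \<open>
  If the partial derivatives of a function are polynomial multiples of it, then so are those of every
  polynomial multiple of it.
\<close>

inductive_set polynomial_multiples :: "(real^'d::finite \<Rightarrow> complex) \<Rightarrow> (real^'d \<Rightarrow> complex) set"
  for G where
  self: "G \<in> polynomial_multiples G"
| lincomb: "f \<in> polynomial_multiples G \<Longrightarrow> h \<in> polynomial_multiples G \<Longrightarrow>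
    (\<lambda>x. c * f x + h x) \<in> polynomial_multiples G"
| coord: "f \<in> polynomial_multiples G \<Longrightarrow> (\<lambda>x. complex_of_real (x $ i) * f x) \<in> polynomial_multiples G"

lemma schwartz_if_partials_polynomial_multiples:
  assumes G: "\<And>x. G differentiable (at x)" "rapid G" "\<And>i. partial i G \<in> polynomial_multiples G"
  shows "G \<in> schwartz"
proof (rule schwartz_coinduct[OF polynomial_multiples.self])
  have main: "(\<forall>x. f differentiable (at x)) \<and> rapid f \<and> (\<forall>i. partial i f \<in> polynomial_multiples G)"
    if "f \<in> polynomial_multiples G" for f
    using that
  proof induction
    case (lincomb f h c)
    then have "partial i (\<lambda>x. c * f x + h x) = (\<lambda>x. c * partial i f x + partial i h x)" for i
      by (intro ext partial_lincomb) auto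
    with lincomb show ?case
      by (auto intro!: partial_lincomb rapid_add rapid_cmult polynomial_multiples.lincomb)
  next
    case (coord f j)
    then have "partial i (\<lambda>x. complex_of_real (x $ j) * f x)
        = (\<lambda>x. complex_of_real (axis i 1 $ j) * f x + complex_of_real (x $ j) * partial i f x)" for i
      by (intro ext partial_coord) auto
    with coord show ?case
      by (auto intro!: partial_coord rapid_coord polynomial_multiples.lincomb polynomial_multiples.coord)
  qed (use G in auto)
  fix f assume "f \<in> polynomial_multiples G"
  from main[OF this] show "f differentiable (at x)" "rapid f" "partial i f \<in> polynomial_multiples G" for x i
    by auto
qed

text \<open>
  The product of a Gaussian centred at \<open>0\<close> with one centred at \<open>x0\<close>. In this form it
  tests functions \<open>u\<close> that need not be integrable: the first factor makes \<open>u\<close> integrable, and the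
  second one serves as an approximate identity at \<open>x0\<close>.
\<close>

lemma schwartz_exp_gaussian:
  fixes x0 :: "real^'d::finite"
  assumes a: "a > 0" and b: "b \<ge> 0"
  shows "(\<lambda>y. complex_of_real (exp (- (a * (norm y)\<^sup>2 + b * (norm (y - x0))\<^sup>2)))) \<in> schwartz"
    (is "?g \<in> _")
proof -
  define G where "G = ?g"
  have derG: "(G has_derivative (\<lambda>h. complex_of_real (exp (- (a * (norm y)\<^sup>2 + b * (norm (y - x0))\<^sup>2)) *
     - (a * (2 * (y \<bullet> h)) + b * (2 * ((y - x0) \<bullet> h)))))) (at y)" for y
  proof -
    have n: "((\<lambda>y::real^'d. (norm (y - c))\<^sup>2) has_derivative (\<lambda>h. 2 * ((y - c) \<bullet> h))) (at y)" for c
      unfolding power2_norm_eq_inner by (auto intro!: derivative_eq_intros simp: inner_commute)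
    have n0: "((\<lambda>y::real^'d. (norm y)\<^sup>2) has_derivative (\<lambda>h. 2 * (y \<bullet> h))) (at y)"
      using n[of 0] by simp
    show ?thesis unfolding G_def
      by (intro has_derivative_of_real has_derivative_eq_rhs[OF has_derivative_exp[OF has_derivative_minus[OF has_derivative_add[OF
            has_derivative_mult_right[OF n0] has_derivative_mult_right[OF n]]]]])
         (auto simp: fun_eq_iff mult.commute)
  qed
  have rapidG: "rapid G"
    unfolding rapid_def
  proof
    fix N :: nat
    obtain C where C: "\<And>t::real. t \<ge> 0 \<Longrightarrow> (1 + t) ^ N * exp (- a * t\<^sup>2) \<le> C"
    proof -
      have "(1 + t) ^ N * exp (- a * t\<^sup>2) \<le> fact N * exp (1 + 1 / a)" if "t \<ge> 0" for t
      proof -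
        have "(1 + t) ^ N \<le> fact N * exp (1 + t)"
          using power_le_fact_exp[of "1 + t" N] that by simp
        then have "(1 + t) ^ N * exp (- a * t\<^sup>2) \<le> fact N * exp (1 + t) * exp (- a * t\<^sup>2)"
          by (intro mult_right_mono) auto
        also have "\<dots> = fact N * exp (1 + t - a * t\<^sup>2)" by (simp add: exp_diff exp_minus field_simps)
        also have "\<dots> \<le> fact N * exp (1 + 1 / a)"
        proof -
          have "t - a * t\<^sup>2 \<le> 1 / a"
          proof -
            have "0 \<le> (a * t - 1 / 2)\<^sup>2" by simp
            then have "a * (t - a * t\<^sup>2) \<le> 1" by (simp add: power2_eq_square algebra_simps)
            then show ?thesis using a by (simp add: field_simps)
          qed
          then show ?thesis by simp
        qed
        finally show ?thesis .
      qed
      then show ?thesis using that by blast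
    qed
    have "(1 + norm y) ^ N * norm (G y) \<le> C" for y
    proof -
      have "norm (G y) \<le> exp (- a * (norm y)\<^sup>2)"
        using b by (auto simp: G_def)
      then have "(1 + norm y) ^ N * norm (G y) \<le> (1 + norm y) ^ N * exp (- a * (norm y)\<^sup>2)"
        by (intro mult_left_mono) auto
      also have "\<dots> \<le> C" by (intro C) auto
      finally show ?thesis .
    qed
    then show "\<exists>C. \<forall>y. (1 + norm y) ^ N * norm (G y) \<le> C" by blast
  qed
  have partG: "partial i G \<in> polynomial_multiples G" for i
  proof -
    have eq: "partial i G = (\<lambda>y. complex_of_real (- 2 * (a + b)) * (complex_of_real (y $ i) * G y) +
        (complex_of_real (2 * b * x0 $ i - 1) * G y + G y))"
      using partial_eqI[OF derG, of i] by (auto simp: fun_eq_iff G_def inner_axis algebra_simps)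
    show ?thesis
      unfolding eq by (intro polynomial_multiples.lincomb polynomial_multiples.coord polynomial_multiples.self)
  qed
  have "G \<in> schwartz"
    by (rule schwartz_if_partials_polynomial_multiples) (use derG rapidG partG in \<open>auto simp: differentiable_def\<close>)
  then show ?thesis by (simp add: G_def)
qed

section \<open>Fourier inversion\<close>

definition wave :: "real^'d::finite \<Rightarrow> real^'d \<Rightarrow> complex" where
  "wave k x = exp (- \<i> * complex_of_real (k \<bullet> x))"

lemma norm_wave [simp]: "norm (wave k x) = 1"
  unfolding wave_def by (simp only: norm_exp_eq_Re) simp

lemma wave_add: "wave (k + h) x = wave k x * wave h x"
  by (simp add: wave_def inner_add_left distrib_left flip: exp_add)

lemma wave_add_right: "wave k (x + y) = wave k x * wave k y"
  by (simp add: wave_def inner_add_right distrib_left flip: exp_add)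

lemma wave_0 [simp]: "wave 0 x = 1" "wave k 0 = 1"
  by (simp_all add: wave_def)

lemma wave_commute: "wave k x = wave x k"
  by (simp add: wave_def inner_commute)

lemma wave_minus: "wave (- k) x = wave k (- x)"
  by (simp add: wave_def)

lemma continuous_wave: "continuous_on UNIV (\<lambda>x. wave k x)"
  unfolding wave_def by (intro continuous_intros)

lemma wave_measurable [measurable]: "wave k \<in> borel_measurable borel"
  by (intro borel_measurable_continuous_onI continuous_wave)

lemma wave_measurable2 [measurable]: "(\<lambda>p. wave (fst p) (snd p)) \<in> borel_measurable (borel \<Otimes>\<^sub>M borel)"
  unfolding wave_def borel_prod by (intro borel_measurable_continuous_onI continuous_intros)

abbreviation fourier_factor :: "'d::finite itself \<Rightarrow> real" where
  "fourier_factor _ \<equiv> (2 * pi) powr (- (real CARD('d) / 2))"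

lemma fourier_wave:
  fixes f :: "real^'d::finite \<Rightarrow> complex"
  shows "fourier f k = complex_of_real (fourier_factor TYPE('d)) * (LBINT x. wave k x * f x)"
  by (simp add: fourier_def wave_def)

lemma integrable_wave_mult:
  fixes f :: "real^'d::finite \<Rightarrow> complex"
  assumes "integrable lborel f"
  shows "integrable lborel (\<lambda>x. wave k x * f x)"
  by (rule Bochner_Integration.integrable_bound[OF assms]) (use assms in \<open>auto simp: norm_mult\<close>)

lemma norm_fourier_le:
  fixes f :: "real^'d::finite \<Rightarrow> complex"
  shows "norm (fourier f k) \<le> fourier_factor TYPE('d) * (LBINT x. norm (f x))"
proof -
  have "norm (LBINT x. wave k x * f x) \<le> (LBINT x. norm (wave k x * f x))"
    by (rule integral_norm_bound)
  then show ?thesis by (simp add: fourier_wave norm_mult)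
qed

lemma fourier_translate_arg: "fourier (\<lambda>x. wave h x * f x) k = fourier f (k + h)"
  by (simp add: fourier_wave wave_add mult_ac)

lemma fourier_cmult: "fourier (\<lambda>x. c * f x) k = c * fourier f k"
proof -
  have "(LBINT x. wave k x * (c * f x)) = (LBINT x. c * (wave k x * f x))"
    by (simp add: mult_ac)
  then show ?thesis by (simp add: fourier_wave)
qed

lemma fourier_minus_arg:
  fixes f :: "real^'d::finite \<Rightarrow> complex"
  assumes [measurable]: "f \<in> borel_measurable borel"
  shows "fourier (\<lambda>x. f (- x)) k = fourier f (- k)"
proof -
  have "(LBINT x. wave k x * f (- x)) = (LBINT x. wave (- k) x * f x)"
    using integral_vec_uminus[of "\<lambda>x. wave (- k) x * f x"] by (simp add: wave_minus)
  then show ?thesis by (simp add: fourier_wave)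
qed

lemma fourier_measurable [measurable]:
  fixes f :: "real^'d::finite \<Rightarrow> complex"
  assumes [measurable]: "f \<in> borel_measurable borel"
  shows "fourier f \<in> borel_measurable borel"
proof -
  have "(\<lambda>k. LBINT x. wave k x * f x) \<in> borel_measurable lborel"
    by (rule lborel.borel_measurable_lebesgue_integral) measurable
  then show ?thesis unfolding fourier_wave[abs_def] by simp
qed

lemma fourier_multiplication_formula:
  fixes f g :: "real^'d::finite \<Rightarrow> complex"
  assumes f: "integrable lborel f" and g: "integrable lborel g"
  shows "(LBINT k. fourier f k * g k) = (LBINT x. f x * fourier g x)"
proof -
  have [measurable]: "f \<in> borel_measurable borel" "g \<in> borel_measurable borel" using f g by auto
  have int: "integrable (lborel \<Otimes>\<^sub>M lborel) (\<lambda>(x, k). wave k x * f x * g k)"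
  proof (rule lborel_pair.Fubini_integrable)
    show "(\<lambda>(x, k). wave k x * f x * g k) \<in> borel_measurable (lborel \<Otimes>\<^sub>M lborel)"
      by (subst wave_commute) measurable
    show "AE x in lborel. integrable lborel (\<lambda>k. case (x, k) of (x, k) \<Rightarrow> wave k x * f x * g k)"
    proof (rule AE_I2)
      fix x
      show "integrable lborel (\<lambda>k. case (x, k) of (x, k) \<Rightarrow> wave k x * f x * g k)"
        by (rule Bochner_Integration.integrable_bound[OF integrable_mult_right[OF g, of "f x"]])
           (auto simp: norm_mult wave_commute[of _ x])
    qed
    have "integrable lborel (\<lambda>x. norm (f x) * (LBINT k. norm (g k)))"
      using f by auto
    then show "integrable lborel (\<lambda>x. LBINT k. norm (case (x, k) of (x, k) \<Rightarrow> wave k x * f x * g k))"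
      by (simp add: norm_mult)
  qed
  have "(LBINT k. (LBINT x. wave k x * f x) * g k) = (LBINT k. LBINT x. wave k x * f x * g k)"
    by simp
  also have "\<dots> = (LBINT x. LBINT k. wave k x * f x * g k)"
    by (rule lborel_pair.Fubini_integral[OF int])
  also have "\<dots> = (LBINT x. LBINT k. f x * (wave x k * g k))"
    by (intro Bochner_Integration.integral_cong refl) (simp add: wave_commute mult_ac)
  also have "\<dots> = (LBINT x. f x * (LBINT k. wave x k * g k))"
    by simp
  finally have "(LBINT k. (LBINT x. wave k x * f x) * g k) = (LBINT x. f x * (LBINT k. wave x k * g k))" .
  moreover have "(LBINT k. fourier f k * g k) = complex_of_real (fourier_factor TYPE('d)) * (LBINT k. (LBINT x. wave k x * f x) * g k)"
    by (simp add: fourier_wave mult.assoc)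
  moreover have "(LBINT x. f x * fourier g x) = complex_of_real (fourier_factor TYPE('d)) * (LBINT x. f x * (LBINT k. wave x k * g k))"
  proof -
    have "(LBINT x. f x * fourier g x) = (LBINT x. complex_of_real (fourier_factor TYPE('d)) * (f x * (LBINT k. wave x k * g k)))"
      by (intro Bochner_Integration.integral_cong refl) (simp add: fourier_wave)
    then show ?thesis by simp
  qed
  ultimately show ?thesis by simp
qed

lemma gaussian_measurable [measurable]: "gaussian \<sigma> \<in> borel_measurable borel"
  unfolding gaussian_def[abs_def] by measurable

lemma gaussian_integrable: "\<sigma> > 0 \<Longrightarrow> integrable lborel (gaussian \<sigma> :: real^'d::finite \<Rightarrow> complex)"
  using gaussian_char[of \<sigma> "0 :: real^'d"] by (simp add: has_bochner_integral_iff)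

lemma gaussian_integral:
  "\<sigma> > 0 \<Longrightarrow> (LBINT x. gaussian \<sigma> (x :: real^'d::finite)) = complex_of_real ((2 * pi / \<sigma>) powr (CARD('d) / 2))"
  using gaussian_char[of \<sigma> "0 :: real^'d"] by (simp add: has_bochner_integral_iff gaussian_def)

lemma norm_gaussian_le: "\<sigma> \<ge> 0 \<Longrightarrow> norm (gaussian \<sigma> x) \<le> 1"
  by (simp add: gaussian_def)

text \<open>
  The Fourier transform of \<open>gaussian e\<^sup>2\<close> has mass independent of \<open>e\<close> and concentrates at the origin
  as \<open>e\<close> tends to \<open>0\<close>, while \<open>gaussian e\<^sup>2\<close> itself tends to \<open>1\<close>. This is the summability kernel
  of the inversion formula; substituting \<open>y = x + e z\<close> makes the limit a case of dominated convergence.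
\<close>

lemma gaussian_convolution_scaled:
  fixes f :: "real^'d::finite \<Rightarrow> complex"
  assumes [measurable]: "f \<in> borel_measurable borel" and e: "e > 0"
  shows "(LBINT y. f y * (complex_of_real ((e\<^sup>2) powr (- real CARD('d) / 2)) * gaussian (1 / e\<^sup>2) (y - x)))
    = (LBINT z. f (x + e *\<^sub>R z) * gaussian 1 z)"
proof -
  have p: "(e\<^sup>2) powr (- real CARD('d) / 2) = 1 / e ^ CARD('d)"
  proof -
    have "(e\<^sup>2) powr (- real CARD('d) / 2) = (e powr 2) powr (- real CARD('d) / 2)"
      using e by (simp add: powr_numeral)
    also have "\<dots> = e powr (- real CARD('d))" by (simp add: powr_powr)
    also have "\<dots> = 1 / e ^ CARD('d)" using e by (simp add: powr_minus powr_realpow inverse_eq_divide)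
    finally show ?thesis .
  qed
  have "(LBINT y. f y * (complex_of_real ((e\<^sup>2) powr (- real CARD('d) / 2)) * gaussian (1 / e\<^sup>2) (y - x)))
    = \<bar>e\<bar> ^ CARD('d) *\<^sub>R (LBINT z. f (x + e *\<^sub>R z) * (complex_of_real ((e\<^sup>2) powr (- real CARD('d) / 2)) * gaussian (1 / e\<^sup>2) ((x + e *\<^sub>R z) - x)))"
    by (rule integral_vec_affine) (use e in \<open>auto\<close>)
  also have "\<dots> = \<bar>e\<bar> ^ CARD('d) *\<^sub>R (LBINT z. complex_of_real (1 / e ^ CARD('d)) * (f (x + e *\<^sub>R z) * gaussian 1 z))"
    using e unfolding p
    by (intro arg_cong[where f="\<lambda>t. \<bar>e\<bar> ^ CARD('d) *\<^sub>R t"] Bochner_Integration.integral_cong refl)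
       (simp add: gaussian_def power_mult_distrib)
  also have "\<dots> = (LBINT z. f (x + e *\<^sub>R z) * gaussian 1 z)"
    using e by (simp add: scaleR_conv_of_real)
  finally show ?thesis .
qed

lemma gaussian_approximate_identity:
  fixes f :: "real^'d::finite \<Rightarrow> complex"
  assumes cont: "continuous_on UNIV f" and bdd: "\<And>x. norm (f x) \<le> C"
  shows "(\<lambda>n. LBINT y. f y * (complex_of_real (((1 / real (Suc n))\<^sup>2) powr (- real CARD('d) / 2)) * gaussian (1 / (1 / real (Suc n))\<^sup>2) (y - x)))
     \<longlonglongrightarrow> complex_of_real ((2 * pi) powr (CARD('d) / 2)) * f x"
proof -
  have [measurable]: "f \<in> borel_measurable borel"
    using cont by (rule borel_measurable_continuous_onI)
  have "(\<lambda>n. LBINT z. f (x + (1 / real (Suc n)) *\<^sub>R z) * gaussian 1 z)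
     \<longlonglongrightarrow> (LBINT z. f x * gaussian 1 (z :: real^'d))"
  proof (rule integral_dominated_convergence[where w="\<lambda>z::real^'d. C * norm (gaussian 1 z)"])
    show "integrable lborel (\<lambda>z::real^'d. C * norm (gaussian 1 z))"
      by (intro integrable_mult_right integrable_norm gaussian_integrable) simp
    show "AE z in lborel. (\<lambda>n. f (x + (1 / real (Suc n)) *\<^sub>R z) * gaussian 1 z) \<longlonglongrightarrow> f x * gaussian 1 z"
    proof (rule AE_I2)
      fix z :: "real^'d"
      have "(\<lambda>n. x + (1 / real (Suc n)) *\<^sub>R z) \<longlonglongrightarrow> x + 0 *\<^sub>R z"
        by (intro tendsto_intros LIMSEQ_Suc lim_1_over_n)
      then have "(\<lambda>n. f (x + (1 / real (Suc n)) *\<^sub>R z)) \<longlonglongrightarrow> f x"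
        using cont by (auto simp: continuous_on_eq_continuous_at intro: isCont_tendsto_compose)
      then show "(\<lambda>n. f (x + (1 / real (Suc n)) *\<^sub>R z) * gaussian 1 z) \<longlonglongrightarrow> f x * gaussian 1 z"
        by (intro tendsto_intros)
    qed
    show "AE z in lborel. norm (f (x + (1 / real (Suc n)) *\<^sub>R z) * gaussian 1 z) \<le> C * norm (gaussian 1 z)" for n
      by (intro AE_I2) (auto simp: norm_mult intro!: mult_right_mono bdd)
  qed auto
  then show ?thesis
    by (subst gaussian_convolution_scaled) (auto simp: gaussian_integral mult.commute)
qed

text \<open>
  Insert the factor \<open>gaussian e\<^sup>2\<close> into the integral that defines the left-hand side and move the
  inner transform to it by the multiplication formula. What remains is \<open>f\<close> tested against the
  approximate identity centred at \<open>-x\<close>.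
\<close>

lemma fourier_inversion:
  fixes f :: "real^'d::finite \<Rightarrow> complex"
  assumes f: "integrable lborel f" and cont: "continuous_on UNIV f" and bdd: "\<And>x. norm (f x) \<le> C"
    and ff: "integrable lborel (fourier f)"
  shows "fourier (fourier f) x = f (- x)"
proof -
  have [measurable]: "f \<in> borel_measurable borel"
    using cont by (rule borel_measurable_continuous_onI)
  define e where "e n = 1 / real (Suc n)" for n
  have e: "e n > 0" for n by (simp add: e_def)
  have int: "integrable lborel (\<lambda>k. wave x k * gaussian ((e n)\<^sup>2) k)" for n
    by (intro integrable_wave_mult gaussian_integrable) (use e[of n] in simp)
  have "(\<lambda>n. LBINT k. fourier f k * (wave x k * gaussian ((e n)\<^sup>2) k)) \<longlonglongrightarrow> (LBINT k. fourier f k * (wave x k * 1))"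
  proof (rule integral_dominated_convergence[where w="\<lambda>k. norm (fourier f k)"])
    show "AE k in lborel. (\<lambda>n. fourier f k * (wave x k * gaussian ((e n)\<^sup>2) k)) \<longlonglongrightarrow> fourier f k * (wave x k * 1)"
    proof (rule AE_I2)
      fix k :: "real^'d"
      have "(\<lambda>n. complex_of_real (exp (- ((e n)\<^sup>2 * (norm k)\<^sup>2 / 2)))) \<longlonglongrightarrow> complex_of_real (exp (- (0\<^sup>2 * (norm k)\<^sup>2 / 2)))"
        unfolding e_def by (intro tendsto_intros LIMSEQ_Suc lim_1_over_n) auto
      then have "(\<lambda>n. gaussian ((e n)\<^sup>2) k) \<longlonglongrightarrow> 1"
        by (simp add: gaussian_def)
      then show "(\<lambda>n. fourier f k * (wave x k * gaussian ((e n)\<^sup>2) k)) \<longlonglongrightarrow> fourier f k * (wave x k * 1)"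
        by (intro tendsto_intros)
    qed
    show "AE k in lborel. norm (fourier f k * (wave x k * gaussian ((e n)\<^sup>2) k)) \<le> norm (fourier f k)" for n
      by (intro AE_I2) (auto simp: norm_mult intro!: mult_right_le_one_le norm_gaussian_le)
  qed (use ff in auto)
  moreover have "(LBINT k. fourier f k * (wave x k * gaussian ((e n)\<^sup>2) k)) =
     (LBINT y. f y * (complex_of_real (((e n)\<^sup>2) powr (- real CARD('d) / 2)) * gaussian (1 / (e n)\<^sup>2) (y - (- x))))" for n
    using e[of n] unfolding fourier_multiplication_formula[OF f int]
    by (simp add: fourier_translate_arg fourier_gaussian)
  ultimately have "(\<lambda>n. LBINT y. f y * (complex_of_real (((e n)\<^sup>2) powr (- real CARD('d) / 2)) * gaussian (1 / (e n)\<^sup>2) (y - (- x))))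
     \<longlonglongrightarrow> (LBINT k. fourier f k * (wave x k * 1))" by simp
  then have "(LBINT k. fourier f k * (wave x k * 1)) = complex_of_real ((2 * pi) powr (CARD('d) / 2)) * f (- x)"
    using gaussian_approximate_identity[OF cont bdd, of "- x"] unfolding e_def
    by (rule LIMSEQ_unique)
  then have "fourier (fourier f) x = complex_of_real (fourier_factor TYPE('d) * (2 * pi) powr (CARD('d) / 2)) * f (- x)"
    by (simp add: fourier_wave[of "fourier f"] mult.commute)
  also have "fourier_factor TYPE('d) * (2 * pi) powr (CARD('d) / 2) = 1"
    by (simp flip: powr_add)
  finally show ?thesis by simp
qed

section \<open>The Fourier transform of Schwartz functions\<close>

lemma norm_exp_minus_first_order: "norm (exp (- \<i> * complex_of_real t) - 1 + \<i> * complex_of_real t) \<le> t\<^sup>2 / 2"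
  using iexp_approx1[of "- t" 1] by (simp add: numeral_2_eq_2 algebra_simps)

lemma wave_first_order:
  "norm (wave (k + h) x - wave k x - (- \<i> * complex_of_real (h \<bullet> x)) * wave k x) \<le> (norm h)\<^sup>2 * (norm x)\<^sup>2 / 2"
proof -
  have "wave (k + h) x - wave k x - (- \<i> * complex_of_real (h \<bullet> x)) * wave k x =
     wave k x * (exp (- \<i> * complex_of_real (h \<bullet> x)) - 1 + \<i> * complex_of_real (h \<bullet> x))"
    by (simp add: wave_add wave_def[of h] algebra_simps)
  then have "norm (wave (k + h) x - wave k x - (- \<i> * complex_of_real (h \<bullet> x)) * wave k x) \<le> (h \<bullet> x)\<^sup>2 / 2"
    using norm_exp_minus_first_order[of "h \<bullet> x"] by (simp only: norm_mult norm_wave mult_1)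
  also have "(h \<bullet> x)\<^sup>2 \<le> (norm h * norm x)\<^sup>2"
    using Cauchy_Schwarz_ineq2[of h x] by (metis abs_le_square_iff abs_mult abs_norm_cancel)
  finally show ?thesis by (simp add: power_mult_distrib)
qed

lemma schwartz_norm_square_integrable:
  assumes "f \<in> schwartz"
  shows "integrable lborel (\<lambda>x. (norm x)\<^sup>2 * norm (f x))"
proof -
  have "integrable lborel (\<lambda>x. complex_of_real ((norm x)\<^sup>2) * f x)"
  proof (rule rapid_integrable)
    show "rapid (\<lambda>x. complex_of_real ((norm x)\<^sup>2) * f x)"
    proof (rule rapid_le_poly[OF schwartz_rapid[OF assms], where K=1 and M=2])
      fix x :: "real^'a"
      have "(norm x)\<^sup>2 \<le> (1 + norm x)\<^sup>2" by (intro power_mono) auto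
      then show "norm (complex_of_real ((norm x)\<^sup>2) * f x) \<le> 1 * (1 + norm x)\<^sup>2 * norm (f x)"
        by (simp add: norm_mult norm_power mult_right_mono)
    qed simp
  qed (use assms in measurable)
  from integrable_norm[OF this] show ?thesis by (simp add: norm_mult norm_power)
qed

lemma fourier_has_derivative:
  fixes f :: "real^'d::finite \<Rightarrow> complex"
  assumes f: "f \<in> schwartz"
  shows "(fourier f has_derivative (\<lambda>h. \<Sum>j\<in>UNIV. complex_of_real (h $ j) * fourier (\<lambda>x. - \<i> * (complex_of_real (x $ j) * f x)) k)) (at k)"
    (is "(_ has_derivative ?D) _")
proof -
  have [measurable]: "f \<in> borel_measurable borel" using f by measurable
  have intj: "integrable lborel (\<lambda>x. - \<i> * (complex_of_real (x $ j) * f x))" for j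
    by (intro schwartz_integrable schwartz_cmult schwartz_coord f)
  have D: "?D h = complex_of_real (fourier_factor TYPE('d)) * (LBINT x. (- \<i> * complex_of_real (h \<bullet> x)) * wave k x * f x)"
    and Dint: "integrable lborel (\<lambda>x. (- \<i> * complex_of_real (h \<bullet> x)) * wave k x * f x)" for h
  proof -
    have eq: "(- \<i> * complex_of_real (h \<bullet> x)) * wave k x * f x =
       (\<Sum>j\<in>UNIV. complex_of_real (h $ j) * (wave k x * (- \<i> * (complex_of_real (x $ j) * f x))))" for x
      by (simp add: inner_vec_def sum_distrib_left sum_distrib_right mult_ac)
    show "integrable lborel (\<lambda>x. (- \<i> * complex_of_real (h \<bullet> x)) * wave k x * f x)"
      unfolding eq by (intro Bochner_Integration.integrable_sum integrable_mult_right integrable_wave_mult intj)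
    show "?D h = complex_of_real (fourier_factor TYPE('d)) * (LBINT x. (- \<i> * complex_of_real (h \<bullet> x)) * wave k x * f x)"
      unfolding eq
      by (subst Bochner_Integration.integral_sum)
         (auto intro!: integrable_mult_right integrable_wave_mult intj sum.cong schwartz_integrable[OF schwartz_coord[OF f]] simp: fourier_wave sum_distrib_left)
  qed
  define B where "B = fourier_factor TYPE('d) * (LBINT x. (norm x)\<^sup>2 * norm (f x)) / 2"
  have bound: "norm (fourier f (k + h) - fourier f k - ?D h) \<le> B * (norm h)\<^sup>2" for h
  proof -
    let ?L = "\<lambda>x. (- \<i> * complex_of_real (h \<bullet> x)) * wave k x"
    let ?R = "\<lambda>x. wave (k + h) x * f x - wave k x * f x - ?L x * f x"
    let ?c = "fourier_factor TYPE('d)"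
    have i: "integrable lborel (\<lambda>x. wave (k + h) x * f x)" "integrable lborel (\<lambda>x. wave k x * f x)"
      by (intro integrable_wave_mult schwartz_integrable f)+
    have "fourier f (k + h) - fourier f k - ?D h = complex_of_real ?c *
       ((LBINT x. wave (k + h) x * f x) - (LBINT x. wave k x * f x) - (LBINT x. ?L x * f x))"
      unfolding D unfolding fourier_wave by (simp only: right_diff_distrib)
    also have "\<dots> = complex_of_real ?c * (LBINT x. ?R x)"
      using i Dint by simp
    finally have "norm (fourier f (k + h) - fourier f k - ?D h) = ?c * norm (LBINT x. ?R x)"
      by (simp only: norm_mult norm_of_real) simp
    also have "norm (LBINT x. ?R x) \<le> (LBINT x. (norm h)\<^sup>2 / 2 * ((norm x)\<^sup>2 * norm (f x)))"
    proof (rule Bochner_Integration.integral_norm_bound_integral)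
      show "integrable lborel ?R"
        by (intro Bochner_Integration.integrable_diff i Dint)
      show "integrable lborel (\<lambda>x. (norm h)\<^sup>2 / 2 * ((norm x)\<^sup>2 * norm (f x)))"
        by (intro integrable_mult_right schwartz_norm_square_integrable f)
      fix x
      have "norm (?R x) = norm (wave (k + h) x - wave k x - ?L x) * norm (f x)"
        by (simp only: left_diff_distrib flip: norm_mult)
      also have "\<dots> \<le> (norm h)\<^sup>2 * (norm x)\<^sup>2 / 2 * norm (f x)"
        by (intro mult_right_mono wave_first_order) auto
      finally show "norm (?R x) \<le> (norm h)\<^sup>2 / 2 * ((norm x)\<^sup>2 * norm (f x))"
        by (simp add: mult_ac)
    qed
    also have "?c * (LBINT x. (norm h)\<^sup>2 / 2 * ((norm x)\<^sup>2 * norm (f x))) = B * (norm h)\<^sup>2"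
      by (simp add: B_def)
    finally show ?thesis by simp
  qed
  have "linear ?D"
    by (intro linearI) (simp_all add: sum.distrib distrib_right sum_distrib_left mult_ac scaleR_conv_of_real[where 'a=complex])
  then have bl: "bounded_linear ?D" by (rule linear_conv_bounded_linear[THEN iffD1])
  have "(\<lambda>h. norm (fourier f (k + h) - fourier f k - ?D h) / norm h) \<midarrow>0\<rightarrow> 0"
  proof (rule Lim_null_comparison[where g="\<lambda>h. B * norm h"])
    show "\<forall>\<^sub>F h in at 0. norm (norm (fourier f (k + h) - fourier f k - ?D h) / norm h) \<le> B * norm h"
      unfolding eventually_at_filter
    proof (intro always_eventually allI impI)
      fix h :: "real^'d" assume "h \<noteq> 0"
      then show "norm (norm (fourier f (k + h) - fourier f k - ?D h) / norm h) \<le> B * norm h"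
        using bound[of h] by (simp add: divide_le_eq power2_eq_square mult.assoc)
    qed
    show "((\<lambda>h::real^'d. B * norm h) \<longlongrightarrow> 0) (at 0)"
      by (auto intro!: tendsto_eq_intros)
  qed
  with bl show ?thesis by (simp only: has_derivative_at simp_thms)
qed

lemma one_plus_le_double: 
  fixes u v w :: real
  shows "u \<le> v + w \<Longrightarrow> w \<le> 1 \<Longrightarrow> 0 \<le> v \<Longrightarrow> 1 + u \<le> 2 * (1 + v)"
  by (simp add: distrib_left)

text \<open>
  The bound that is uniform in \<open>t\<close> allows dominated convergence for difference quotients: by the mean
  value inequality the quotient is at most a value of the partial derivative at distance at most \<open>1\<close>.
\<close>

lemma schwartz_difference_quotient_bound:
  fixes f :: "real^'d::finite \<Rightarrow> complex"
  assumes f: "f \<in> schwartz"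
  shows "\<exists>C. \<forall>x. \<forall>t\<in>{0<..1}. norm ((f (x + t *\<^sub>R axis j 1) - f x) / complex_of_real t) \<le> C * decay x"
proof -
  let ?e = "axis j 1 :: real^'d" and ?N = "2 * CARD('d)"
  obtain C where C: "\<And>x. (1 + norm x) ^ ?N * norm (partial j f x) \<le> C"
    using schwartz_rapid[OF schwartz_partial[OF f, of j]] unfolding rapid_def by metis
  have "norm ((f (x + t *\<^sub>R ?e) - f x) / complex_of_real t) \<le> (2 ^ ?N * C) * decay x" if t: "t \<in> {0<..1}" for x t
  proof -
    define B where "B = 2 ^ ?N * C / (1 + norm x) ^ ?N"
    have pB: "norm (partial j f (x + s *\<^sub>R ?e)) \<le> B" if "s \<in> {0..t}" for s
    proof -
      have "norm x \<le> norm (x + s *\<^sub>R ?e) + norm (s *\<^sub>R ?e)"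
        using norm_triangle_ineq4[of "x + s *\<^sub>R ?e" "s *\<^sub>R ?e"] by simp
      moreover have "norm (s *\<^sub>R ?e) \<le> 1" using that t by simp
      moreover have "1 + u \<le> 2 * (1 + v)" if "u \<le> v + w" "w \<le> 1" "0 \<le> v" for u v w :: real
        using one_plus_le_double[OF that] .
      ultimately have "1 + norm x \<le> 2 * (1 + norm (x + s *\<^sub>R ?e))"
        using norm_ge_zero[of "x + s *\<^sub>R ?e"] by blast
      then have "(1 + norm x) ^ ?N \<le> (2 * (1 + norm (x + s *\<^sub>R ?e))) ^ ?N"
        by (intro power_mono) auto
      then have "(1 + norm x) ^ ?N * norm (partial j f (x + s *\<^sub>R ?e)) \<le> (2 * (1 + norm (x + s *\<^sub>R ?e))) ^ ?N * norm (partial j f (x + s *\<^sub>R ?e))"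
        by (intro mult_right_mono) auto
      also have "\<dots> = 2 ^ ?N * ((1 + norm (x + s *\<^sub>R ?e)) ^ ?N * norm (partial j f (x + s *\<^sub>R ?e)))"
        by (simp only: power_mult_distrib mult.assoc)
      also have "\<dots> \<le> 2 ^ ?N * C" by (intro mult_left_mono C) auto
      finally have *: "(1 + norm x) ^ ?N * norm (partial j f (x + s *\<^sub>R ?e)) \<le> 2 ^ ?N * C" .
      have "(1 + norm x) ^ ?N > 0" by (simp add: add_pos_nonneg)
      then show ?thesis using * unfolding B_def by (simp add: pos_le_divide_eq mult.commute)
    qed
    have der: "((\<lambda>s. f (x + s *\<^sub>R ?e)) has_derivative (\<lambda>r. r *\<^sub>R partial j f (x + s *\<^sub>R ?e))) (at s within {0..t})" for s
    proof -
      have "((\<lambda>s. x + s *\<^sub>R ?e) has_derivative (\<lambda>r. r *\<^sub>R ?e)) (at s within {0..t})"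
        by (auto intro!: derivative_eq_intros)
      from has_derivative_compose[OF this schwartz_has_derivative[OF f]]
      have "((\<lambda>s. f (x + s *\<^sub>R ?e)) has_derivative (\<lambda>r. frechet_derivative f (at (x + s *\<^sub>R ?e)) (r *\<^sub>R ?e))) (at s within {0..t})" .
      moreover have "linear (frechet_derivative f (at (x + s *\<^sub>R ?e)))"
        using schwartz_has_derivative[OF f] has_derivative_linear by blast
      ultimately show ?thesis by (simp add: partial_def linear_scale)
    qed
    have "norm (f (x + t *\<^sub>R ?e) - f (x + 0 *\<^sub>R ?e)) \<le> B * norm (t - 0)"
    proof (rule differentiable_bound[where f="\<lambda>s. f (x + s *\<^sub>R ?e)" and S="{0..t}"])
      show "onorm (\<lambda>r. r *\<^sub>R partial j f (x + s *\<^sub>R ?e)) \<le> B" if "s \<in> {0..t}" for s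
        by (rule onorm_le) (use mult_right_mono[OF pB[OF that] abs_ge_zero] in \<open>simp add: mult.commute\<close>)
    qed (use t der in auto)
    then have "norm ((f (x + t *\<^sub>R ?e) - f x) / complex_of_real t) \<le> B"
      using t by (simp add: norm_divide divide_le_eq)
    then have "(1 + norm x) ^ ?N * norm ((f (x + t *\<^sub>R ?e) - f x) / complex_of_real t) \<le> 2 ^ ?N * C"
      unfolding B_def by (subst (asm) pos_le_divide_eq) (auto intro!: zero_less_power add_pos_nonneg simp: mult.commute)
    then show ?thesis by (rule norm_le_decay[where f="\<lambda>x. (f (x + t *\<^sub>R ?e) - f x) / complex_of_real t"])
  qed
  then show ?thesis by blast
qed

lemma has_vector_derivative_quotient_tendsto:
  assumes "(g has_vector_derivative D) (at (0::real))"
  shows "((\<lambda>s. (g s - g 0) /\<^sub>R s) \<longlongrightarrow> D) (at 0)"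
proof -
  have "((\<lambda>s. (g s - g 0 - s *\<^sub>R D) /\<^sub>R norm s) \<longlongrightarrow> 0) (at 0)"
    using assms by (simp add: has_vector_derivative_def has_derivative_at_within has_derivative_iff_norm divide_inverse)
  then have "((\<lambda>s. (g s - g 0) /\<^sub>R s - D) \<longlongrightarrow> 0) (at 0)"
  proof (rule Lim_transform_bound[rotated])
    show "\<forall>\<^sub>F s in at 0. norm ((g s - g 0) /\<^sub>R s - D) \<le> norm ((g s - g 0 - s *\<^sub>R D) /\<^sub>R norm s)"
      unfolding eventually_at_filter
    proof (intro always_eventually allI impI)
      fix s :: real assume "s \<noteq> 0"
      then have "(g s - g 0) /\<^sub>R s - D = (g s - g 0 - s *\<^sub>R D) /\<^sub>R s" by (simp add: scaleR_diff_right)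
      then show "norm ((g s - g 0) /\<^sub>R s - D) \<le> norm ((g s - g 0 - s *\<^sub>R D) /\<^sub>R norm s)" by simp
    qed
  qed
  then show ?thesis by (simp add: LIM_zero_iff)
qed

text \<open>
  Translation by \<open>t\<close> along axis \<open>j\<close> multiplies the transform by \<open>exp (\<i> t k\<^sub>j)\<close>; dividing by \<open>t\<close> and
  letting it tend to \<open>0\<close> on both sides replaces an integration by parts in several variables.
\<close>

lemma fourier_partial:
  fixes f :: "real^'d::finite \<Rightarrow> complex"
  assumes f: "f \<in> schwartz"
  shows "fourier (partial j f) k = \<i> * complex_of_real (k $ j) * fourier f k"
proof -
  let ?e = "axis j 1 :: real^'d"
  have [measurable]: "f \<in> borel_measurable borel" "partial j f \<in> borel_measurable borel"
    using f schwartz_partial[OF f, of j] by measurable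
  define t where "t n = 1 / real (Suc n)" for n
  have t: "t n \<in> {0<..1}" for n by (simp add: t_def)
  have nz: "t n \<noteq> 0" for n by (simp add: t_def)
  have t0: "t \<longlonglongrightarrow> 0" unfolding t_def by (intro LIMSEQ_Suc lim_1_over_n)
  have t_at: "filterlim t (at 0) sequentially"
    using t0 by (simp add: filterlim_at t_def)
  obtain C where C: "\<And>x n. norm ((f (x + t n *\<^sub>R ?e) - f x) / complex_of_real (t n)) \<le> C * decay x"
    using schwartz_difference_quotient_bound[OF f, of j] t by metis
  let ?q = "\<lambda>n x. (f (x + t n *\<^sub>R ?e) - f x) / complex_of_real (t n)"
  let ?I = "LBINT x. wave k x * f x"
  have lim1: "(\<lambda>n. LBINT x. wave k x * ?q n x) \<longlonglongrightarrow> (LBINT x. wave k x * partial j f x)"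
  proof (rule integral_dominated_convergence[where w="\<lambda>x. C * decay x"])
    show "integrable lborel (\<lambda>x::real^'d. C * decay x)" by (intro integrable_mult_right integrable_decay)
    show "AE x in lborel. norm (wave k x * ?q n x) \<le> C * decay x" for n
      unfolding norm_mult norm_wave mult_1 by (intro AE_I2 C)
    show "AE x in lborel. (\<lambda>n. wave k x * ?q n x) \<longlonglongrightarrow> wave k x * partial j f x"
    proof (rule AE_I2)
      fix x
      have "((\<lambda>s. x + s *\<^sub>R ?e) has_derivative (\<lambda>r. r *\<^sub>R ?e)) (at 0)"
        by (auto intro!: derivative_eq_intros)
      from has_derivative_compose[OF this schwartz_has_derivative[OF f]]
      have d: "((\<lambda>s. f (x + s *\<^sub>R ?e)) has_derivative (\<lambda>r. frechet_derivative f (at x) (r *\<^sub>R ?e))) (at 0)" by simp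
      have "linear (frechet_derivative f (at x))"
        using schwartz_has_derivative[OF f] has_derivative_linear by blast
      with d have *: "((\<lambda>s. f (x + s *\<^sub>R ?e)) has_vector_derivative partial j f x) (at 0)"
        by (simp add: has_vector_derivative_def partial_def linear_scale)
      have "((\<lambda>s. (f (x + s *\<^sub>R ?e) - f x) /\<^sub>R s) \<longlongrightarrow> partial j f x) (at 0)"
        using has_vector_derivative_quotient_tendsto[OF *] by simp
      from filterlim_compose[OF this t_at]
      have "(\<lambda>n. ?q n x) \<longlonglongrightarrow> partial j f x"
        by (simp add: scaleR_conv_of_real field_simps)
      then show "(\<lambda>n. wave k x * ?q n x) \<longlonglongrightarrow> wave k x * partial j f x"
        by (intro tendsto_intros)
    qed
  qed measurable
  have quot: "(LBINT x. wave k x * ?q n x) =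
     (exp (\<i> * complex_of_real (k $ j * t n)) - 1) / complex_of_real (t n) * ?I" for n
  proof -
    have i: "integrable lborel (\<lambda>x. wave k x * f x)"
      by (intro integrable_wave_mult schwartz_integrable f)
    have i2: "integrable lborel (\<lambda>x. wave k x * f (x + t n *\<^sub>R ?e))"
      using integrable_vec_affine[OF schwartz_integrable[OF f], of 1 "t n *\<^sub>R ?e"]
      by (intro integrable_wave_mult) (simp add: add.commute)
    have "(LBINT x. wave k x * f (x + t n *\<^sub>R ?e)) = (LBINT x. wave k (- (t n *\<^sub>R ?e)) * (wave k (t n *\<^sub>R ?e + x) * f (t n *\<^sub>R ?e + x)))"
      by (intro Bochner_Integration.integral_cong refl)
         (simp add: add.commute flip: wave_add_right mult.assoc)
    also have "\<dots> = wave k (- (t n *\<^sub>R ?e)) * ?I"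
      using integral_vec_translate[of "\<lambda>x. wave k x * f x" "t n *\<^sub>R ?e"] by simp
    also have "wave k (- (t n *\<^sub>R ?e)) = exp (\<i> * complex_of_real (k $ j * t n))"
      by (simp add: wave_def inner_axis mult.commute)
    finally have "(LBINT x. wave k x * f (x + t n *\<^sub>R ?e)) = exp (\<i> * complex_of_real (k $ j * t n)) * ?I" .
    moreover have "(LBINT x. wave k x * ?q n x) =
       (LBINT x. (wave k x * f (x + t n *\<^sub>R ?e) - wave k x * f x) / complex_of_real (t n))"
      by (simp add: right_diff_distrib)
    ultimately show ?thesis using i i2 by (simp add: field_simps diff_divide_distrib)
  qed
  have lim2: "(\<lambda>n. (exp (\<i> * complex_of_real (k $ j * t n)) - 1) / complex_of_real (t n) * ?I) \<longlonglongrightarrow>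
     \<i> * complex_of_real (k $ j) * ?I"
  proof -
    have "((\<lambda>z. exp (\<i> * complex_of_real (k $ j) * z)) has_field_derivative (\<i> * complex_of_real (k $ j))) (at 0)"
      by (auto intro!: derivative_eq_intros)
    then have l: "((\<lambda>z. (exp (\<i> * complex_of_real (k $ j) * z) - 1) / z) \<longlongrightarrow> \<i> * complex_of_real (k $ j)) (at 0)"
      by (simp add: DERIV_def)
    have "filterlim (\<lambda>n. complex_of_real (t n)) (at 0) sequentially"
      using tendsto_of_real[OF t0, where 'a=complex] by (simp add: filterlim_at nz)
    from filterlim_compose[OF l this] show ?thesis
      by (intro tendsto_mult tendsto_const) (simp add: mult.assoc)
  qed
  have "(LBINT x. wave k x * partial j f x) = \<i> * complex_of_real (k $ j) * ?I"
    by (rule LIMSEQ_unique[OF lim1[unfolded quot] lim2])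
  then show ?thesis by (simp add: fourier_wave)
qed

text \<open>
  One more power of \<open>|k|\<close> costs one more derivative, since \<open>|k|\<close> is at most the sum of the \<open>|k\<^sub>j|\<close>;
  the induction therefore runs over all Schwartz functions at once.
\<close>

lemma rapid_fourier:
  fixes f :: "real^'d::finite \<Rightarrow> complex"
  assumes "f \<in> schwartz"
  shows "rapid (fourier f)"
proof -
  have "\<forall>f\<in>(schwartz :: (real^'d \<Rightarrow> complex) set). \<exists>C. \<forall>k. (1 + norm k) ^ N * norm (fourier f k) \<le> C" for N
  proof (induction N)
    case 0 then show ?case using norm_fourier_le by auto
  next
    case (Suc N)
    show ?case
    proof
      fix f :: "real^'d \<Rightarrow> complex" assume f: "f \<in> schwartz"
      obtain C0 where C0: "\<And>k. (1 + norm k) ^ N * norm (fourier f k) \<le> C0" using Suc f by blast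
      have "\<forall>j. \<exists>C. \<forall>k. (1 + norm k) ^ N * norm (fourier (partial j f) k) \<le> C"
        using Suc schwartz_partial[OF f] by blast
      then obtain C where C: "\<And>j k. (1 + norm k) ^ N * norm (fourier (partial j f) k) \<le> C j" by metis
      have "(1 + norm k) ^ Suc N * norm (fourier f k) \<le> C0 + (\<Sum>j\<in>UNIV. C j)" for k
      proof -
        have "(1 + norm k) ^ Suc N * norm (fourier f k) \<le> (1 + (\<Sum>j\<in>UNIV. \<bar>k $ j\<bar>)) * ((1 + norm k) ^ N * norm (fourier f k))"
          using norm_le_l1_cart[of k] by (simp add: mult.assoc mult_right_mono)
        also have "\<dots> = (1 + norm k) ^ N * norm (fourier f k) + (\<Sum>j\<in>UNIV. (1 + norm k) ^ N * norm (fourier (partial j f) k))"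
          unfolding fourier_partial[OF f] norm_mult distrib_right sum_distrib_right
          by (auto intro!: sum.cong simp: mult_ac)
        also have "\<dots> \<le> C0 + (\<Sum>j\<in>UNIV. C j)"
          by (intro add_mono sum_mono C0 C)
        finally show ?thesis .
      qed
      then show "\<exists>C. \<forall>k. (1 + norm k) ^ Suc N * norm (fourier f k) \<le> C" by blast
    qed
  qed
  then show ?thesis using assms by (auto simp: rapid_def)
qed

lemma schwartz_fourier:
  assumes "f \<in> schwartz" shows "fourier f \<in> schwartz"
proof (rule schwartz_coinduct[of _ "fourier ` schwartz"])
  fix g :: "real^'a \<Rightarrow> complex" assume "g \<in> fourier ` schwartz"
  then obtain f where f: "f \<in> schwartz" "g = fourier f" by blast
  show "g differentiable (at x)" for x
    using fourier_has_derivative[OF f(1)] unfolding f(2) differentiable_def by blast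
  show "rapid g" unfolding f(2) by (rule rapid_fourier[OF f(1)])
  have "partial i g = fourier (\<lambda>x. - \<i> * (complex_of_real (x $ i) * f x))" for i
  proof
    fix k
    have "partial i g k = (\<Sum>j\<in>UNIV. complex_of_real (axis i 1 $ j) * fourier (\<lambda>x. - \<i> * (complex_of_real (x $ j) * f x)) k)"
      unfolding f(2) by (rule partial_eqI[OF fourier_has_derivative[OF f(1)]])
    also have "\<dots> = (\<Sum>j\<in>UNIV. if j = i then fourier (\<lambda>x. - \<i> * (complex_of_real (x $ j) * f x)) k else 0)"
      by (intro sum.cong) (auto simp: axis_def)
    finally show "partial i g k = fourier (\<lambda>x. - \<i> * (complex_of_real (x $ i) * f x)) k" by simp
  qed
  moreover have "(\<lambda>x. - \<i> * (complex_of_real (x $ i) * f x)) \<in> schwartz" for i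
    by (intro schwartz_cmult schwartz_coord f)
  ultimately show "partial i g \<in> fourier ` schwartz" for i by auto
qed (use assms in auto)

lemma fourier_inversion_schwartz:
  assumes "f \<in> schwartz"
  shows "fourier (fourier f) x = f (- x)"
proof -
  obtain C where "\<And>x. norm (f x) \<le> C" using schwartz_bounded[OF assms] by blast
  then show ?thesis
    by (intro fourier_inversion schwartz_integrable schwartz_continuous schwartz_fourier assms)
qed

lemma schwartz_fourier_surj:
  assumes "f \<in> schwartz"
  shows "(\<lambda>x. fourier f (- x)) \<in> schwartz" "fourier (\<lambda>x. fourier f (- x)) = f"
proof -
  show "(\<lambda>x. fourier f (- x)) \<in> schwartz"
    by (intro schwartz_uminus schwartz_fourier assms)
  show "fourier (\<lambda>x. fourier f (- x)) = f"
  proof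
    fix x
    have "fourier (\<lambda>x. fourier f (- x)) x = fourier (fourier f) (- x)"
      by (intro fourier_minus_arg schwartz_measurable schwartz_fourier assms)
    then show "fourier (\<lambda>x. fourier f (- x)) x = f x"
      using fourier_inversion_schwartz[OF assms] by simp
  qed
qed

section \<open>Uniqueness of the function that represents a distribution\<close>

text \<open>
  The positive and the negative part of \<open>w\<close> are densities of finite measures that agree on closed
  sets, hence on all Borel sets.
\<close>

lemma AE_zero_if_integral_closed_zero:
  fixes w :: "'a::euclidean_space \<Rightarrow> real"
  assumes w: "integrable lborel w"
    and zero: "\<And>C. closed C \<Longrightarrow> (LBINT x. w x * indicator C x) = 0"
  shows "AE x in lborel. w x = 0"
proof -
  have [measurable]: "w \<in> borel_measurable borel" using w by auto
  let ?M = "density lborel (\<lambda>x. ennreal (w x))" and ?N = "density lborel (\<lambda>x. ennreal (- w x))"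
  have fin: "(\<integral>\<^sup>+x. ennreal (s * w x) * indicator A x \<partial>lborel) \<noteq> \<infinity>" if "\<bar>s\<bar> = 1" for A s
  proof -
    have "(\<integral>\<^sup>+x. ennreal (s * w x) * indicator A x \<partial>lborel) \<le> (\<integral>\<^sup>+x. ennreal (norm (w x)) \<partial>lborel)"
    proof (intro nn_integral_mono)
      fix x
      have "s * w x \<le> norm (w x)" using that abs_ge_self[of "s * w x"] by (simp add: abs_mult)
      then show "ennreal (s * w x) * indicator A x \<le> ennreal (norm (w x))"
        by (auto simp: indicator_def ennreal_leI)
    qed
    also have "\<dots> < \<infinity>" using w by (simp add: integrable_iff_bounded)
    finally show ?thesis by simp
  qed
  have eq: "emeasure ?M A = emeasure ?N A" if "closed A" for A
  proof -
    have [measurable]: "A \<in> sets borel" using that by simp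
    have int: "integrable lborel (\<lambda>x. w x * indicator A x)"
      by (rule integrable_real_mult_indicator) (use w in auto)
    have e: "(\<integral>\<^sup>+x. ennreal (w x * indicator A x) \<partial>lborel) = emeasure ?M A"
      "(\<integral>\<^sup>+x. ennreal (- (w x * indicator A x)) \<partial>lborel) = emeasure ?N A"
      by (auto simp: emeasure_density intro!: nn_integral_cong split: split_indicator)
    have f: "emeasure ?M A \<noteq> \<infinity>" "emeasure ?N A \<noteq> \<infinity>"
      using fin[of 1 A] fin[of "-1" A] by (auto simp: emeasure_density)
    have "enn2real (emeasure ?M A) - enn2real (emeasure ?N A) = 0"
      using real_lebesgue_integral_def[OF int] zero[OF that] by (simp add: e)
    then have "enn2real (emeasure ?M A) = enn2real (emeasure ?N A)" by simp
    then show ?thesis using f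
      by (metis ennreal_enn2real infinity_ennreal_def less_top)
  qed
  have "?M = ?N"
  proof (rule measure_eqI_generator_eq[where E="Collect closed" and \<Omega>=UNIV and A="\<lambda>_. UNIV"])
    show "Int_stable (Collect closed :: 'a set set)" by (auto simp: Int_stable_def)
    show "emeasure ?M UNIV \<noteq> \<infinity>"
      using fin[of 1 UNIV] by (auto simp: emeasure_density)
  qed (auto simp: eq borel_eq_closed)
  then have "AE x in lborel. ennreal (w x) = ennreal (- w x)"
    using fin[of 1 UNIV] finite_density_unique[of "\<lambda>x. ennreal (w x)" lborel "\<lambda>x. ennreal (- w x)"] by simp
  then show ?thesis
  proof eventually_elim
    case (elim x)
    show ?case
    proof (cases "w x \<ge> 0")
      case True
      then have "ennreal (w x) = 0" using elim by (simp add: ennreal_neg)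
      then show ?thesis using True by simp
    next
      case False
      then have "ennreal (- w x) = 0" using elim by (simp add: ennreal_neg)
      then show ?thesis using False by (simp add: ennreal_eq_0_iff)
    qed
  qed
qed

lemma integrable_mult_bounded_right:
  fixes f g :: "'a \<Rightarrow> complex"
  assumes "integrable M f" "g \<in> borel_measurable M" "\<And>x. norm (g x) \<le> C"
  shows "integrable M (\<lambda>x. f x * g x)"
proof (rule Bochner_Integration.integrable_bound[OF integrable_mult_right[OF integrable_norm[OF assms(1)], of C]])
  show "AE x in M. norm (f x * g x) \<le> norm (C * norm (f x))"
  proof (rule AE_I2)
    fix x
    have "norm (f x * g x) \<le> norm (f x) * C" unfolding norm_mult by (intro mult_left_mono assms) auto
    also have "\<dots> \<le> norm (C * norm (f x))" using abs_ge_self[of "C * norm (f x)"] by (simp add: mult.commute)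
    finally show "norm (f x * g x) \<le> norm (C * norm (f x))" .
  qed
qed (use assms in measurable)

definition conv :: "(real^'d::finite \<Rightarrow> complex) \<Rightarrow> (real^'d \<Rightarrow> complex) \<Rightarrow> real^'d \<Rightarrow> complex" where
  "conv f g k = (LBINT y. f (k - y) * g y)"

lemma conv_integrable_pair:
  fixes f g :: "real^'d::finite \<Rightarrow> complex"
  assumes f: "integrable lborel f" and g: "integrable lborel g"
  shows "integrable (lborel \<Otimes>\<^sub>M lborel) (\<lambda>(y, k). f (k - y) * g y)"
proof (rule lborel_pair.Fubini_integrable)
  have [measurable]: "f \<in> borel_measurable borel" "g \<in> borel_measurable borel" using f g by auto
  show "(\<lambda>(y, k). f (k - y) * g y) \<in> borel_measurable (lborel \<Otimes>\<^sub>M lborel)" by measurable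
  have fs: "integrable lborel (\<lambda>k. f (k - y))" for y
    using integrable_vec_affine[OF f, of 1 "- y"] by simp
  then show "AE y in lborel. integrable lborel (\<lambda>k. case (y, k) of (y, k) \<Rightarrow> f (k - y) * g y)"
    by (intro AE_I2) auto
  have "(LBINT k. norm (f (k - y))) = (LBINT k. norm (f k))" for y
    using integral_vec_translate[of "\<lambda>k. norm (f k)" "- y"] by simp
  then have "(LBINT k. norm (case (y, k) of (y, k) \<Rightarrow> f (k - y) * g y)) = (LBINT k. norm (f k)) * norm (g y)" for y
    by (simp add: norm_mult)
  then show "integrable lborel (\<lambda>y. LBINT k. norm (case (y, k) of (y, k) \<Rightarrow> f (k - y) * g y))"
    using g by simp
qed

text \<open>
  Approximate \<open>h\<close> by its convolutions \<open>H n\<close> with narrow Gaussians: by Fubini the integral of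
  \<open>v * H n\<close> is that of \<open>h\<close> against a Gaussian convolution of \<open>v\<close>, which vanishes.
\<close>

lemma integral_zero_if_gaussian_zero:
  fixes v h :: "real^'d::finite \<Rightarrow> complex"
  assumes v: "integrable lborel v"
    and zero: "\<And>x s. s > 0 \<Longrightarrow> (LBINT y. v y * gaussian s (y - x)) = 0"
    and cont: "continuous_on UNIV h" and bdd: "\<And>x. norm (h x) \<le> C"
  shows "(LBINT y. v y * h y) = 0"
proof -
  have C0: "C \<ge> 0" using bdd[of 0] norm_ge_zero[of "h 0"] by linarith
  have [measurable]: "h \<in> borel_measurable borel" "v \<in> borel_measurable borel"
    using cont v by (auto intro: borel_measurable_continuous_onI)
  define e where "e n = 1 / real (Suc n)" for n
  have e: "e n > 0" for n by (simp add: e_def)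
  define c where "c n = complex_of_real (((e n)\<^sup>2) powr (- real CARD('d) / 2))" for n
  define s where "s n = 1 / (e n)\<^sup>2" for n
  have s: "s n > 0" for n using e[of n] by (simp add: s_def)
  define H where "H n y = (LBINT x. h x * (c n * gaussian (s n) (x - y)))" for n y
  have HM: "H n y = (LBINT z. h (y + e n *\<^sub>R z) * gaussian 1 z)" for n y
    unfolding H_def c_def s_def by (rule gaussian_convolution_scaled) (auto simp: e)
  have Hb: "norm (H n y) \<le> C * (2 * pi) powr (CARD('d) / 2)" for n y
  proof -
    have "norm (H n y) \<le> (LBINT z. C * norm (gaussian 1 (z :: real^'d)))"
      unfolding HM
    proof (rule Bochner_Integration.integral_norm_bound_integral)
      have "integrable lborel (\<lambda>z. gaussian 1 z * h (y + e n *\<^sub>R z))"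
        by (rule integrable_mult_bounded_right[of _ _ _ C]) (auto intro!: gaussian_integrable bdd)
      then show "integrable lborel (\<lambda>z. h (y + e n *\<^sub>R z) * gaussian 1 z)" by (simp add: mult.commute)
      show "integrable lborel (\<lambda>z::real^'d. C * norm (gaussian 1 z))"
        by (intro integrable_mult_right integrable_norm gaussian_integrable) simp
      show "norm (h (y + e n *\<^sub>R z) * gaussian 1 z) \<le> C * norm (gaussian 1 z)" for z
        unfolding norm_mult by (intro mult_right_mono bdd) auto
    qed
    also have "(LBINT z. norm (gaussian 1 (z :: real^'d))) = (2 * pi) powr (CARD('d) / 2)"
    proof -
      have "complex_of_real (LBINT z. norm (gaussian 1 (z :: real^'d))) = (LBINT z. gaussian 1 (z :: real^'d))"
        by (subst integral_complex_of_real[symmetric]) (simp add: gaussian_def[abs_def])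
      then show ?thesis by (simp add: gaussian_integral)
    qed
    then have "(LBINT z. C * norm (gaussian 1 (z :: real^'d))) = C * (2 * pi) powr (CARD('d) / 2)" by simp
    finally show ?thesis .
  qed
  have Hm [measurable]: "H n \<in> borel_measurable borel" for n
  proof -
    have "(\<lambda>y. LBINT x. h x * (c n * gaussian (s n) (x - y))) \<in> borel_measurable lborel"
      unfolding gaussian_def by (rule lborel.borel_measurable_lebesgue_integral) measurable
    then show ?thesis unfolding H_def[abs_def] by simp
  qed
  have int0: "(LBINT y. v y * H n y) = 0" for n
  proof -
    have zero': "conv (gaussian (s n)) v x = 0" for x
      using zero[OF s, of n x] by (simp add: conv_def gaussian_def norm_minus_commute mult.commute)
    have "integrable (lborel \<Otimes>\<^sub>M lborel) (\<lambda>p. (case p of (y, x) \<Rightarrow> gaussian (s n) (x - y) * v y) * h (snd p))"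
      by (rule integrable_mult_bounded_right[OF conv_integrable_pair[OF gaussian_integrable[OF s] v] _ bdd]) measurable
    then have int: "integrable (lborel \<Otimes>\<^sub>M lborel) (\<lambda>(y, x). gaussian (s n) (x - y) * v y * h x)"
      by (simp add: case_prod_unfold)
    have "(LBINT y. v y * H n y) = (LBINT y. LBINT x. c n * (gaussian (s n) (x - y) * v y * h x))"
      unfolding H_def integral_mult_right_zero[symmetric]
      by (intro Bochner_Integration.integral_cong refl) (simp add: mult_ac)
    also have "\<dots> = c n * (LBINT x. LBINT y. gaussian (s n) (x - y) * v y * h x)"
      using lborel_pair.Fubini_integral[OF int] by simp
    also have "\<dots> = c n * (LBINT x. conv (gaussian (s n)) v x * h x)"
      by (simp add: conv_def)
    finally show ?thesis by (simp add: zero')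
  qed
  have "(\<lambda>n. LBINT y. v y * H n y) \<longlonglongrightarrow> (LBINT y. v y * (complex_of_real ((2 * pi) powr (CARD('d) / 2)) * h y))"
  proof (rule integral_dominated_convergence[where w="\<lambda>y. norm (v y) * (C * (2 * pi) powr (CARD('d) / 2))"])
    show "AE y in lborel. (\<lambda>n. v y * H n y) \<longlonglongrightarrow> v y * (complex_of_real ((2 * pi) powr (CARD('d) / 2)) * h y)"
      using gaussian_approximate_identity[OF cont bdd]
      by (intro AE_I2 tendsto_mult tendsto_const) (simp add: H_def c_def s_def e_def)
    show "AE y in lborel. norm (v y * H n y) \<le> norm (v y) * (C * (2 * pi) powr (CARD('d) / 2))" for n
      unfolding norm_mult by (intro AE_I2 mult_left_mono Hb) auto
    show "integrable lborel (\<lambda>y. norm (v y) * (C * (2 * pi) powr (CARD('d) / 2)))" using v by auto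
  qed measurable
  then have "(LBINT y. v y * (complex_of_real ((2 * pi) powr (CARD('d) / 2)) * h y)) = 0"
    unfolding int0 by (simp add: LIMSEQ_const_iff)
  moreover have "(LBINT y. v y * (complex_of_real ((2 * pi) powr (CARD('d) / 2)) * h y)) = 
     (LBINT y. complex_of_real ((2 * pi) powr (CARD('d) / 2)) * (v y * h y))"
    by (simp add: mult_ac)
  ultimately show ?thesis by simp
qed

text \<open>
  Indicators of closed sets are pointwise limits of bounded continuous functions.
\<close>

lemma AE_zero_if_gaussian_zero:
  fixes v :: "real^'d::finite \<Rightarrow> complex"
  assumes v: "integrable lborel v"
    and zero: "\<And>x s. s > 0 \<Longrightarrow> (LBINT y. v y * gaussian s (y - x)) = 0"
  shows "AE x in lborel. v x = 0"
proof -
  have [measurable]: "v \<in> borel_measurable borel" using v by auto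
  have closed0: "(LBINT x. v x * complex_of_real (indicator A x)) = 0" if A: "closed A" for A
  proof (cases "A = {}")
    case False
    define h where "h n x = complex_of_real (max 0 (1 - real n * infdist x A))" for n x
    have hc: "continuous_on UNIV (h n)" for n
      unfolding h_def by (intro continuous_intros)
    have hb: "norm (h n x) \<le> 1" for n x
      using infdist_nonneg[of x A] by (auto simp: h_def)
    have [measurable]: "h n \<in> borel_measurable borel" for n
      using hc by (rule borel_measurable_continuous_onI)
    have [measurable]: "A \<in> sets borel" using A by simp
    have "(\<lambda>n. LBINT x. v x * h n x) \<longlonglongrightarrow> (LBINT x. v x * complex_of_real (indicator A x))"
    proof (rule integral_dominated_convergence[where w="\<lambda>x. norm (v x)"])
      show "AE x in lborel. (\<lambda>n. v x * h n x) \<longlonglongrightarrow> v x * complex_of_real (indicator A x)"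
      proof (intro AE_I2 tendsto_mult tendsto_const)
        fix x
        show "(\<lambda>n. h n x) \<longlonglongrightarrow> complex_of_real (indicator A x)"
        proof (cases "x \<in> A")
          case True then show ?thesis by (simp add: h_def)
        next
          case False
          then have pos: "infdist x A > 0"
            using A \<open>A \<noteq> {}\<close> by (metis in_closed_iff_infdist_zero infdist_nonneg less_le)
          have "\<forall>\<^sub>F n in sequentially. h n x = 0"
            using eventually_ge_at_top[of "nat \<lceil>1 / infdist x A\<rceil>"]
          proof eventually_elim
            case (elim n)
            then have "1 / infdist x A \<le> real n" by linarith
            then show ?case using pos by (simp add: h_def field_simps)
          qed
          then show ?thesis using False by (simp add: tendsto_eventually)
        qed
      qed
      show "AE x in lborel. norm (v x * h n x) \<le> norm (v x)" for n
        unfolding norm_mult by (intro AE_I2 mult_right_le_one_le hb) auto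
      show "integrable lborel (\<lambda>x. norm (v x))" using v by simp
    qed measurable
    then show ?thesis
      using integral_zero_if_gaussian_zero[OF v zero hc hb] by (simp add: LIMSEQ_const_iff)
  qed simp
  have i: "integrable lborel (\<lambda>x. v x * complex_of_real (indicator A x))" if "closed A" for A
  proof (rule integrable_mult_bounded_right[OF v, of _ 1])
    have [measurable]: "A \<in> sets borel" using that by simp
    show "(\<lambda>x. complex_of_real (indicator A x)) \<in> borel_measurable lborel" by measurable
  qed (auto simp: indicator_def)
  have "AE x in lborel. Re (v x) = 0"
  proof (rule AE_zero_if_integral_closed_zero)
    show "integrable lborel (\<lambda>x. Re (v x))" using v by simp
    show "(LBINT x. Re (v x) * indicator A x) = 0" if "closed A" for A
      using integral_Re[OF i[OF that]] closed0[OF that] by simp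
  qed
  moreover have "AE x in lborel. Im (v x) = 0"
  proof (rule AE_zero_if_integral_closed_zero)
    show "integrable lborel (\<lambda>x. Im (v x))" using v by simp
    show "(LBINT x. Im (v x) * indicator A x) = 0" if "closed A" for A
      using integral_Im[OF i[OF that]] closed0[OF that] by simp
  qed
  ultimately show ?thesis by eventually_elim (simp add: complex_eq_iff)
qed

text \<open>
  The difference of the two functions need not be integrable, but its product with a fixed Gaussian
  is, because that Gaussian is a Schwartz function; translated Gaussians remain as test functions.
\<close>

lemma is_fun_of_unique:
  fixes f g :: "real^'d::finite \<Rightarrow> complex"
  assumes f: "is_fun_of f T" and g: "is_fun_of g T"
  shows "AE x in lborel. f x = g x"
proof -
  have [measurable]: "f \<in> borel_measurable borel" "g \<in> borel_measurable borel"
    using f g by (auto simp: is_fun_of_def)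
  define v where "v y = (f y - g y) * gaussian 2 y" for y
  have u: "integrable lborel (\<lambda>x. (f x - g x) * \<phi> x)" "(LBINT x. (f x - g x) * \<phi> x) = 0" if "\<phi> \<in> schwartz" for \<phi>
  proof -
    have i: "integrable lborel (\<lambda>x. f x * \<phi> x)" "integrable lborel (\<lambda>x. g x * \<phi> x)"
      "(LBINT x. f x * \<phi> x) = (LBINT x. g x * \<phi> x)"
      using f g that by (auto simp: is_fun_of_def dist_of_fun_def)
    show "integrable lborel (\<lambda>x. (f x - g x) * \<phi> x)" "(LBINT x. (f x - g x) * \<phi> x) = 0"
      using i by (simp_all add: left_diff_distrib)
  qed
  have "AE x in lborel. v x = 0"
  proof (rule AE_zero_if_gaussian_zero)
    have "gaussian 2 = (\<lambda>y::real^'d. complex_of_real (exp (- (1 * (norm y)\<^sup>2 + 0 * (norm (y - 0))\<^sup>2))))"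
      by (simp add: gaussian_def fun_eq_iff)
    then show "integrable lborel v" unfolding v_def
      using schwartz_exp_gaussian[of 1 0 "0 :: real^'d"] by (intro u) simp
    fix x :: "real^'d" and s :: real assume s: "s > 0"
    have g2: "gaussian 2 y * gaussian s (y - x) = complex_of_real (exp (- (1 * (norm y)\<^sup>2 + s / 2 * (norm (y - x))\<^sup>2)))" for y
    proof -
      have "- (1 * (norm y)\<^sup>2 + s / 2 * (norm (y - x))\<^sup>2) = - (2 * (norm y)\<^sup>2 / 2) + - (s * (norm (y - x))\<^sup>2 / 2)" by simp
      then show ?thesis unfolding gaussian_def by (simp only: exp_add of_real_mult)
    qed
    have "(LBINT y. v y * gaussian s (y - x)) = (LBINT y. (f y - g y) * complex_of_real (exp (- (1 * (norm y)\<^sup>2 + s / 2 * (norm (y - x))\<^sup>2))))"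
      by (intro Bochner_Integration.integral_cong refl)
         (simp only: v_def g2 mult.assoc)
    also have "\<dots> = 0" by (intro u(2) schwartz_exp_gaussian) (use s in auto)
    finally show "(LBINT y. v y * gaussian s (y - x)) = 0" .
  qed
  then show ?thesis by eventually_elim (simp add: v_def gaussian_def)
qed

lemma fun_of_dist_AE_eq:
  assumes "is_fun_of f T" shows "is_fun_of (fun_of_dist T) T" "AE x in lborel. fun_of_dist T x = f x"
proof -
  show "is_fun_of (fun_of_dist T) T"
    unfolding fun_of_dist_def by (rule someI[of "\<lambda>f. is_fun_of f T", OF assms])
  from is_fun_of_unique[OF this assms] show "AE x in lborel. fun_of_dist T x = f x" .
qed

section \<open>An Euler integral for the hypergeometric function\<close>

definition beta_weight :: "real \<Rightarrow> real \<Rightarrow> real \<Rightarrow> real" where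
  "beta_weight m n s = indicator {0<..<1} s * (s powr (m - 1) * (1 - s) powr (n - 1))"

lemma beta_weight_nonneg: "beta_weight m n s \<ge> 0"
  by (simp add: beta_weight_def indicator_def)

lemma beta_weight_measurable [measurable]: "beta_weight m n \<in> borel_measurable borel"
  unfolding beta_weight_def[abs_def] by measurable

lemma beta_weight_integral:
  assumes "m > 0" "n > 0"
  shows "has_bochner_integral lborel (beta_weight m n) (Beta m n)"
proof -
  have eq: "beta_weight m n = (\<lambda>s. indicator {0..1} s *\<^sub>R (s powr (m - 1) * (1 - s) powr (n - 1)))"
    by (auto simp: beta_weight_def indicator_def fun_eq_iff)
  have i: "set_integrable lborel {0..1} (\<lambda>s. s powr (m - 1) * (1 - s) powr (n - 1))"
    by (rule integrable_Beta[OF assms])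
  then have "(LINT s:{0..1}|lborel. s powr (m - 1) * (1 - s) powr (n - 1)) = integral {0..1} (\<lambda>s. s powr (m - 1) * (1 - s) powr (n - 1))"
    by (rule set_borel_integral_eq_integral)
  also have "\<dots> = Beta m n" using has_integral_Beta_real[OF assms] by (rule integral_unique)
  finally show ?thesis using i unfolding eq has_bochner_integral_iff set_integrable_def set_lebesgue_integral_def by simp
qed

text \<open>
  Up to the factor \<open>Beta m n\<close> this is the function \<open>\<^sub>3F\<^sub>2(a, m, n; (m+n)/2, (m+n+1)/2; w)\<close>: expanding the
  power of \<open>1 - 4ws(1-s)\<close> gives Beta integrals with parameters \<open>m + k\<close> and \<open>n + k\<close>, and the
  duplication formula turns their Pochhammer symbol \<open>(m+n)\<^sub>2\<^sub>k\<close> into the two lower parameters. The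
  integral makes sense for all \<open>w < 1\<close> because \<open>4s(1-s) \<le> 1\<close>.
\<close>

definition hyp_integral :: "real \<Rightarrow> real \<Rightarrow> real \<Rightarrow> real \<Rightarrow> real" where
  "hyp_integral a m n w = (LBINT s. beta_weight m n s * (1 - w * (4 * s * (1 - s))) powr (- a))"

lemma four_s_bounds:
  assumes "0 < s" "s < (1::real)"
  shows "0 < 4 * s * (1 - s)" "4 * s * (1 - s) \<le> 1"
proof -
  show "0 < 4 * s * (1 - s)" using assms by simp
  have "0 \<le> (2 * s - 1)\<^sup>2" by simp
  then show "4 * s * (1 - s) \<le> 1" by (simp add: power2_eq_square algebra_simps)
qed

lemma hyp_base_bound:
  assumes "0 \<le> p" "p \<le> 1" "x < (1::real)"
  shows "min 1 (1 - x) \<le> 1 - x * p"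
proof (cases "x \<ge> 0")
  case True
  then have "x * p \<le> x" using assms by (simp add: mult_left_le)
  then show ?thesis by simp
next
  case False
  then have "x * p \<le> 0" using assms by (simp add: mult_nonpos_nonneg)
  then show ?thesis by simp
qed

lemma pochhammer_binomial_sums:
  fixes a z :: real
  assumes "\<bar>z\<bar> < 1"
  shows "(\<lambda>k. pochhammer a k / fact k * z ^ k) sums (1 - z) powr (- a)"
proof -
  have "(- a gchoose k) * (- z) ^ k = pochhammer a k / fact k * z ^ k" for k
  proof -
    have "(- z) ^ k = (- 1) ^ k * z ^ k" by (rule power_minus)
    moreover have "(- 1) ^ k * (- 1) ^ k = (1 :: real)" by (simp flip: power_mult_distrib)
    ultimately show ?thesis by (simp add: gbinomial_pochhammer mult.assoc[symmetric] mult.commute[of "pochhammer a k"])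
  qed
  then show ?thesis using gen_binomial_real[of "- z" "- a"] assms by simp
qed

text \<open>
  With \<open>p = 4s(1-s)\<close> and \<open>c = 1 - xp\<close> one has \<open>1 - (x+h)p = c(1 - hp/c)\<close>, and the binomial series in
  \<open>hp/c\<close> converges uniformly in \<open>s\<close> since \<open>c\<close> is at least \<open>min 1 (1 - x)\<close>, which exceeds \<open>\<bar>h\<bar>\<close>.
\<close>

lemma hyp_integral_power_series:
  assumes a: "a > 0" and m: "m > 0" and n: "n > 0" and x: "x < 1" and h: "\<bar>h\<bar> < min 1 (1 - x)"
  defines "coef \<equiv> (\<lambda>k. pochhammer a k / fact k *
     (LBINT s. beta_weight m n s * ((1 - x * (4 * s * (1 - s))) powr (- a) * (4 * s * (1 - s) / (1 - x * (4 * s * (1 - s)))) ^ k)))"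
  shows "(\<lambda>k. coef k * h ^ k) sums hyp_integral a m n (x + h)"
proof -
  define \<delta> where "\<delta> = min 1 (1 - x)"
  have \<delta>: "\<delta> > 0" "\<bar>h\<bar> < \<delta>" using x h by (auto simp: \<delta>_def)
  define p where "p s = 4 * s * (1 - s)" for s :: real
  define c where "c s = 1 - x * p s" for s :: real
  define q where "q s = p s / c s" for s
  have [measurable]: "p \<in> borel_measurable borel" "c \<in> borel_measurable borel" "q \<in> borel_measurable borel"
    unfolding p_def[abs_def] c_def[abs_def] q_def[abs_def] by measurable
  have p: "0 < p s" "p s \<le> 1" if "0 < s" "s < 1" for s
    using four_s_bounds[OF that] by (simp_all add: p_def)
  have c: "\<delta> \<le> c s" if "0 < s" "s < 1" for s
    using hyp_base_bound[of "p s" x] p[OF that] x by (simp add: c_def \<delta>_def)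
  have q: "0 \<le> q s" "q s \<le> 1 / \<delta>" if "0 < s" "s < 1" for s
    using p[OF that] c[OF that] \<delta> by (auto simp: q_def intro!: frac_le)
  define A where "A k = pochhammer a k / fact k" for k
  have A: "A k \<ge> 0" for k using a by (simp add: A_def pochhammer_nonneg)
  define f where "f k s = A k * (beta_weight m n s * (c s powr (- a) * q s ^ k)) * h ^ k" for k s
  have [measurable]: "f k \<in> borel_measurable borel" for k unfolding f_def[abs_def] by measurable
  have bound: "norm (f k s) \<le> beta_weight m n s * \<delta> powr (- a) * (A k * (\<bar>h\<bar> / \<delta>) ^ k)" for k s
  proof (cases "0 < s \<and> s < 1")
    case True
    have "c s powr (- a) \<le> \<delta> powr (- a)" using c[of s] \<delta> a True by (intro powr_mono2') auto
    moreover have "q s ^ k \<le> (1 / \<delta>) ^ k" using q[of s] True by (intro power_mono) auto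
    ultimately have "c s powr (- a) * q s ^ k \<le> \<delta> powr (- a) * (1 / \<delta>) ^ k"
      using q[of s] True by (intro mult_mono) auto
    then have "A k * (beta_weight m n s * (c s powr (- a) * q s ^ k)) * \<bar>h\<bar> ^ k \<le> A k * (beta_weight m n s * (\<delta> powr (- a) * (1 / \<delta>) ^ k)) * \<bar>h\<bar> ^ k"
      by (intro mult_right_mono mult_left_mono A beta_weight_nonneg) auto
    moreover have "norm (f k s) = A k * (beta_weight m n s * (c s powr (- a) * q s ^ k)) * \<bar>h\<bar> ^ k"
      using A[of k] beta_weight_nonneg[of m n s] q[of s] True by (simp add: f_def abs_mult power_abs)
    ultimately show ?thesis by (simp add: power_divide mult_ac)
  qed (auto simp: f_def beta_weight_def)
  have B: "integrable lborel (beta_weight m n)" "integral\<^sup>L lborel (beta_weight m n) = Beta m n"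
    using beta_weight_integral[OF m n] by (auto simp: has_bochner_integral_iff)
  have int: "integrable lborel (f k)" for k
  proof (rule Bochner_Integration.integrable_bound)
    show "integrable lborel (\<lambda>s. beta_weight m n s * \<delta> powr (- a) * (A k * (\<bar>h\<bar> / \<delta>) ^ k))"
      by (intro integrable_mult_left B)
    show "AE s in lborel. norm (f k s) \<le> norm (beta_weight m n s * \<delta> powr (- a) * (A k * (\<bar>h\<bar> / \<delta>) ^ k))"
      by (intro AE_I2 order.trans[OF bound]) simp
  qed measurable
  have sA: "summable (\<lambda>k. A k * (\<bar>h\<bar> / \<delta>) ^ k)"
    using pochhammer_binomial_sums[of "\<bar>h\<bar> / \<delta>" a] \<delta> unfolding A_def by (auto intro: sums_summable)
  have sn: "summable (\<lambda>k. norm (f k s))" for s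
    by (rule summable_comparison_test'[OF summable_mult[OF sA, of "beta_weight m n s * \<delta> powr (- a)"], of 0])
       (use bound in simp)
  have si: "summable (\<lambda>k. LBINT s. norm (f k s))"
  proof (rule summable_comparison_test'[OF summable_mult[OF sA, of "Beta m n * \<delta> powr (- a)"], of 0])
    fix k
    have "(LBINT s. norm (f k s)) \<le> (LBINT s. beta_weight m n s * \<delta> powr (- a) * (A k * (\<bar>h\<bar> / \<delta>) ^ k))"
      by (intro integral_mono integrable_norm int integrable_mult_left B bound)
    then show "norm (LBINT s. norm (f k s)) \<le> Beta m n * \<delta> powr (- a) * (A k * (\<bar>h\<bar> / \<delta>) ^ k)"
      using B by simp
  qed
  have "(\<lambda>k. LBINT s. f k s) sums (LBINT s. (\<Sum>k. f k s))"
    by (rule sums_integral[OF int _ si]) (use sn in auto)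
  moreover have "(\<Sum>k. f k s) = beta_weight m n s * (1 - (x + h) * (4 * s * (1 - s))) powr (- a)" for s
  proof (cases "0 < s \<and> s < 1")
    case True
    have cs: "c s > 0" using c[of s] \<delta> True by auto
    have "\<bar>h * q s\<bar> < 1"
    proof -
      have "\<bar>h * q s\<bar> \<le> \<bar>h\<bar> * (1 / \<delta>)" using q[of s] True by (simp only: abs_mult) (intro mult_left_mono; simp)
      also have "\<dots> < 1" using \<delta> by simp
      finally show ?thesis .
    qed
    from sums_mult[OF pochhammer_binomial_sums[OF this, of a], of "beta_weight m n s * c s powr (- a)"]
    have "(\<lambda>k. f k s) sums (beta_weight m n s * c s powr (- a) * (1 - h * q s) powr (- a))"
      by (simp add: f_def A_def power_mult_distrib mult_ac)
    then have "(\<Sum>k. f k s) = beta_weight m n s * (c s powr (- a) * (1 - h * q s) powr (- a))"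
      by (simp add: sums_iff mult.assoc)
    also have "c s powr (- a) * (1 - h * q s) powr (- a) = (c s * (1 - h * q s)) powr (- a)"
      using cs \<open>\<bar>h * q s\<bar> < 1\<close> by (subst powr_mult) auto
    also have "c s * (1 - h * q s) = 1 - (x + h) * (4 * s * (1 - s))"
    proof -
      have "c s * (1 - h * q s) = c s - h * p s" using cs by (simp add: q_def right_diff_distrib)
      then show ?thesis by (simp add: c_def p_def distrib_right)
    qed
    finally show ?thesis .
  qed (auto simp: f_def beta_weight_def)
  moreover have "(LBINT s. f k s) = coef k * h ^ k" for k
    unfolding f_def coef_def A_def c_def p_def q_def by simp
  ultimately show ?thesis by (simp add: hyp_integral_def)
qed

lemma hyp_integral_has_fps_expansion:
  assumes a: "a > 0" and m: "m > 0" and n: "n > 0" and x: "x < 1"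
  shows "\<exists>F. (\<lambda>h. hyp_integral a m n (x + h)) has_fps_expansion F"
proof -
  define coef where "coef = (\<lambda>k. pochhammer a k / fact k *
     (LBINT s. beta_weight m n s * ((1 - x * (4 * s * (1 - s))) powr (- a) * (4 * s * (1 - s) / (1 - x * (4 * s * (1 - s)))) ^ k)))"
  define \<delta> where "\<delta> = min 1 (1 - x)"
  have \<delta>: "\<delta> > 0" using x by (simp add: \<delta>_def)
  have s: "(\<lambda>k. coef k * h ^ k) sums hyp_integral a m n (x + h)" if "\<bar>h\<bar> < \<delta>" for h
    unfolding coef_def by (rule hyp_integral_power_series[OF a m n x]) (use that in \<open>simp add: \<delta>_def\<close>)
  have "conv_radius coef \<ge> norm (\<delta> / 2)"
    by (rule conv_radius_geI) (use s[of "\<delta> / 2"] \<delta> in \<open>auto intro: sums_summable\<close>)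
  then have "fps_conv_radius (Abs_fps coef) > 0"
    using \<delta> unfolding fps_conv_radius_def fps_nth_Abs_fps
    by (metis ereal_less(2) half_gt_zero order_less_le_trans zero_less_norm_iff less_numeral_extra(3))
  moreover have "\<forall>\<^sub>F h in nhds 0. eval_fps (Abs_fps coef) h = hyp_integral a m n (x + h)"
  proof -
    have "\<forall>\<^sub>F h in nhds 0. h \<in> {-\<delta><..<\<delta>}"
      using \<delta> by (intro eventually_nhds_in_open) auto
    then show ?thesis
    proof eventually_elim
      case (elim h)
      then have "\<bar>h\<bar> < \<delta>" by auto
      from s[OF this] show ?case by (simp add: eval_fps_def sums_iff)
    qed
  qed
  ultimately show ?thesis unfolding has_fps_expansion_def by blast
qed

lemma has_fps_expansion_nonzero_eventually:
  fixes f :: "real \<Rightarrow> real"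
  assumes f: "f has_fps_expansion F" and F: "F \<noteq> 0"
  shows "\<forall>\<^sub>F h in at 0. f h \<noteq> 0"
proof -
  define n where "n = subdegree F"
  define g where "g = (\<lambda>x. if x = 0 then fps_nth F n else f x / x ^ n)"
  have "g has_fps_expansion fps_shift n F"
    unfolding g_def by (rule has_fps_expansion_shift[OF f]) (auto simp: n_def)
  then have "continuous (at 0) g" by (rule has_fps_expansion_imp_continuous)
  then have "(g \<longlongrightarrow> fps_nth F n) (at 0)" by (simp add: isCont_def g_def)
  moreover have "fps_nth F n \<noteq> 0" using F by (simp add: n_def)
  ultimately have "\<forall>\<^sub>F h in at 0. g h \<noteq> 0" by (rule tendsto_imp_eventually_ne)
  moreover have "\<forall>\<^sub>F h in at (0::real). h \<noteq> 0" by (simp add: eventually_at_filter)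
  ultimately show ?thesis by eventually_elim (auto simp: g_def)
qed

text \<open>
  The points near which the two functions agree form an open set, and so do the remaining points,
  because a nonzero power series has no zeros close to its centre other than the centre itself.
\<close>

lemma real_analytic_identity:
  assumes f: "real_analytic_on f {..<b}" and g: "real_analytic_on g {..<b}"
    and eq: "\<forall>\<^sub>F y in nhds x0. f y = g y" and x0: "x0 < b" and x: "x < b"
  shows "f x = g x"
proof -
  define E where "E = {y \<in> {..<b}. \<forall>\<^sub>F z in nhds y. f z = g z}"
  have shift: "(\<forall>\<^sub>F z in nhds y. P z) \<longleftrightarrow> (\<forall>\<^sub>F h in nhds 0. P (y + h))" for P and y :: real
  proof -
    have "nhds y = filtermap (\<lambda>x. x - (- y)) (nhds 0)"
      using filtermap_nhds_shift[of "- y" 0] by simp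
    then show ?thesis by (simp add: eventually_filtermap add.commute)
  qed
  have shift': "(\<forall>\<^sub>F z in at y. P z) \<longleftrightarrow> (\<forall>\<^sub>F h in at 0. P (y + h))" for P and y :: real
    by (subst eventually_at_to_0) (simp add: add.commute)
  have "open E"
  proof (subst open_subopen, intro ballI)
    fix y assume y: "y \<in> E"
    then have "\<forall>\<^sub>F z in nhds y. \<forall>\<^sub>F w in nhds z. f w = g w" by (simp add: E_def eventually_eventually)
    moreover have "\<forall>\<^sub>F z in nhds y. z \<in> {..<b}" using y by (intro eventually_nhds_in_open) (auto simp: E_def)
    ultimately have "\<forall>\<^sub>F z in nhds y. z \<in> E" by eventually_elim (simp add: E_def)
    then show "\<exists>T. open T \<and> y \<in> T \<and> T \<subseteq> E" by (auto simp: eventually_nhds)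
  qed
  moreover have "open ({..<b} - E)"
  proof (subst open_subopen, intro ballI)
    fix y assume y: "y \<in> {..<b} - E"
    obtain F G where "(\<lambda>h. f (y + h)) has_fps_expansion F" "(\<lambda>h. g (y + h)) has_fps_expansion G"
      using f g y unfolding real_analytic_on_def by blast
    then have D: "(\<lambda>h. f (y + h) - g (y + h)) has_fps_expansion (F - G)" by (rule has_fps_expansion_diff)
    have "F - G \<noteq> 0"
    proof
      assume "F - G = 0"
      with D have "\<forall>\<^sub>F h in nhds 0. eval_fps 0 h = f (y + h) - g (y + h)"
        unfolding has_fps_expansion_def by metis
      then have "\<forall>\<^sub>F h in nhds 0. f (y + h) = g (y + h)" by eventually_elim simp
      then have "y \<in> E" using y by (simp add: E_def shift[of _ y])
      then show False using y by simp
    qed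
    from has_fps_expansion_nonzero_eventually[OF D this]
    have ne: "\<forall>\<^sub>F z in at y. f z \<noteq> g z" by (subst shift') simp
    have "\<forall>\<^sub>F z in nhds y. z \<notin> E"
    proof -
      have "\<forall>\<^sub>F z in at y. z \<notin> E"
        using ne by eventually_elim (auto simp: E_def dest: eventually_nhds_x_imp_x)
      then show ?thesis using y by (auto simp: eventually_at_filter elim: eventually_mono)
    qed
    moreover have "\<forall>\<^sub>F z in nhds y. z \<in> {..<b}" using y by (intro eventually_nhds_in_open) auto
    ultimately have "\<forall>\<^sub>F z in nhds y. z \<in> {..<b} - E" by eventually_elim simp
    then show "\<exists>T. open T \<and> y \<in> T \<and> T \<subseteq> {..<b} - E" by (auto simp: eventually_nhds)
  qed
  moreover have "connected {..<b}" by (simp add: convex_connected)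
  moreover have "x0 \<in> E" using eq x0 by (simp add: E_def)
  ultimately have "({..<b} - E) \<inter> {..<b} = {}"
    using connectedD[of "{..<b}" E "{..<b} - E"] x0 by auto
  then have "x \<in> E" using x by auto
  then show ?thesis by (auto simp: E_def dest: eventually_nhds_x_imp_x)
qed

lemma Beta_shift_ratio:
  fixes m n :: real
  assumes "m > 0" "n > 0"
  shows "4 ^ k * Beta (m + real k) (n + real k) = Beta m n * (pochhammer m k * pochhammer n k / (pochhammer ((m + n) / 2) k * pochhammer ((m + n + 1) / 2) k))"
proof -
  have nz: "z \<notin> \<int>\<^sub>\<le>\<^sub>0" if "z > 0" for z :: real using that by (auto elim!: nonpos_Ints_cases)
  have P: "pochhammer z j = Gamma (z + real j) / Gamma z" "Gamma z > 0" if "z > 0" for z :: real and j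
    using that by (auto simp: pochhammer_Gamma nz Gamma_real_pos)
  have "pochhammer (m + n) (2 * k) = 4 ^ k * pochhammer ((m + n) / 2) k * pochhammer ((m + n + 1) / 2) k"
    using pochhammer_double[of "(m + n) / 2" k] by (simp add: power_mult add_divide_distrib)
  moreover have pos: "pochhammer ((m + n) / 2) k > 0" "pochhammer ((m + n + 1) / 2) k > 0"
    using assms by (auto intro!: pochhammer_pos)
  ultimately have "pochhammer m k * pochhammer n k / (pochhammer ((m + n) / 2) k * pochhammer ((m + n + 1) / 2) k)
    = 4 ^ k * (pochhammer m k * pochhammer n k / pochhammer (m + n) (2 * k))"
    by (simp add: field_simps)
  moreover have "m + real k + (n + real k) = m + n + real (2 * k)" by simp
  moreover have "Beta (m + real k) (n + real k) = Beta m n * (pochhammer m k * pochhammer n k / pochhammer (m + n) (2 * k))"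
  proof -
    have "Gamma m \<noteq> 0" "Gamma n \<noteq> 0" "Gamma (m + n) \<noteq> 0"
      using assms by (metis P(2) less_irrefl add_pos_pos)+
    then show ?thesis
      unfolding Beta_def \<open>m + real k + (n + real k) = m + n + real (2 * k)\<close>
      using assms by (simp add: P(1))
  qed
  ultimately show ?thesis by simp
qed

lemma beta_weight_mult_power:
  "beta_weight m n s * (4 * s * (1 - s)) ^ k = 4 ^ k * beta_weight (m + real k) (n + real k) s"
proof (cases "0 < s \<and> s < 1")
  case True
  then have "s powr (m - 1) * s ^ k = s powr (m + real k - 1)" "(1 - s) powr (n - 1) * (1 - s) ^ k = (1 - s) powr (n + real k - 1)"
    by (simp_all add: powr_realpow[symmetric] powr_add[symmetric] algebra_simps)
  moreover have "s powr (m - 1) * (1 - s) powr (n - 1) * (4 * s * (1 - s)) ^ k = 4 ^ k * ((s powr (m - 1) * s ^ k) * ((1 - s) powr (n - 1) * (1 - s) ^ k))"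
    by (simp only: power_mult_distrib mult_ac)
  ultimately show ?thesis using True by (simp add: beta_weight_def)
qed (auto simp: beta_weight_def)

text \<open>
  The integral satisfies both conditions by which \<open>hyp3F2\<close> is chosen, and on \<open>{..<1}\<close> they
  determine a function uniquely.
\<close>

lemma hyp3F2_eq_integral:
  assumes a: "a > 0" and m: "m > 0" and n: "n > 0" and w: "w < 1"
  shows "hyp3F2 a m n ((m + n) / 2) ((m + n + 1) / 2) w = hyp_integral a m n w / Beta m n"
proof -
  define H where "H w = hyp_integral a m n w / Beta m n" for w
  define P where "P g \<longleftrightarrow> real_analytic_on g {..<1} \<and>
     (\<forall>w\<in>{-1<..<1}. (\<lambda>k. pochhammer a k * pochhammer m k * pochhammer n k /
        (pochhammer ((m + n) / 2) k * pochhammer ((m + n + 1) / 2) k * fact k) * w ^ k) sums g w)" for g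
  have B0: "Beta m n > 0" using m n by (simp add: Beta_def Gamma_real_pos)
  have PH: "P H"
    unfolding P_def
  proof (intro conjI ballI)
    show "real_analytic_on H {..<1}"
      unfolding real_analytic_on_def
    proof
      fix x :: real assume "x \<in> {..<1}"
      then obtain F where "(\<lambda>h. hyp_integral a m n (x + h)) has_fps_expansion F"
        using hyp_integral_has_fps_expansion[OF a m n, of x] by auto
      from has_fps_expansion_cmult_left[OF this, of "1 / Beta m n"]
      show "\<exists>F. (\<lambda>h. H (x + h)) has_fps_expansion F" by (auto simp: H_def)
    qed
    fix w :: real assume w: "w \<in> {-1<..<1}"
    have H1: "(\<lambda>k. pochhammer a k / fact k *
       (LBINT s. beta_weight m n s * ((1 - 0 * (4 * s * (1 - s))) powr (- a) * (4 * s * (1 - s) / (1 - 0 * (4 * s * (1 - s)))) ^ k)) * w ^ k)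
       sums hyp_integral a m n (0 + w)"
      by (rule hyp_integral_power_series[OF a m n]) (use w in auto)
    have H2: "(LBINT s. beta_weight m n s * ((1 - 0 * (4 * s * (1 - s))) powr (- a) * (4 * s * (1 - s) / (1 - 0 * (4 * s * (1 - s)))) ^ k))
       = Beta m n * (pochhammer m k * pochhammer n k / (pochhammer ((m + n) / 2) k * pochhammer ((m + n + 1) / 2) k))" for k
    proof -
      have "(LBINT s. beta_weight m n s * ((1 - 0 * (4 * s * (1 - s))) powr (- a) * (4 * s * (1 - s) / (1 - 0 * (4 * s * (1 - s)))) ^ k))
         = (LBINT s. 4 ^ k * beta_weight (m + real k) (n + real k) s)"
        by (simp add: beta_weight_mult_power)
      also have "\<dots> = 4 ^ k * Beta (m + real k) (n + real k)"
        using beta_weight_integral[of "m + real k" "n + real k"] m n by (simp add: has_bochner_integral_iff)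
      finally show ?thesis by (simp only: Beta_shift_ratio[OF m n])
    qed
    have "(\<lambda>k. pochhammer a k / fact k * (Beta m n * (pochhammer m k * pochhammer n k / (pochhammer ((m + n) / 2) k * pochhammer ((m + n + 1) / 2) k))) * w ^ k) sums hyp_integral a m n w"
      using H1 unfolding H2 add_0_left .
    from sums_divide[OF this, of "Beta m n"]
    show "(\<lambda>k. pochhammer a k * pochhammer m k * pochhammer n k /
        (pochhammer ((m + n) / 2) k * pochhammer ((m + n + 1) / 2) k * fact k) * w ^ k) sums H w"
      using B0 by (simp add: H_def mult_ac)
  qed
  have "hyp3F2 a m n ((m + n) / 2) ((m + n + 1) / 2) = (SOME g. P g)"
    unfolding hyp3F2_def P_def ..
  then have Ph: "P (hyp3F2 a m n ((m + n) / 2) ((m + n + 1) / 2))"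
    using someI[of P, OF PH] by simp
  have "hyp3F2 a m n ((m + n) / 2) ((m + n + 1) / 2) w = H w"
  proof (rule real_analytic_identity[of "hyp3F2 a m n ((m + n) / 2) ((m + n + 1) / 2)" 1 H 0])
    have "\<forall>\<^sub>F y in nhds (0::real). y \<in> {-1<..<1}" by (intro eventually_nhds_in_open) auto
    then show "\<forall>\<^sub>F y in nhds 0. hyp3F2 a m n ((m + n) / 2) ((m + n + 1) / 2) y = H y"
    proof eventually_elim
      case (elim y)
      show ?case
        by (rule sums_unique2[OF bspec[OF conjunct2[OF Ph[unfolded P_def]] elim] bspec[OF conjunct2[OF PH[unfolded P_def]] elim]])
    qed
  qed (use w in \<open>simp_all add: conjunct1[OF PH[unfolded P_def]] conjunct1[OF Ph[unfolded P_def]]\<close>)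
  then show ?thesis by (simp add: H_def)
qed

section \<open>The convolution of two Sobolev weights\<close>

lemma nn_integral_Gamma_scaled:
  assumes a: "a > 0" and A: "A > (0::real)"
  shows "(\<integral>\<^sup>+t. ennreal (indicator {0<..} t * t powr (a - 1) * exp (- A * t)) \<partial>lborel) = ennreal (Gamma a * A powr (- a))"
    (is "?I = _")
proof -
  have "ennreal (Gamma a) = (\<integral>\<^sup>+t. ennreal (indicator {0..} t * t powr (a - 1) / exp t) \<partial>lborel)"
    by (rule Gamma_conv_nn_integral_real[OF a])
  also have "\<dots> = ennreal \<bar>A\<bar> * (\<integral>\<^sup>+t. ennreal (indicator {0..} (0 + A * t) * (0 + A * t) powr (a - 1) / exp (0 + A * t)) \<partial>lborel)"
    by (rule nn_integral_real_affine) (use A in auto)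
  also have "(\<integral>\<^sup>+t. ennreal (indicator {0..} (0 + A * t) * (0 + A * t) powr (a - 1) / exp (0 + A * t)) \<partial>lborel)
     = (\<integral>\<^sup>+t. ennreal (A powr (a - 1)) * ennreal (indicator {0<..} t * t powr (a - 1) * exp (- A * t)) \<partial>lborel)"
  proof (intro nn_integral_cong)
    fix t
    have "indicator {0..} (0 + A * t) * (0 + A * t) powr (a - 1) / exp (0 + A * t) = A powr (a - 1) * (indicator {0<..} t * t powr (a - 1) * exp (- A * t))"
      using A by (cases "t = 0") (auto simp: indicator_def powr_mult exp_minus divide_inverse zero_le_mult_iff)
    then show "ennreal (indicator {0..} (0 + A * t) * (0 + A * t) powr (a - 1) / exp (0 + A * t)) = ennreal (A powr (a - 1)) * ennreal (indicator {0<..} t * t powr (a - 1) * exp (- A * t))"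
      by (simp add: ennreal_mult')
  qed
  also have "\<dots> = ennreal (A powr (a - 1)) * ?I"
    by (rule nn_integral_cmult) measurable
  finally have "ennreal (Gamma a) = ennreal (A powr a) * ?I"
    using A by (simp add: mult.assoc[symmetric] powr_mult_base flip: ennreal_mult')
  then have "ennreal (A powr (- a)) * ennreal (Gamma a) = ennreal (A powr (- a) * A powr a) * ?I"
    by (simp add: mult.assoc ennreal_mult')
  also have "A powr (- a) * A powr a = 1" using A by (simp flip: powr_add)
  finally have "?I = ennreal (A powr (- a)) * ennreal (Gamma a)" by simp
  also have "\<dots> = ennreal (Gamma a * A powr (- a))"
    using Gamma_real_pos[OF a] by (subst ennreal_mult[symmetric]) (auto simp: mult.commute)
  finally show ?thesis .
qed

text \<open>
  Write both powers as Gamma integrals over \<open>t\<close> and \<open>t'\<close>. The new variables are \<open>r = t + t'\<close> and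
  \<open>s = t / r\<close>, the change of variables that also relates Gamma and Beta functions.
\<close>

lemma Feynman_parametrisation:
  assumes m: "m > 0" and n: "n > 0" and A: "A > (0::real)" and B: "B > (0::real)"
  shows "ennreal (Gamma m * Gamma n * (A powr (- m) * B powr (- n))) =
    (\<integral>\<^sup>+r. \<integral>\<^sup>+s. ennreal (indicator {0<..} r * r powr (m + n - 1) * beta_weight m n s *
        exp (- r * (s * A + (1 - s) * B))) \<partial>lborel \<partial>lborel)"
    (is "?l = (\<integral>\<^sup>+r. \<integral>\<^sup>+s. ennreal (?P r s) \<partial>lborel \<partial>lborel)")
proof -
  define F where "F t = indicator {0<..} t * t powr (m - 1) * exp (- A * t)" for t :: real
  define G where "G t = indicator {0<..} t * t powr (n - 1) * exp (- B * t)" for t :: real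
  have [measurable]: "F \<in> borel_measurable borel" "G \<in> borel_measurable borel"
    unfolding F_def[abs_def] G_def[abs_def] by measurable
  have nonneg: "F t \<ge> 0" "G t \<ge> 0" for t by (auto simp: F_def G_def)
  let ?FG = "\<lambda>r t. ennreal (F t) * ennreal (G (r - t))"
  have "?l = ennreal (Gamma m * A powr (- m)) * ennreal (Gamma n * B powr (- n))"
    using Gamma_real_pos[OF m] Gamma_real_pos[OF n] by (subst ennreal_mult[symmetric]) (auto simp: mult_ac)
  also have "\<dots> = (\<integral>\<^sup>+t. ennreal (F t) \<partial>lborel) * (\<integral>\<^sup>+s. ennreal (G s) \<partial>lborel)"
    unfolding F_def G_def by (simp only: nn_integral_Gamma_scaled[OF m A] nn_integral_Gamma_scaled[OF n B])
  also have "\<dots> = (\<integral>\<^sup>+t. ennreal (F t) * (\<integral>\<^sup>+s. ennreal (G s) \<partial>lborel) \<partial>lborel)"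
    by (rule nn_integral_multc[symmetric]) measurable
  also have "\<dots> = (\<integral>\<^sup>+t. \<integral>\<^sup>+r. ?FG r t \<partial>lborel \<partial>lborel)"
  proof (intro nn_integral_cong)
    fix t
    have "(\<integral>\<^sup>+s. ennreal (G s) \<partial>lborel) = (\<integral>\<^sup>+r. ennreal (G (r - t)) \<partial>lborel)"
      using nn_integral_real_affine[of "\<lambda>s. ennreal (G s)" 1 "- t"] by simp
    then show "ennreal (F t) * (\<integral>\<^sup>+s. ennreal (G s) \<partial>lborel) = (\<integral>\<^sup>+r. ?FG r t \<partial>lborel)"
      by (simp add: nn_integral_cmult)
  qed
  also have "\<dots> = (\<integral>\<^sup>+r. \<integral>\<^sup>+t. ?FG r t \<partial>lborel \<partial>lborel)"
    by (rule lborel_pair.Fubini') measurable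
  also have "\<dots> = (\<integral>\<^sup>+r. \<integral>\<^sup>+s. ennreal (?P r s) \<partial>lborel \<partial>lborel)"
  proof (rule nn_integral_cong)
    fix r :: real
    show "(\<integral>\<^sup>+t. ?FG r t \<partial>lborel) = (\<integral>\<^sup>+s. ennreal (?P r s) \<partial>lborel)"
    proof (cases "r > 0")
      case True
      have "(\<integral>\<^sup>+t. ?FG r t \<partial>lborel) = ennreal \<bar>r\<bar> * (\<integral>\<^sup>+s. ?FG r (0 + r * s) \<partial>lborel)"
        by (rule nn_integral_real_affine) (use True in auto)
      also have "\<dots> = (\<integral>\<^sup>+s. ennreal \<bar>r\<bar> * ?FG r (0 + r * s) \<partial>lborel)"
        by (rule nn_integral_cmult[symmetric]) measurable
      also have "\<dots> = (\<integral>\<^sup>+s. ennreal (?P r s) \<partial>lborel)"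
      proof (intro nn_integral_cong)
        fix s
        have "r * (F (r * s) * G (r * (1 - s))) = ?P r s"
        proof (cases "0 < s \<and> s < 1")
          case s: True
          have "r * (F (r * s) * G (r * (1 - s))) = r * ((r * s) powr (m - 1) * exp (- A * (r * s)) *
              ((r * (1 - s)) powr (n - 1) * exp (- B * (r * (1 - s)))))"
            using s True by (simp add: F_def G_def indicator_def)
          also have "\<dots> = (r * r powr (m - 1) * r powr (n - 1)) * beta_weight m n s *
              (exp (- A * (r * s)) * exp (- B * (r * (1 - s))))"
            using s True by (simp add: powr_mult beta_weight_def)
          also have "r * r powr (m - 1) * r powr (n - 1) = r powr (m + n - 1)"
          proof -
            have "r * r powr (m - 1) * r powr (n - 1) = r powr 1 * r powr (m - 1) * r powr (n - 1)" using True by simp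
            also have "\<dots> = r powr (1 + (m - 1) + (n - 1))" by (simp only: powr_add)
            finally show ?thesis by (simp add: algebra_simps)
          qed
          also have "exp (- A * (r * s)) * exp (- B * (r * (1 - s))) = exp (- r * (s * A + (1 - s) * B))"
            by (simp add: exp_add[symmetric] algebra_simps)
          finally show ?thesis using s True by (simp add: indicator_def)
        next
          case False
          then have "F (r * s) = 0 \<or> G (r * (1 - s)) = 0"
            using True by (auto simp: F_def G_def indicator_def zero_less_mult_iff not_less)
          then show ?thesis using False by (auto simp: indicator_def beta_weight_def)
        qed
        moreover have "r - (0 + r * s) = r * (1 - s)" by (simp add: algebra_simps)
        ultimately show "ennreal \<bar>r\<bar> * ?FG r (0 + r * s) = ennreal (?P r s)"
          using True nonneg by (simp only: ennreal_mult[symmetric] abs_of_pos add_0_left mult_nonneg_nonneg less_imp_le)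
      qed
      finally show ?thesis .
    next
      case False
      then have "F t = 0 \<or> G (r - t) = 0" for t by (auto simp: F_def G_def indicator_def)
      then have "?FG r t = 0" for t by (metis ennreal_0 mult_zero_left mult_zero_right)
      then have "(\<integral>\<^sup>+t. ?FG r t \<partial>lborel) = 0" by (simp only: nn_integral_const mult_zero_left)
      then show ?thesis using False by simp
    qed
  qed
  finally show ?thesis .
qed

lemma nn_integral_gaussian_translate:
  fixes c :: "real^'d::finite"
  assumes "r > 0"
  shows "(\<integral>\<^sup>+h. ennreal (exp (- r * (norm (h - c))\<^sup>2)) \<partial>lborel) = ennreal ((pi / r) powr (CARD('d) / 2))"
proof -
  have "(\<integral>\<^sup>+h. ennreal (exp (- r * (norm (h - c))\<^sup>2)) \<partial>lborel) = (\<integral>\<^sup>+h. ennreal (exp (- r * (norm (h::real^'d))\<^sup>2)) \<partial>lborel)"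
    using nn_integral_vec_affine[of "\<lambda>h. ennreal (exp (- r * (norm (h - c))\<^sup>2))" 1 c] by simp
  also have "\<dots> = ennreal ((pi / r) powr (CARD('d) / 2))"
    using integral_gaussian[OF assms, where 'd='d] by (subst nn_integral_eq_integral) (auto simp: has_bochner_integral_iff)
  finally show ?thesis .
qed

text \<open>
  The supremum over \<open>k\<close> of this function, multiplied by the Sobolev weight of order \<open>l\<close> at \<open>k\<close> and a
  power of \<open>2\<pi>\<close>, controls the squared norm of a product.
\<close>

definition conv_kernel :: "real \<Rightarrow> real \<Rightarrow> real^'d::finite \<Rightarrow> ennreal" where
  "conv_kernel m n k = (\<integral>\<^sup>+h. ennreal ((1 + (norm (k - h))\<^sup>2) powr (- m) * (1 + (norm h)\<^sup>2) powr (- n)) \<partial>lborel)"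

text \<open>
  After the Feynman parametrisation the exponent is quadratic in \<open>h\<close>. The Gaussian integral over \<open>h\<close>
  lowers the power of \<open>r\<close> by \<open>d / 2\<close>, and the integral over \<open>r\<close> is again a Gamma integral.
\<close>

lemma conv_kernel_eq:
  fixes k :: "real^'d::finite"
  assumes m: "m > 0" and n: "n > 0" and d: "m + n > CARD('d) / 2"
  shows "ennreal (Gamma m * Gamma n) * conv_kernel m n k =
    ennreal (pi powr (CARD('d) / 2) * Gamma (m + n - CARD('d) / 2)) *
    (\<integral>\<^sup>+s. ennreal (beta_weight m n s * (1 + s * (1 - s) * (norm k)\<^sup>2) powr (- (m + n - CARD('d) / 2))) \<partial>lborel)"
proof -
  let ?D = "real CARD('d) / 2"
  define P where "P h r s = indicator {0<..} r * r powr (m + n - 1) * beta_weight m n s *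
      exp (- r * (s * (1 + (norm (k - h))\<^sup>2) + (1 - s) * (1 + (norm h)\<^sup>2)))" for h :: "real^'d" and r s :: real
  have Pm [measurable]: "(\<lambda>x. ennreal (P (f x) (g x) (e x))) \<in> borel_measurable M"
    if "f \<in> borel_measurable M" "g \<in> borel_measurable M" "e \<in> borel_measurable M" for f g e and M :: "'x measure"
    unfolding P_def using that by measurable
  define Q where "Q s = 1 + s * (1 - s) * (norm k)\<^sup>2" for s
  let ?W = "\<lambda>s. ennreal (beta_weight m n s * pi powr ?D)"
  let ?R = "\<lambda>s r. ennreal (indicator {0<..} r * r powr (m + n - ?D - 1) * exp (- Q s * r))"
  have "ennreal (Gamma m * Gamma n) * conv_kernel m n k = (\<integral>\<^sup>+h. ennreal (Gamma m * Gamma n *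
      ((1 + (norm (k - h))\<^sup>2) powr (- m) * (1 + (norm h)\<^sup>2) powr (- n))) \<partial>lborel)"
    unfolding conv_kernel_def
    by (subst nn_integral_cmult[symmetric]) (auto simp: ennreal_mult'[symmetric] Gamma_real_pos m n intro!: nn_integral_cong)
  also have "\<dots> = (\<integral>\<^sup>+h. \<integral>\<^sup>+r. \<integral>\<^sup>+s. ennreal (P h r s) \<partial>lborel \<partial>lborel \<partial>lborel)"
    unfolding P_def by (intro nn_integral_cong Feynman_parametrisation m n) (auto intro: add_pos_nonneg)
  also have "\<dots> = (\<integral>\<^sup>+r. \<integral>\<^sup>+h. \<integral>\<^sup>+s. ennreal (P h r s) \<partial>lborel \<partial>lborel \<partial>lborel)"
    by (rule lborel_pair.Fubini') measurable
  also have "\<dots> = (\<integral>\<^sup>+r. \<integral>\<^sup>+s. \<integral>\<^sup>+h. ennreal (P h r s) \<partial>lborel \<partial>lborel \<partial>lborel)"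
    by (intro nn_integral_cong lborel_pair.Fubini') measurable
  also have "\<dots> = (\<integral>\<^sup>+r. \<integral>\<^sup>+s. ?W s * ?R s r \<partial>lborel \<partial>lborel)"
  proof (intro nn_integral_cong)
    fix r s :: real
    show "(\<integral>\<^sup>+h. ennreal (P h r s) \<partial>lborel) = ?W s * ?R s r"
    proof (cases "r > 0")
      case True
      define c where "c = r powr (m + n - 1) * beta_weight m n s * exp (- Q s * r)"
      have c0: "c \<ge> 0" by (simp add: c_def beta_weight_nonneg)
      have "P h r s = c * exp (- r * (norm (h - s *\<^sub>R k))\<^sup>2)" for h
      proof -
        \<comment> \<open>Complete the square in \<open>h\<close>.\<close>
        have "s * (1 + (norm (k - h))\<^sup>2) + (1 - s) * (1 + (norm h)\<^sup>2) = Q s + (norm (h - s *\<^sub>R k))\<^sup>2"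
          unfolding Q_def power2_norm_eq_inner
          by (simp add: inner_diff_left inner_diff_right inner_commute algebra_simps power2_eq_square)
        then have "exp (- r * (s * (1 + (norm (k - h))\<^sup>2) + (1 - s) * (1 + (norm h)\<^sup>2))) =
            exp (- Q s * r) * exp (- r * (norm (h - s *\<^sub>R k))\<^sup>2)"
          by (simp add: exp_add[symmetric] algebra_simps)
        then show ?thesis using True by (simp add: P_def c_def)
      qed
      then have "(\<integral>\<^sup>+h. ennreal (P h r s) \<partial>lborel) = (\<integral>\<^sup>+h. ennreal c * ennreal (exp (- r * (norm (h - s *\<^sub>R k))\<^sup>2)) \<partial>lborel)"
        using c0 by (simp add: ennreal_mult')
      also have "\<dots> = ennreal c * ennreal ((pi / r) powr ?D)"
        by (subst nn_integral_cmult) (measurable, simp only: nn_integral_gaussian_translate[OF True])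
      also have "\<dots> = ennreal (c * (pi / r) powr ?D)"
        using c0 by (simp add: ennreal_mult')
      also have "c * (pi / r) powr ?D = (beta_weight m n s * pi powr ?D) *
         (indicator {0<..} r * r powr (m + n - ?D - 1) * exp (- Q s * r))"
      proof -
        have "r powr (m + n - 1) = r powr (m + n - ?D - 1) * r powr ?D"
          unfolding powr_add[symmetric] by (rule arg_cong) simp
        then have "r powr (m + n - 1) * (pi / r) powr ?D = pi powr ?D * r powr (m + n - ?D - 1)"
          using True by (simp add: powr_divide)
        then show ?thesis using True by (simp add: c_def mult_ac)
      qed
      also have "ennreal \<dots> = ?W s * ?R s r"
        by (rule ennreal_mult) (auto intro!: mult_nonneg_nonneg beta_weight_nonneg)
      finally show ?thesis .
    next
      case False
      then show ?thesis by (simp add: P_def)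
    qed
  qed
  also have "\<dots> = (\<integral>\<^sup>+s. \<integral>\<^sup>+r. ?W s * ?R s r \<partial>lborel \<partial>lborel)"
    unfolding Q_def by (rule lborel_pair.Fubini') measurable
  also have "\<dots> = (\<integral>\<^sup>+s. ennreal (pi powr ?D * Gamma (m + n - ?D)) *
      ennreal (beta_weight m n s * Q s powr (- (m + n - ?D))) \<partial>lborel)"
  proof (intro nn_integral_cong)
    fix s :: real
    have d': "m + n - ?D > 0" using d by simp
    show "(\<integral>\<^sup>+r. ?W s * ?R s r \<partial>lborel) =
       ennreal (pi powr ?D * Gamma (m + n - ?D)) * ennreal (beta_weight m n s * Q s powr (- (m + n - ?D)))"
    proof (cases "0 < s \<and> s < 1")
      case True
      then have Q: "Q s > 0" unfolding Q_def by (intro add_pos_nonneg mult_nonneg_nonneg) auto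
      have "(\<integral>\<^sup>+r. ?W s * ?R s r \<partial>lborel) = ?W s * ennreal (Gamma (m + n - ?D) * Q s powr (- (m + n - ?D)))"
        by (subst nn_integral_cmult) (auto simp only: nn_integral_Gamma_scaled[OF d' Q], measurable)
      also have "\<dots> = ennreal (pi powr ?D * Gamma (m + n - ?D)) * ennreal (beta_weight m n s * Q s powr (- (m + n - ?D)))"
        using Gamma_real_pos[OF d'] by (simp add: ennreal_mult[symmetric] beta_weight_nonneg mult_ac)
      finally show ?thesis .
    qed (auto simp: beta_weight_def)
  qed
  also have "\<dots> = ennreal (pi powr ?D * Gamma (m + n - ?D)) *
      (\<integral>\<^sup>+s. ennreal (beta_weight m n s * Q s powr (- (m + n - ?D))) \<partial>lborel)"
    unfolding Q_def by (rule nn_integral_cmult) measurable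
  finally show ?thesis unfolding Q_def .
qed

section \<open>Products in Sobolev spaces\<close>

lemma one_plus_norm_powr_le_decay:
  fixes k :: "real^'d::finite"
  assumes "m \<ge> real CARD('d)"
  shows "(1 + (norm k)\<^sup>2) powr (- m) \<le> decay k"
proof -
  have "1 + (k $ i)\<^sup>2 \<le> 1 + (norm k)\<^sup>2" for i
    using component_le_norm_cart[of k i] by (metis abs_norm_cancel abs_le_square_iff add_left_mono)
  then have "(\<Prod>i\<in>UNIV. 1 + (k $ i)\<^sup>2) \<le> (\<Prod>i\<in>(UNIV::'d set). 1 + (norm k)\<^sup>2)"
    by (intro prod_mono) auto
  also have "\<dots> = (1 + (norm k)\<^sup>2) powr real CARD('d)"
    by (simp add: powr_realpow add_pos_nonneg)
  also have "\<dots> \<le> (1 + (norm k)\<^sup>2) powr m"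
    using assms by (intro powr_mono) auto
  finally have *: "(\<Prod>i\<in>UNIV. 1 + (k $ i)\<^sup>2) \<le> (1 + (norm k)\<^sup>2) powr m" .
  have "(\<Prod>i\<in>UNIV. 1 + (k $ i)\<^sup>2) > 0" by (intro prod_pos) (auto intro: add_pos_nonneg)
  then have "inverse ((1 + (norm k)\<^sup>2) powr m) \<le> inverse (\<Prod>i\<in>UNIV. 1 + (k $ i)\<^sup>2)"
    using * by (intro le_imp_inverse_le) auto
  then show ?thesis by (simp add: powr_minus decay_def prod_dividef inverse_eq_divide)
qed

text \<open>
  The squared norm of order \<open>l\<close> of any distribution with Fourier transform \<open>h\<close>. In contrast to
  \<open>sobolev_norm\<close> it is infinite outside the space and does not involve a choice of \<open>h\<close>.
\<close>

definition sobolev_energy :: "real \<Rightarrow> (real^'d::finite \<Rightarrow> complex) \<Rightarrow> ennreal" where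
  "sobolev_energy l h = (\<integral>\<^sup>+k. ennreal ((1 + (norm k)\<^sup>2) powr l * (norm (h k))\<^sup>2) \<partial>lborel)"

lemma norm_weight_square:
  fixes k :: "real^'d::finite" and z :: complex
  shows "(norm ((1 + (norm k)\<^sup>2) powr (l / 2) *\<^sub>R z))\<^sup>2 = (1 + (norm k)\<^sup>2) powr l * (norm z)\<^sup>2"
proof -
  have "((1 + (norm k)\<^sup>2) powr (l / 2))\<^sup>2 = (1 + (norm k)\<^sup>2) powr l"
    by (simp add: power2_eq_square flip: powr_add)
  then show ?thesis by (simp add: power_mult_distrib)
qed

lemma sobolevI:
  fixes h :: "real^'d::finite \<Rightarrow> complex"
  assumes T: "T \<in> tempered" and h: "is_fun_of h (fourier_dist T)" and fin: "sobolev_energy l h < \<infinity>"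
  shows "T \<in> sobolev l"
    and "ennreal ((sobolev_norm l T)\<^sup>2) = sobolev_energy l h"
proof -
  note u = fun_of_dist_AE_eq[OF h]
  have [measurable]: "fun_of_dist (fourier_dist T) \<in> borel_measurable borel"
    using u(1) by (simp add: is_fun_of_def)
  have wm: "weighted_fourier l T \<in> borel_measurable lborel"
    unfolding weighted_fourier_def[abs_def] by measurable
  have e: "(\<integral>\<^sup>+k. ennreal ((norm (weighted_fourier l T k))\<^sup>2) \<partial>lborel) = sobolev_energy l h"
    unfolding sobolev_energy_def
    by (rule nn_integral_cong_AE) (use u(2) in eventually_elim, simp only: weighted_fourier_def norm_weight_square)
  have int: "integrable lborel (\<lambda>k. (norm (weighted_fourier l T k))\<^sup>2)"
    using wm fin by (intro integrableI_bounded) (auto simp: e)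
  show "T \<in> sobolev l"
    using T h wm int by (auto simp: sobolev_def in_L2_def)
  have "(sobolev_norm l T)\<^sup>2 = (LBINT k. (norm (weighted_fourier l T k))\<^sup>2)"
    by (simp add: sobolev_norm_def L2_norm_def)
  then show "ennreal ((sobolev_norm l T)\<^sup>2) = sobolev_energy l h"
    using nn_integral_eq_integral[OF int] by (simp add: e)
qed

lemma sobolevD:
  fixes T :: "'d::finite distribution"
  assumes T: "T \<in> sobolev l"
  obtains h where "is_fun_of h (fourier_dist T)" "sobolev_energy l h = ennreal ((sobolev_norm l T)\<^sup>2)"
proof
  let ?h = "fun_of_dist (fourier_dist T)"
  show h: "is_fun_of ?h (fourier_dist T)"
    using T fun_of_dist_AE_eq(1) by (auto simp: sobolev_def)
  have int: "integrable lborel (\<lambda>k. (norm (weighted_fourier l T k))\<^sup>2)"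
    using T by (auto simp: sobolev_def in_L2_def)
  have "sobolev_energy l ?h = (\<integral>\<^sup>+k. ennreal ((norm (weighted_fourier l T k))\<^sup>2) \<partial>lborel)"
    unfolding sobolev_energy_def by (simp only: weighted_fourier_def norm_weight_square)
  also have "\<dots> = ennreal ((sobolev_norm l T)\<^sup>2)"
    using nn_integral_eq_integral[OF int] by (simp add: sobolev_norm_def L2_norm_def)
  finally show "sobolev_energy l ?h = ennreal ((sobolev_norm l T)\<^sup>2)" .
qed

lemma sobolev_norm_nonneg: "sobolev_norm l T \<ge> 0"
  by (simp add: sobolev_norm_def L2_norm_def)

text \<open>
  Cauchy-Schwarz with the weight \<open>(1 + |k|\<^sup>2)\<close> to the power \<open>-m\<close>. Integrability of the transform is
  what makes the elements of the Sobolev space continuous functions given by absolutely convergent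
  Fourier integrals.
\<close>

lemma sobolev_energy_imp_integrable:
  fixes h :: "real^'d::finite \<Rightarrow> complex"
  assumes [measurable]: "h \<in> borel_measurable borel" and m: "m \<ge> real CARD('d)" and fin: "sobolev_energy m h < \<infinity>"
  shows "integrable lborel h"
proof (rule integrableI_bounded)
  let ?w = "\<lambda>k::real^'d. 1 + (norm k)\<^sup>2"
  have pos: "?w k > 0" for k by (simp add: add_pos_nonneg)
  have eq: "ennreal (norm (h k)) = ennreal (?w k powr (- m / 2)) * ennreal (?w k powr (m / 2) * norm (h k))" for k
  proof -
    have "?w k powr (- m / 2) * ?w k powr (m / 2) = 1" using pos[of k] by (simp flip: powr_add)
    then have "norm (h k) = ?w k powr (- m / 2) * (?w k powr (m / 2) * norm (h k))"
      by (simp flip: mult.assoc)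
    then show ?thesis by (metis ennreal_mult' powr_ge_zero)
  qed
  have sq: "ennreal (?w k powr (- m / 2)) ^ 2 = ennreal (?w k powr (- m))"
    "ennreal (?w k powr (m / 2) * norm (h k)) ^ 2 = ennreal (?w k powr m * (norm (h k))\<^sup>2)" for k
  proof -
    have "(?w k powr (p / 2))\<^sup>2 = ?w k powr p" for p by (simp add: power2_eq_square flip: powr_add)
    from this[of "- m"] this[of m] show "ennreal (?w k powr (- m / 2)) ^ 2 = ennreal (?w k powr (- m))"
    "ennreal (?w k powr (m / 2) * norm (h k)) ^ 2 = ennreal (?w k powr m * (norm (h k))\<^sup>2)"
      by (simp_all add: ennreal_power power_mult_distrib)
  qed
  have "(\<integral>\<^sup>+k. ennreal (norm (h k)) \<partial>lborel)\<^sup>2 \<le> (\<integral>\<^sup>+k. ennreal (?w k powr (- m)) \<partial>lborel) * sobolev_energy m h"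
    unfolding eq sobolev_energy_def sq[symmetric] by (rule Cauchy_Schwarz_nn_integral) measurable
  also have "\<dots> < \<infinity>"
  proof -
    have "(\<integral>\<^sup>+k. ennreal (?w k powr (- m)) \<partial>lborel) \<le> (\<integral>\<^sup>+k. ennreal (decay (k :: real^'d)) \<partial>lborel)"
      by (intro nn_integral_mono ennreal_leI one_plus_norm_powr_le_decay m)
    also have "\<dots> < \<infinity>"
      using nn_integral_eq_integral[OF integrable_decay[where 'd='d] AE_I2[OF less_imp_le[OF decay_pos]]] by simp
    finally show ?thesis using fin by (simp add: ennreal_mult_less_top)
  qed
  finally show "(\<integral>\<^sup>+k. ennreal (norm (h k)) \<partial>lborel) < \<infinity>"
    by (simp add: power_less_top_ennreal)
qed measurable

lemma integrable_mult_schwartz: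
  fixes u :: "real^'d::finite \<Rightarrow> complex"
  assumes "u \<in> borel_measurable borel" "\<And>x. norm (u x) \<le> C" "\<phi> \<in> schwartz"
  shows "integrable lborel (\<lambda>x. u x * \<phi> x)"
  using integrable_mult_bounded_right[OF schwartz_integrable[OF assms(3)], of u C] assms(1,2) by (simp add: mult.commute)

lemma integrable_L1_mult_schwartz:
  fixes u :: "real^'d::finite \<Rightarrow> complex"
  assumes "integrable lborel u" "\<phi> \<in> schwartz"
  shows "integrable lborel (\<lambda>x. u x * \<phi> x)"
proof -
  obtain C where "\<And>x. norm (\<phi> x) \<le> C" using schwartz_bounded[OF assms(2)] by blast
  then show ?thesis
    using integrable_mult_bounded_right[OF assms(1), of \<phi> C] schwartz_measurable[OF assms(2)] by simp
qed

lemma schwartz_norm_ge: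
  fixes \<phi> :: "real^'d::finite \<Rightarrow> complex"
  assumes "\<phi> \<in> schwartz"
  shows "(1 + norm x) ^ N * norm (\<phi> x) \<le> schwartz_norm N \<phi>"
proof -
  let ?q = "\<lambda>is::'d list. SUP x. (1 + norm x) ^ N * norm (partials is \<phi> x)"
  have "finite {is::'d list. set is \<subseteq> UNIV \<and> length is \<le> N}" by (rule finite_lists_length_le) simp
  then have "bdd_above (?q ` {is. length is \<le> N})" by simp
  then have 1: "?q [] \<le> schwartz_norm N \<phi>"
    unfolding schwartz_norm_def by (intro cSUP_upper) auto
  obtain C where C: "\<And>x. (1 + norm x) ^ N * norm (\<phi> x) \<le> C"
    using schwartz_rapid[OF assms] unfolding rapid_def by metis
  have "bdd_above (range (\<lambda>x. (1 + norm x) ^ N * norm (\<phi> x)))" by (rule bdd_aboveI2[OF C])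
  then have "(1 + norm x) ^ N * norm (\<phi> x) \<le> ?q []"
    by (auto intro: cSUP_upper)
  with 1 show ?thesis by simp
qed

lemma bounded_fun_tempered:
  fixes u :: "real^'d::finite \<Rightarrow> complex"
  assumes u: "u \<in> borel_measurable borel" and bdd: "\<And>x. norm (u x) \<le> C"
    and T: "\<And>\<phi>. \<phi> \<in> schwartz \<Longrightarrow> T \<phi> = (LBINT x. u x * \<phi> x)"
  shows "T \<in> tempered"
proof -
  note i = integrable_mult_schwartz[OF u bdd]
  have C0: "C \<ge> 0" using bdd[of 0] norm_ge_zero[of "u 0"] by (rule order.trans[rotated])
  have "T (\<lambda>x. \<phi> x + \<psi> x) = T \<phi> + T \<psi>" if "\<phi> \<in> schwartz" "\<psi> \<in> schwartz" for \<phi> \<psi>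
    using that i by (simp add: T schwartz_add distrib_left)
  moreover have "T (\<lambda>x. c * \<phi> x) = c * T \<phi>" if "\<phi> \<in> schwartz" for \<phi> c
    using that by (simp add: T schwartz_cmult mult.left_commute[of _ c])
  moreover have "norm (T \<phi>) \<le> (C * (LBINT x. decay (x::real^'d))) * schwartz_norm (2 * CARD('d)) \<phi>" if \<phi>: "\<phi> \<in> schwartz" for \<phi>
  proof -
    let ?S = "schwartz_norm (2 * CARD('d)) \<phi>"
    have "norm (T \<phi>) \<le> (LBINT x. C * (?S * decay (x::real^'d)))"
      unfolding T[OF \<phi>]
    proof (rule Bochner_Integration.integral_norm_bound_integral)
      show "integrable lborel (\<lambda>x. u x * \<phi> x)" by (rule i[OF \<phi>])
      show "integrable lborel (\<lambda>x::real^'d. C * (?S * decay x))"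
        by (intro integrable_mult_right integrable_decay)
      show "norm (u x * \<phi> x) \<le> C * (?S * decay x)" for x
        unfolding norm_mult by (intro mult_mono bdd norm_le_decay schwartz_norm_ge \<phi> C0) auto
    qed
    also have "\<dots> = (C * (LBINT x. decay (x::real^'d))) * ?S" by simp
    finally show ?thesis .
  qed
  ultimately show ?thesis unfolding tempered_def by blast
qed

text \<open>
  The next two lemmas relate a distribution to its transform \<open>h\<close> in both directions. They follow
  from the multiplication formula and from inversion on the space of Schwartz functions.
\<close>

lemma fourier_dist_of_inverse_fourier:
  fixes h :: "real^'d::finite \<Rightarrow> complex"
  assumes h: "integrable lborel h"
    and T: "\<And>\<phi>. \<phi> \<in> schwartz \<Longrightarrow> T \<phi> = (LBINT x. fourier h (- x) * \<phi> x)"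
  shows "is_fun_of h (fourier_dist T)"
  unfolding is_fun_of_def
proof (intro conjI ballI)
  have [measurable]: "h \<in> borel_measurable borel" using h by auto
  then show "h \<in> borel_measurable lborel" by simp
  fix \<phi> :: "real^'d \<Rightarrow> complex" assume \<phi>: "\<phi> \<in> schwartz"
  have [measurable]: "\<phi> \<in> borel_measurable borel" using \<phi> by measurable
  show "integrable lborel (\<lambda>x. h x * \<phi> x)" by (rule integrable_L1_mult_schwartz[OF h \<phi>])
  let ?r = "\<lambda>x. \<phi> (- x)"
  have r: "?r \<in> schwartz" by (rule schwartz_uminus[OF \<phi>])
  have "fourier_dist T \<phi> = (LBINT x. fourier h (- x) * fourier \<phi> x)"
    unfolding fourier_dist_def by (rule T[OF schwartz_fourier[OF \<phi>]])
  also have "\<dots> = (LBINT x. fourier h x * fourier \<phi> (- x))"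
    using integral_vec_uminus[of "\<lambda>x. fourier h x * fourier \<phi> (- x)"] by simp
  also have "\<dots> = (LBINT x. fourier h x * fourier ?r x)"
    by (simp add: fourier_minus_arg)
  also have "\<dots> = (LBINT x. h x * fourier (fourier ?r) x)"
    by (intro fourier_multiplication_formula h schwartz_integrable schwartz_fourier r)
  also have "\<dots> = dist_of_fun h \<phi>"
    by (simp add: dist_of_fun_def fourier_inversion_schwartz[OF r])
  finally show "fourier_dist T \<phi> = dist_of_fun h \<phi>" .
qed

lemma inverse_fourier_represents:
  fixes h :: "real^'d::finite \<Rightarrow> complex"
  assumes h: "integrable lborel h" and T: "is_fun_of h (fourier_dist T)"
  shows "is_fun_of (\<lambda>x. fourier h (- x)) T"
  unfolding is_fun_of_def
proof (intro conjI ballI)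
  have [measurable]: "h \<in> borel_measurable borel" using h by auto
  show m: "(\<lambda>x. fourier h (- x)) \<in> borel_measurable lborel" by measurable
  fix \<phi> :: "real^'d \<Rightarrow> complex" assume \<phi>: "\<phi> \<in> schwartz"
  have [measurable]: "\<phi> \<in> borel_measurable borel" using \<phi> by measurable
  obtain C where "\<And>x. norm (fourier h x) \<le> C" using norm_fourier_le by blast
  then show "integrable lborel (\<lambda>x. fourier h (- x) * \<phi> x)"
    using m by (intro integrable_mult_schwartz[OF _ _ \<phi>]) auto
  let ?r = "\<lambda>x. \<phi> (- x)"
  have r: "?r \<in> schwartz" by (rule schwartz_uminus[OF \<phi>])
  have "T \<phi> = fourier_dist T (\<lambda>x. fourier \<phi> (- x))"
    unfolding fourier_dist_def by (simp add: schwartz_fourier_surj(2)[OF \<phi>])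
  also have "\<dots> = (LBINT x. h x * fourier \<phi> (- x))"
    using T schwartz_fourier_surj(1)[OF \<phi>] by (simp add: is_fun_of_def dist_of_fun_def)
  also have "\<dots> = (LBINT x. h x * fourier ?r x)"
    by (simp add: fourier_minus_arg)
  also have "\<dots> = (LBINT x. fourier h x * ?r x)"
    by (rule fourier_multiplication_formula[OF h schwartz_integrable[OF r], symmetric])
  also have "\<dots> = dist_of_fun (\<lambda>x. fourier h (- x)) \<phi>"
    using integral_vec_uminus[of "\<lambda>x. fourier h x * ?r x"] by (simp add: dist_of_fun_def)
  finally show "T \<phi> = dist_of_fun (\<lambda>x. fourier h (- x)) \<phi>" .
qed

lemma dist_times_eq:
  fixes f g :: "real^'d::finite \<Rightarrow> complex"
  assumes f: "is_fun_of f F" and g: "is_fun_of g G" and \<phi>: "\<phi> \<in> schwartz"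
  shows "dist_times F G \<phi> = (LBINT x. (f x * g x) * \<phi> x)"
proof -
  note uf = fun_of_dist_AE_eq[OF f] and ug = fun_of_dist_AE_eq[OF g]
  have [measurable]: "f \<in> borel_measurable borel" "g \<in> borel_measurable borel" "\<phi> \<in> borel_measurable borel"
    "fun_of_dist F \<in> borel_measurable borel" "fun_of_dist G \<in> borel_measurable borel"
    using f g uf(1) ug(1) schwartz_measurable[OF \<phi>] by (auto simp: is_fun_of_def)
  have "AE x in lborel. fun_of_dist F x * fun_of_dist G x * \<phi> x = f x * g x * \<phi> x"
    using uf(2) ug(2) by eventually_elim simp
  then show ?thesis
    unfolding dist_times_def dist_of_fun_def by (intro integral_cong_AE) auto
qed

lemma conv_integrable:
  fixes f g :: "real^'d::finite \<Rightarrow> complex"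
  assumes f: "integrable lborel f" and g: "integrable lborel g"
  shows "integrable lborel (conv f g)"
  using lborel_pair.integrable_snd[OF conv_integrable_pair[OF f g]] by (simp add: conv_def[abs_def])

lemma fourier_conv:
  fixes f g :: "real^'d::finite \<Rightarrow> complex"
  assumes f: "integrable lborel f" and g: "integrable lborel g"
  shows "fourier_factor TYPE('d) * fourier (conv f g) x = fourier f x * fourier g x"
proof -
  have [measurable]: "f \<in> borel_measurable borel" "g \<in> borel_measurable borel" using f g by auto
  have i: "integrable (lborel \<Otimes>\<^sub>M lborel) (\<lambda>(y, k). (wave x (k - y) * f (k - y)) * (wave x y * g y))"
    by (rule conv_integrable_pair[OF integrable_wave_mult[OF f] integrable_wave_mult[OF g]])
  have "(LBINT k. wave x k * conv f g k) = (LBINT k. LBINT y. (wave x (k - y) * f (k - y)) * (wave x y * g y))"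
  proof (intro Bochner_Integration.integral_cong refl)
    fix k
    have "wave x k = wave x (k - y) * wave x y" for y by (simp flip: wave_add_right)
    then have "(LBINT y. (wave x (k - y) * f (k - y)) * (wave x y * g y)) = (LBINT y. wave x k * (f (k - y) * g y))"
      by (intro Bochner_Integration.integral_cong refl) (metis (no_types, opaque_lifting) mult.assoc mult.left_commute)
    then show "wave x k * conv f g k = (LBINT y. (wave x (k - y) * f (k - y)) * (wave x y * g y))"
      by (simp add: conv_def)
  qed
  also have "\<dots> = (LBINT y. LBINT k. (wave x (k - y) * f (k - y)) * (wave x y * g y))"
    by (rule lborel_pair.Fubini_integral[OF i])
  also have "\<dots> = (LBINT y. (LBINT k. wave x k * f k) * (wave x y * g y))"
  proof (intro Bochner_Integration.integral_cong refl)
    fix y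
    have "(LBINT k. wave x (k - y) * f (k - y)) = (LBINT k. wave x k * f k)"
      using integral_vec_translate[of "\<lambda>k. wave x k * f k" "- y"] by simp
    then show "(LBINT k. (wave x (k - y) * f (k - y)) * (wave x y * g y)) = (LBINT k. wave x k * f k) * (wave x y * g y)"
      by simp
  qed
  also have "\<dots> = (LBINT k. wave x k * f k) * (LBINT y. wave x y * g y)" by simp
  finally show ?thesis by (simp add: fourier_wave)
qed

text \<open>
  Cauchy-Schwarz, after dividing and multiplying the integrand by the square roots of the two weights.
\<close>

lemma norm_conv_square_le:
  fixes f g :: "real^'d::finite \<Rightarrow> complex"
  assumes [measurable]: "f \<in> borel_measurable borel" "g \<in> borel_measurable borel"
  shows "ennreal ((norm (conv f g k))\<^sup>2) \<le> conv_kernel m n k *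
    (\<integral>\<^sup>+y. ennreal ((1 + (norm (k - y))\<^sup>2) powr m * (norm (f (k - y)))\<^sup>2) * ennreal ((1 + (norm y)\<^sup>2) powr n * (norm (g y))\<^sup>2) \<partial>lborel)"
proof -
  let ?w = "\<lambda>k::real^'d. 1 + (norm k)\<^sup>2"
  have pos: "?w y > 0" for y by (simp add: add_pos_nonneg)
  define a where "a y = ?w (k - y) powr (- m / 2) * ?w y powr (- n / 2)" for y
  define b where "b y = (?w (k - y) powr (m / 2) * norm (f (k - y))) * (?w y powr (n / 2) * norm (g y))" for y
  have [measurable]: "a \<in> borel_measurable borel" "b \<in> borel_measurable borel"
    unfolding a_def[abs_def] b_def[abs_def] by measurable
  have half: "(?w y powr (p / 2))\<^sup>2 = ?w y powr p" for p y by (simp add: power2_eq_square flip: powr_add)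
  have inv: "?w y powr (- p / 2) * ?w y powr (p / 2) = 1" for p y using pos[of y] by (simp flip: powr_add)
  have ab: "a y * b y = norm (f (k - y) * g y)" for y
  proof -
    have "a y * b y = (?w (k - y) powr (- m / 2) * ?w (k - y) powr (m / 2)) * (?w y powr (- n / 2) * ?w y powr (n / 2)) * (norm (f (k - y)) * norm (g y))"
      by (simp only: a_def b_def mult_ac)
    then show ?thesis by (simp only: inv norm_mult mult_1)
  qed
  have ab0: "a y \<ge> 0" "b y \<ge> 0" for y by (auto simp: a_def b_def)
  have a2: "ennreal (a y) ^ 2 = ennreal (?w (k - y) powr (- m) * ?w y powr (- n))" for y
    using half[of "k - y" "- m"] half[of y "- n"] ab0(1)[of y] by (simp add: ennreal_power a_def power_mult_distrib)
  have b2: "ennreal (b y) ^ 2 = ennreal (?w (k - y) powr m * (norm (f (k - y)))\<^sup>2) * ennreal (?w y powr n * (norm (g y))\<^sup>2)" for y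
    using half[of "k - y" m] half[of y n] ab0(2)[of y] by (simp add: ennreal_power b_def power_mult_distrib ennreal_mult)
  have "ennreal (norm (conv f g k)) \<le> (\<integral>\<^sup>+y. ennreal (norm (f (k - y) * g y)) \<partial>lborel)"
  proof (cases "integrable lborel (\<lambda>y. f (k - y) * g y)")
    case True
    then show ?thesis unfolding conv_def by (rule integral_norm_bound_ennreal)
  qed (simp add: conv_def not_integrable_integral_eq)
  also have "\<dots> = (\<integral>\<^sup>+y. ennreal (a y) * ennreal (b y) \<partial>lborel)"
    using ab0 by (simp add: ab[symmetric] ennreal_mult)
  finally have "(ennreal (norm (conv f g k)))\<^sup>2 \<le> (\<integral>\<^sup>+y. ennreal (a y) * ennreal (b y) \<partial>lborel)\<^sup>2"
    by (rule power_mono) simp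
  also have "\<dots> \<le> (\<integral>\<^sup>+y. ennreal (a y) ^ 2 \<partial>lborel) * (\<integral>\<^sup>+y. ennreal (b y) ^ 2 \<partial>lborel)"
    by (rule Cauchy_Schwarz_nn_integral) measurable
  finally show ?thesis by (simp add: a2 b2 conv_kernel_def ennreal_power)
qed

lemma nn_integral_conv_weights:
  fixes u v :: "real^'d::finite \<Rightarrow> ennreal"
  assumes [measurable]: "u \<in> borel_measurable borel" "v \<in> borel_measurable borel"
  shows "(\<integral>\<^sup>+k. \<integral>\<^sup>+y. u (k - y) * v y \<partial>lborel \<partial>lborel) = (\<integral>\<^sup>+k. u k \<partial>lborel) * (\<integral>\<^sup>+k. v k \<partial>lborel)"
proof -
  have "(\<integral>\<^sup>+k. \<integral>\<^sup>+y. u (k - y) * v y \<partial>lborel \<partial>lborel) = (\<integral>\<^sup>+y. \<integral>\<^sup>+k. u (k - y) * v y \<partial>lborel \<partial>lborel)"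
    by (rule lborel_pair.Fubini') measurable
  also have "\<dots> = (\<integral>\<^sup>+y. (\<integral>\<^sup>+k. u k \<partial>lborel) * v y \<partial>lborel)"
  proof (rule nn_integral_cong)
    fix y
    have "(\<integral>\<^sup>+k. u k \<partial>lborel) = (\<integral>\<^sup>+k. u (k - y) \<partial>lborel)"
      using nn_integral_vec_affine[of u 1 "- y"] by simp
    then show "(\<integral>\<^sup>+k. u (k - y) * v y \<partial>lborel) = (\<integral>\<^sup>+k. u k \<partial>lborel) * v y"
      by (simp add: nn_integral_multc)
  qed
  also have "\<dots> = (\<integral>\<^sup>+k. u k \<partial>lborel) * (\<integral>\<^sup>+k. v k \<partial>lborel)" by (rule nn_integral_cmult) measurable
  finally show ?thesis .
qed

lemma sobolev_energy_conv_le: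
  fixes f g :: "real^'d::finite \<Rightarrow> complex"
  assumes f: "integrable lborel f" and g: "integrable lborel g"
    and K: "\<And>k::real^'d. ennreal ((2 * pi) powr (- real CARD('d)) * (1 + (norm k)\<^sup>2) powr l) * conv_kernel m n k \<le> K"
  shows "sobolev_energy l (\<lambda>k. complex_of_real (fourier_factor TYPE('d)) * conv f g k) \<le> K * (sobolev_energy m f * sobolev_energy n g)"
proof -
  have [measurable]: "f \<in> borel_measurable borel" "g \<in> borel_measurable borel" using f g by auto
  define I where "I k = (\<integral>\<^sup>+y. ennreal ((1 + (norm (k - y))\<^sup>2) powr m * (norm (f (k - y)))\<^sup>2) * ennreal ((1 + (norm y)\<^sup>2) powr n * (norm (g y))\<^sup>2) \<partial>lborel)" for k :: "real^'d"
  have [measurable]: "I \<in> borel_measurable borel"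
  proof -
    have "I \<in> borel_measurable lborel" unfolding I_def[abs_def]
      by (rule lborel.borel_measurable_nn_integral) measurable
    then show ?thesis by simp
  qed
  have fac: "(fourier_factor TYPE('d))\<^sup>2 = (2 * pi) powr (- real CARD('d))"
    by (simp add: power2_eq_square flip: powr_add)
  have "sobolev_energy l (\<lambda>k. complex_of_real (fourier_factor TYPE('d)) * conv f g k) \<le> (\<integral>\<^sup>+k. K * I k \<partial>lborel)"
    unfolding sobolev_energy_def
  proof (rule nn_integral_mono)
    fix k :: "real^'d"
    have "ennreal ((1 + (norm k)\<^sup>2) powr l * (norm (complex_of_real (fourier_factor TYPE('d)) * conv f g k))\<^sup>2) =
      ennreal ((2 * pi) powr (- real CARD('d)) * (1 + (norm k)\<^sup>2) powr l) * ennreal ((norm (conv f g k))\<^sup>2)"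
    proof -
      have "(norm (complex_of_real (fourier_factor TYPE('d)) * conv f g k))\<^sup>2 = (2 * pi) powr (- real CARD('d)) * (norm (conv f g k))\<^sup>2"
        by (simp only: norm_mult norm_of_real power_mult_distrib power2_abs fac)
      then show ?thesis by (simp add: ennreal_mult[symmetric] mult_ac)
    qed
    also have "\<dots> \<le> ennreal ((2 * pi) powr (- real CARD('d)) * (1 + (norm k)\<^sup>2) powr l) * (conv_kernel m n k * I k)"
      unfolding I_def by (intro mult_left_mono norm_conv_square_le) auto
    also have "\<dots> = ennreal ((2 * pi) powr (- real CARD('d)) * (1 + (norm k)\<^sup>2) powr l) * conv_kernel m n k * I k"
      by (simp add: mult.assoc)
    also have "\<dots> \<le> K * I k" by (intro mult_right_mono K) auto
    finally show "ennreal ((1 + (norm k)\<^sup>2) powr l * (norm (complex_of_real (fourier_factor TYPE('d)) * conv f g k))\<^sup>2) \<le> K * I k" .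
  qed
  also have "\<dots> = K * (\<integral>\<^sup>+k. I k \<partial>lborel)" by (rule nn_integral_cmult) measurable
  also have "(\<integral>\<^sup>+k. I k \<partial>lborel) = sobolev_energy m f * sobolev_energy n g"
    unfolding I_def sobolev_energy_def by (rule nn_integral_conv_weights) measurable
  finally show ?thesis .
qed

text \<open>
  The product of two inverse transforms is the inverse transform of a multiple of the convolution,
  to which the pointwise bound applies.
\<close>

lemma sobolev_product:
  fixes F G :: "'d::finite distribution"
  assumes F: "F \<in> sobolev m" and G: "G \<in> sobolev n"
    and m: "m \<ge> real CARD('d)" and n: "n \<ge> real CARD('d)" and K0: "K \<ge> 0"
    and K: "\<And>k::real^'d. ennreal ((2 * pi) powr (- real CARD('d)) * (1 + (norm k)\<^sup>2) powr l) * conv_kernel m n k \<le> ennreal (K\<^sup>2)"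
  shows "dist_times F G \<in> sobolev l" "sobolev_norm l (dist_times F G) \<le> K * sobolev_norm m F * sobolev_norm n G"
proof -
  obtain f where f: "is_fun_of f (fourier_dist F)" "sobolev_energy m f = ennreal ((sobolev_norm m F)\<^sup>2)"
    using sobolevD[OF F] by blast
  obtain g where g: "is_fun_of g (fourier_dist G)" "sobolev_energy n g = ennreal ((sobolev_norm n G)\<^sup>2)"
    using sobolevD[OF G] by blast
  have fm: "f \<in> borel_measurable borel" and gm: "g \<in> borel_measurable borel"
    using f(1) g(1) by (simp_all add: is_fun_of_def)
  have fi: "integrable lborel f" by (rule sobolev_energy_imp_integrable[OF fm m]) (simp add: f)
  have gi: "integrable lborel g" by (rule sobolev_energy_imp_integrable[OF gm n]) (simp add: g)
  define h where "h k = complex_of_real (fourier_factor TYPE('d)) * conv f g k" for k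
  have hi: "integrable lborel h" unfolding h_def by (intro integrable_mult_right conv_integrable fi gi)
  have hf: "fourier h x = fourier f x * fourier g x" for x
    using fourier_conv[OF fi gi, of x] unfolding h_def fourier_cmult by simp
  have T: "dist_times F G \<phi> = (LBINT x. fourier h (- x) * \<phi> x)" if "\<phi> \<in> schwartz" for \<phi>
    using dist_times_eq[OF inverse_fourier_represents[OF fi f(1)] inverse_fourier_represents[OF gi g(1)] that]
    by (simp add: hf)
  obtain C where C: "\<And>x. norm (fourier h x) \<le> C" using norm_fourier_le by blast
  have hm: "h \<in> borel_measurable borel" using hi by auto
  have temp: "dist_times F G \<in> tempered"
  proof (rule bounded_fun_tempered)
    show "(\<lambda>x. fourier h (- x)) \<in> borel_measurable borel" using hm by measurable
  qed (use C T in auto)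
  have rep: "is_fun_of h (fourier_dist (dist_times F G))"
    by (rule fourier_dist_of_inverse_fourier[OF hi T])
  let ?B = "K * sobolev_norm m F * sobolev_norm n G"
  have "sobolev_energy l h \<le> ennreal (K\<^sup>2) * (ennreal ((sobolev_norm m F)\<^sup>2) * ennreal ((sobolev_norm n G)\<^sup>2))"
    unfolding h_def using sobolev_energy_conv_le[OF fi gi K] by (simp add: f g)
  also have "\<dots> = ennreal (?B\<^sup>2)"
    by (simp add: ennreal_mult[symmetric] power_mult_distrib mult_ac)
  finally have e: "sobolev_energy l h \<le> ennreal (?B\<^sup>2)" .
  then have fin: "sobolev_energy l h < \<infinity>" by (simp add: le_less_trans)
  show "dist_times F G \<in> sobolev l" by (rule sobolevI(1)[OF temp rep fin])
  have "(sobolev_norm l (dist_times F G))\<^sup>2 \<le> ?B\<^sup>2"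
    using e unfolding sobolevI(2)[OF temp rep fin, symmetric] by (simp add: ennreal_le_iff)
  then show "sobolev_norm l (dist_times F G) \<le> ?B"
    by (rule power2_le_imp_le) (intro mult_nonneg_nonneg K0 sobolev_norm_nonneg)
qed

section \<open>Asymptotics with relative error \<open>O(1/l)\<close>\<close>

text \<open>
  Since \<open>ln \<circ> Gamma\<close> is convex, its slope over \<open>[x - a, x]\<close> lies between those over the unit intervals
  to the left and to the right, which equal \<open>ln (x - a - 1)\<close> and \<open>ln x\<close>.
\<close>

lemma Gamma_ratio_bounds:
  fixes a x :: real
  assumes a: "a > 0" and x: "x > a + 1"
  shows "x powr (- a) \<le> Gamma (x - a) / Gamma x" "Gamma (x - a) / Gamma x \<le> (x - a - 1) powr (- a)"
proof -
  define f :: "real \<Rightarrow> real" where "f = ln \<circ> Gamma"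
  have f: "convex_on {0<..} f" unfolding f_def by (rule log_convex_Gamma_real)
  have slope: "(f u - f v) / (u - v) \<le> (f w - f v) / (w - v)" "(f w - f v) / (w - v) \<le> (f w - f u) / (w - u)"
    if "0 < v" "v < u" "u < w" for u v w
  proof -
    show "(f u - f v) / (u - v) \<le> (f w - f v) / (w - v)" "(f w - f v) / (w - v) \<le> (f w - f u) / (w - u)"
      using convex_on_slope_le[OF f, of v w u] that by (auto simp: divide_simps algebra_simps)
  qed
  have step: "f (z + 1) - f z = ln z" if "z > 0" for z
  proof -
    have "z \<notin> \<int>\<^sub>\<le>\<^sub>0" using that by (auto elim!: nonpos_Ints_cases)
    then have "Gamma (z + 1) = z * Gamma z" by (rule Gamma_plus1)
    then show ?thesis using that less_imp_neq[OF Gamma_real_pos[OF that]] by (simp add: f_def ln_mult)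
  qed
  have "x - a > 0" "x > 0" using a x by simp_all
  then have P: "Gamma (x - a) > 0" "Gamma x > 0" by (simp_all only: Gamma_real_pos)
  have r: "Gamma (x - a) / Gamma x = exp (- (f x - f (x - a)))"
    using P by (simp add: f_def exp_diff)
  have "(f x - f (x - a)) / a \<le> (f (x + 1) - f x) / 1"
    using slope[of "x - a" x "x + 1"] a x by simp
  then have 1: "f x - f (x - a) \<le> a * ln x" using a x step[of x] by (simp add: divide_le_eq mult.commute)
  have "(f (x - a) - f (x - a - 1)) / 1 \<le> (f x - f (x - a)) / a"
    using slope[of "x - a - 1" "x - a" x] a x by simp
  then have 2: "a * ln (x - a - 1) \<le> f x - f (x - a)" using a x step[of "x - a - 1"] by (simp add: le_divide_eq mult.commute)
  show "x powr (- a) \<le> Gamma (x - a) / Gamma x"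
    using 1 a x unfolding r by (simp add: powr_def)
  show "Gamma (x - a) / Gamma x \<le> (x - a - 1) powr (- a)"
    using 2 a x unfolding r by (simp add: powr_def)
qed

definition asymp_one :: "(real \<Rightarrow> real) \<Rightarrow> bool" where
  "asymp_one f \<longleftrightarrow> (\<lambda>l. f l - 1) \<in> O[at_top](\<lambda>l. 1 / l)"

lemma asymp_one_tendsto:
  assumes "asymp_one f" shows "(f \<longlongrightarrow> 1) at_top"
proof -
  have "(\<lambda>l. f l - 1) \<in> O[at_top](\<lambda>l. 1 / l)" using assms by (simp add: asymp_one_def)
  moreover have "(\<lambda>l::real. 1 / l) \<in> o[at_top](\<lambda>_. 1)"
    by (intro smalloI_tendsto) (auto intro!: real_tendsto_divide_at_top[where c=1] filterlim_ident)
  ultimately have "(\<lambda>l. f l - 1) \<in> o[at_top](\<lambda>_. 1)" by (rule landau_o.big_small_trans)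
  from smalloD_tendsto[OF this] have "((\<lambda>l. f l - 1) \<longlongrightarrow> 0) at_top" by simp
  then show ?thesis by (simp add: LIM_zero_iff)
qed

lemma asymp_one_mult:
  assumes "asymp_one f" "asymp_one g" shows "asymp_one (\<lambda>l. f l * g l)"
proof -
  have "(g \<longlongrightarrow> 1) at_top" using assms by (intro asymp_one_tendsto)
  then have "g \<in> O[at_top](\<lambda>_. 1)" by (intro bigoI_tendsto[where c=1]) auto 
  then have "(\<lambda>l. (f l - 1) * g l) \<in> O[at_top](\<lambda>l. 1 / l * 1)"
    using assms by (intro landau_o.big.mult) (simp_all add: asymp_one_def)
  then have "(\<lambda>l. (f l - 1) * g l) \<in> O[at_top](\<lambda>l. 1 / l)"
    by (simp only: mult_1_right)
  then have "(\<lambda>l. (f l - 1) * g l + (g l - 1)) \<in> O[at_top](\<lambda>l. 1 / l)"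
    by (rule sum_in_bigo(1)) (use assms in \<open>simp add: asymp_one_def\<close>)
  then show ?thesis by (simp add: asymp_one_def algebra_simps)
qed

text \<open>
  Near \<open>1\<close> the increment \<open>g x - 1\<close> is bounded by a multiple of \<open>x - 1\<close>.
\<close>

lemma asymp_one_differentiable:
  assumes f: "asymp_one f" and g: "(g has_real_derivative D) (at 1)" "g 1 = 1"
  shows "asymp_one (\<lambda>l. g (f l))"
proof -
  have lim: "filterlim f (nhds 1) at_top" using asymp_one_tendsto[OF f] .
  have "(\<lambda>x. g x - 1) \<in> O[nhds 1](\<lambda>x. x - 1)"
  proof -
    have "((\<lambda>x. (g x - g 1) / (x - 1)) \<longlongrightarrow> D) (at 1)"
      using g(1) by (simp add: has_field_derivative_iff)
    then have "\<forall>\<^sub>F x in at 1. \<bar>(g x - g 1) / (x - 1)\<bar> < \<bar>D\<bar> + 1"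
      by (intro order_tendstoD(2)[OF tendsto_rabs]) auto
    then have "\<forall>\<^sub>F x in at 1. norm (g x - 1) \<le> (\<bar>D\<bar> + 1) * norm (x - 1)"
      unfolding eventually_at_filter
      by eventually_elim (auto simp: g(2) abs_divide divide_less_eq)
    then have "\<forall>\<^sub>F x in nhds 1. norm (g x - 1) \<le> (\<bar>D\<bar> + 1) * norm (x - 1)"
      unfolding eventually_at_filter by eventually_elim (auto simp: g(2))
    then show ?thesis by (rule bigoI)
  qed
  from landau_o.big.compose[OF this lim]
  have "(\<lambda>l. g (f l) - 1) \<in> O[at_top](\<lambda>l. f l - 1)" .
  also have "(\<lambda>l. f l - 1) \<in> O[at_top](\<lambda>l. 1 / l)" using f by (simp add: asymp_one_def)
  finally show ?thesis by (simp add: asymp_one_def)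
qed

lemma asymp_one_powr:
  assumes "asymp_one f" shows "asymp_one (\<lambda>l. f l powr p)"
proof -
  have "((\<lambda>x. x powr p) has_real_derivative p * 1 powr (p - 1)) (at (1::real))"
    by (rule has_real_derivative_powr) simp
  from asymp_one_differentiable[OF assms this] show ?thesis by simp
qed

lemma asymp_one_sqrt:
  assumes "asymp_one f" shows "asymp_one (\<lambda>l. sqrt (f l))"
proof -
  have "(sqrt has_real_derivative inverse (sqrt 1) / 2) (at 1)"
    by (rule DERIV_real_sqrt) simp
  from asymp_one_differentiable[OF assms this] show ?thesis by simp
qed

lemma asymp_one_inverse:
  assumes "asymp_one f" shows "asymp_one (\<lambda>l. inverse (f l))"
proof -
  have "(inverse has_real_derivative - (inverse 1 ^ Suc (Suc 0))) (at (1::real))"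
    by (rule DERIV_inverse) simp
  from asymp_one_differentiable[OF assms this] show ?thesis by simp
qed

lemma asymp_one_divide:
  assumes "asymp_one f" "asymp_one g" shows "asymp_one (\<lambda>l. f l / g l)"
  using asymp_one_mult[OF assms(1) asymp_one_inverse[OF assms(2)]] by (simp only: divide_inverse)

lemma asymp_one_cong: 
  assumes "asymp_one f" "\<forall>\<^sub>F l in at_top. f l = g l" shows "asymp_one g"
proof -
  have "(\<lambda>l. f l - 1) \<in> O[at_top](\<lambda>l. 1 / l) \<longleftrightarrow> (\<lambda>l. g l - 1) \<in> O[at_top](\<lambda>l. 1 / l)"
    by (rule landau_o.big.in_cong) (use assms(2) in \<open>auto elim: eventually_mono\<close>)
  then show ?thesis using assms by (simp add: asymp_one_def)
qed

lemma asymp_one_between: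
  assumes f: "asymp_one f" and g: "asymp_one g" and b: "\<forall>\<^sub>F l in at_top. f l \<le> h l \<and> h l \<le> g l"
  shows "asymp_one h"
proof -
  have "(\<lambda>l. \<bar>f l - 1\<bar> + \<bar>g l - 1\<bar>) \<in> O[at_top](\<lambda>l. 1 / l)"
    using f g by (intro sum_in_bigo) (simp_all add: asymp_one_def)
  moreover have "(\<lambda>l. h l - 1) \<in> O[at_top](\<lambda>l. \<bar>f l - 1\<bar> + \<bar>g l - 1\<bar>)"
    by (intro bigoI[of _ 1] eventually_mono[OF b]) auto
  ultimately show ?thesis unfolding asymp_one_def by (rule landau_o.big_trans[rotated])
qed

lemma asymp_one_1: "asymp_one (\<lambda>_. 1)"
  unfolding asymp_one_def diff_self by (rule zero_in_bigo)

lemma asymp_one_minus: "asymp_one (\<lambda>l. 1 - c / l)"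
proof -
  have "(\<lambda>l. - c * (1 / l)) \<in> O[at_top](\<lambda>l::real. 1 / l)"
    by (intro bigoI[of _ "\<bar>c\<bar>"] always_eventually allI) (simp add: abs_mult)
  then show ?thesis by (simp add: asymp_one_def)
qed

lemma asymp_one_Gamma_ratio:
  assumes a: "a > 0" and c: "c > 0"
  shows "asymp_one (\<lambda>l. (c * l) powr a * (Gamma (c * l - a) / Gamma (c * l)))"
proof (rule asymp_one_between[OF asymp_one_1 asymp_one_powr[OF asymp_one_minus[of "(a + 1) / c"], of "- a"]])
  show "\<forall>\<^sub>F l in at_top. 1 \<le> (c * l) powr a * (Gamma (c * l - a) / Gamma (c * l)) \<and>
      (c * l) powr a * (Gamma (c * l - a) / Gamma (c * l)) \<le> (1 - (a + 1) / c / l) powr (- a)"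
    using eventually_gt_at_top[of "(a + 1) / c"]
  proof eventually_elim
    case (elim l)
    then have x: "c * l > a + 1" using c by (simp add: divide_less_eq mult.commute)
    then have x0: "c * l > 0" using a by linarith
    have "1 = (c * l) powr a * (c * l) powr (- a)" 
    proof -
      have "u powr a * u powr (- a) = 1" if "u > 0" for u :: real using that by (simp flip: powr_add)
      from this[OF x0] show ?thesis by simp
    qed
    also have "\<dots> \<le> (c * l) powr a * (Gamma (c * l - a) / Gamma (c * l))"
      by (intro mult_left_mono Gamma_ratio_bounds a x) auto
    finally have 1: "1 \<le> (c * l) powr a * (Gamma (c * l - a) / Gamma (c * l))" .
    have "(c * l) powr a * (Gamma (c * l - a) / Gamma (c * l)) \<le> (c * l) powr a * (c * l - a - 1) powr (- a)"
      by (intro mult_left_mono Gamma_ratio_bounds a x) auto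
    also have "\<dots> = ((c * l - a - 1) / (c * l)) powr (- a)"
    proof -
      have "u powr a * v powr (- a) = (v / u) powr (- a)" if "u > 0" "v > 0" for u v :: real
        using that by (simp add: powr_divide powr_minus field_simps)
      from this[of "c * l" "c * l - a - 1"] show ?thesis using x x0 by simp
    qed
    also have "(c * l - a - 1) / (c * l) = 1 - (a + 1) / c / l"
    proof -
      have "c \<noteq> 0" "l \<noteq> 0" using x0 by auto
      then show ?thesis by (simp add: field_simps)
    qed
    finally show ?case using 1 by simp
  qed
qed

text \<open>
  The following bounds reduce Laplace's method at the maximum \<open>q = 0\<close> to exact Gaussian integrals:
  the exponential replaces the power up to a relative error \<open>p q\<^sup>2\<close>, and \<open>q\<^sup>2\<close> is absorbed by giving
  away half of the exponential decay.
\<close>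

lemma one_plus_powr_le_exp:
  fixes p q :: real
  assumes "p \<ge> 0" "q \<ge> 0" shows "(1 + q) powr p \<le> exp (p * q)"
proof -
  have "ln (1 + q) \<le> q" using assms by (intro ln_add_one_self_le_self) 
  then show ?thesis using assms by (simp add: powr_def mult_left_mono)
qed

lemma one_plus_powr_ge:
  fixes p q :: real
  assumes "p \<ge> 0" "q \<ge> 0" shows "exp (p * q) * (1 - p * q\<^sup>2) \<le> (1 + q) powr p"
proof -
  have "q - q\<^sup>2 \<le> ln (1 + q)"
  proof (cases "q \<le> 1")
    case True then show ?thesis using assms by (intro ln_one_plus_pos_lower_bound) auto
  next
    case False
    then have "q - q\<^sup>2 \<le> 0" by (simp add: power2_eq_square)
    also have "0 \<le> ln (1 + q)" using assms by simp
    finally show ?thesis .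
  qed
  then have "p * (q - q\<^sup>2) \<le> p * ln (1 + q)" using assms by (intro mult_left_mono)
  then have "exp (p * q) * exp (- (p * q\<^sup>2)) \<le> (1 + q) powr p"
    using assms by (simp add: powr_def right_diff_distrib flip: exp_add)
  moreover have "1 - p * q\<^sup>2 \<le> exp (- (p * q\<^sup>2))" using exp_ge_add_one_self[of "- (p * q\<^sup>2)"] by simp
  then have "exp (p * q) * (1 - p * q\<^sup>2) \<le> exp (p * q) * exp (- (p * q\<^sup>2))" by (intro mult_left_mono) auto
  ultimately show ?thesis by linarith
qed

lemma square_le_exp: "q \<ge> 0 \<Longrightarrow> t > 0 \<Longrightarrow> q\<^sup>2 \<le> 2 / t\<^sup>2 * exp (t * (q::real))"
  using power_le_fact_exp[of "t * q" 2] by (simp add: power_mult_distrib field_simps numeral_2_eq_2)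

text \<open>
  Times \<open>b\<close> to the power \<open>d\<close>, this is the squared Sobolev norm of order \<open>p\<close> of \<open>gaussian (1 / b)\<close>.
\<close>

definition gauss_moment :: "'d::finite itself \<Rightarrow> real \<Rightarrow> real \<Rightarrow> real" where
  "gauss_moment _ p b = (LBINT k. (1 + (norm (k :: real^'d))\<^sup>2) powr p * exp (- b * (norm k)\<^sup>2))"

lemma gauss_moment_bounds:
  assumes p: "p \<ge> 0" and b: "p < b"
  shows "integrable lborel (\<lambda>k::real^'d::finite. (1 + (norm k)\<^sup>2) powr p * exp (- b * (norm k)\<^sup>2))"
    and "gauss_moment TYPE('d) p b \<le> (pi / (b - p)) powr (CARD('d) / 2)"
    and "(pi / (b - p)) powr (CARD('d) / 2) * (1 - 2 powr (CARD('d) / 2) * 8 * p / (b - p)\<^sup>2) \<le> gauss_moment TYPE('d) p b"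
proof -
  let ?q = "\<lambda>k::real^'d. (norm k)\<^sup>2" and ?c = "b - p"
  have c: "?c > 0" using b by simp
  have G: "integrable lborel (\<lambda>k::real^'d. exp (- s * ?q k))" "(LBINT k. exp (- s * ?q k)) = (pi / s) powr (CARD('d) / 2)"
    if "s > 0" for s
    using integral_gaussian[OF that, where 'd='d] by (simp_all add: has_bochner_integral_iff)
  have up: "(1 + ?q k) powr p * exp (- b * ?q k) \<le> exp (- ?c * ?q k)" for k
  proof -
    have "(1 + ?q k) powr p * exp (- b * ?q k) \<le> exp (p * ?q k) * exp (- b * ?q k)"
      by (intro mult_right_mono one_plus_powr_le_exp p) auto
    also have "\<dots> = exp (- ?c * ?q k)" by (simp add: exp_add[symmetric] algebra_simps)
    finally show ?thesis .
  qed
  show int: "integrable lborel (\<lambda>k. (1 + ?q k) powr p * exp (- b * ?q k))"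
    by (rule Bochner_Integration.integrable_bound[OF G(1)[OF c]]) (use up in auto)
  have "gauss_moment TYPE('d) p b \<le> (LBINT k. exp (- ?c * ?q (k :: real^'d)))"
    unfolding gauss_moment_def by (intro integral_mono int G c up)
  then show "gauss_moment TYPE('d) p b \<le> (pi / (b - p)) powr (CARD('d) / 2)"
    by (simp only: G(2)[OF c])
  have lo: "exp (- ?c * ?q k) - p * (8 / ?c\<^sup>2) * exp (- (?c / 2) * ?q k) \<le> (1 + ?q k) powr p * exp (- b * ?q k)" for k
  proof -
    \<comment> \<open>Half of the decay rate \<open>?c\<close> pays for the factor \<open>(?q k)\<^sup>2\<close>, hence the constant \<open>2 / (?c / 2)\<^sup>2\<close>.\<close>
    have "exp (- ?c * ?q k) * (?q k)\<^sup>2 \<le> exp (- ?c * ?q k) * (2 / (?c / 2)\<^sup>2 * exp (?c / 2 * ?q k))"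
      by (intro mult_left_mono square_le_exp) (use c in auto)
    also have "\<dots> = 8 / ?c\<^sup>2 * (exp (- ?c * ?q k) * exp (?c / 2 * ?q k))"
      by (simp add: power_divide)
    also have "exp (- ?c * ?q k) * exp (?c / 2 * ?q k) = exp (- (?c / 2) * ?q k)"
      by (simp add: exp_add[symmetric] field_simps)
    finally have *: "p * (exp (- ?c * ?q k) * (?q k)\<^sup>2) \<le> p * (8 / ?c\<^sup>2 * exp (- (?c / 2) * ?q k))"
      by (intro mult_left_mono p)
    have "exp (p * ?q k) * (1 - p * (?q k)\<^sup>2) * exp (- b * ?q k) \<le> (1 + ?q k) powr p * exp (- b * ?q k)"
      by (intro mult_right_mono one_plus_powr_ge p) auto
    moreover have "exp (p * ?q k) * (1 - p * (?q k)\<^sup>2) * exp (- b * ?q k) = exp (- ?c * ?q k) * (1 - p * (?q k)\<^sup>2)"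
    proof -
      have "exp (p * ?q k) * exp (- b * ?q k) = exp (- ?c * ?q k)" by (simp add: exp_add[symmetric] algebra_simps)
      moreover have "exp (p * ?q k) * (1 - p * (?q k)\<^sup>2) * exp (- b * ?q k) = exp (p * ?q k) * exp (- b * ?q k) * (1 - p * (?q k)\<^sup>2)"
        by (simp only: mult_ac)
      ultimately show ?thesis by (simp only:)
    qed
    ultimately have **: "exp (- ?c * ?q k) * (1 - p * (?q k)\<^sup>2) \<le> (1 + ?q k) powr p * exp (- b * ?q k)" by (simp only:)
    have "X - p * E * Y \<le> R" if "X * (1 - p * S) \<le> R" "p * (X * S) \<le> p * (E * Y)" for X S E Y R :: real
    proof -
      have "X - p * (X * S) \<le> R" using that(1) by (simp add: algebra_simps)
      then show ?thesis using that(2) by (simp add: mult.assoc)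
    qed
    from this[OF ** *] show ?thesis .
  qed
  have "(LBINT k. exp (- ?c * ?q (k :: real^'d)) - p * (8 / ?c\<^sup>2) * exp (- (?c / 2) * ?q k)) \<le> gauss_moment TYPE('d) p b"
    unfolding gauss_moment_def
    by (intro integral_mono int lo Bochner_Integration.integrable_diff G c integrable_mult_right) (use c in auto)
  also have "(LBINT k. exp (- ?c * ?q (k :: real^'d)) - p * (8 / ?c\<^sup>2) * exp (- (?c / 2) * ?q k)) =
     (pi / ?c) powr (CARD('d) / 2) - p * (8 / ?c\<^sup>2) * (pi / (?c / 2)) powr (CARD('d) / 2)"
  proof -
    have c2: "?c / 2 > 0" using c by simp
    show ?thesis
      by (subst Bochner_Integration.integral_diff[OF G(1)[OF c] integrable_mult_right[OF G(1)[OF c2]]])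
         (simp only: G(2)[OF c] G(2)[OF c2] integral_mult_right_zero)
  qed
  also have "(pi / (?c / 2)) powr (CARD('d) / 2) = 2 powr (CARD('d) / 2) * (pi / ?c) powr (CARD('d) / 2)"
    using c powr_mult[of 2 "pi / ?c" "CARD('d) / 2"] by (simp add: mult.commute)
  finally show "(pi / (b - p)) powr (CARD('d) / 2) * (1 - 2 powr (CARD('d) / 2) * 8 * p / (b - p)\<^sup>2) \<le> gauss_moment TYPE('d) p b"
    by (simp add: algebra_simps)
qed

text \<open>
  The error term of the lower bound is a constant times \<open>a l / ((b - a) l)\<^sup>2\<close>, which is of order \<open>1/l\<close>.
\<close>

lemma asymp_one_gauss_moment:
  assumes a: "a > 0" and b: "a < b"
  shows "asymp_one (\<lambda>l. gauss_moment TYPE('d::finite) (a * l) (b * l) * ((b - a) * l / pi) powr (CARD('d) / 2))"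
proof (rule asymp_one_between[OF asymp_one_minus[of "2 powr (CARD('d) / 2) * 8 * a / (b - a)\<^sup>2"] asymp_one_1])
  show "\<forall>\<^sub>F l in at_top. 1 - 2 powr (CARD('d) / 2) * 8 * a / (b - a)\<^sup>2 / l \<le> gauss_moment TYPE('d) (a * l) (b * l) * ((b - a) * l / pi) powr (CARD('d) / 2) \<and>
     gauss_moment TYPE('d) (a * l) (b * l) * ((b - a) * l / pi) powr (CARD('d) / 2) \<le> 1"
    using eventually_gt_at_top[of 0]
  proof eventually_elim
    case (elim l)
    define D where "D = (b - a) * l"
    have D: "D > 0" "b * l - a * l = D" using b elim by (simp_all add: D_def left_diff_distrib)
    have ab: "a * l \<ge> 0" "a * l < b * l" using a b elim by auto
    have one: "(pi / D) powr (CARD('d) / 2) * (D / pi) powr (CARD('d) / 2) = 1"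
      using D by (simp add: powr_divide)
    have e: "2 powr (CARD('d) / 2) * 8 * (a * l) / D\<^sup>2 = 2 powr (CARD('d) / 2) * 8 * a / (b - a)\<^sup>2 / l"
      using b elim by (simp add: D_def power2_eq_square)
    have "(pi / D) powr (CARD('d) / 2) * (1 - 2 powr (CARD('d) / 2) * 8 * a / (b - a)\<^sup>2 / l) * (D / pi) powr (CARD('d) / 2)
       \<le> gauss_moment TYPE('d) (a * l) (b * l) * (D / pi) powr (CARD('d) / 2)"
      using gauss_moment_bounds(3)[OF ab, where 'd='d] unfolding D(2) e by (intro mult_right_mono) auto
    moreover have "gauss_moment TYPE('d) (a * l) (b * l) * (D / pi) powr (CARD('d) / 2) \<le> (pi / D) powr (CARD('d) / 2) * (D / pi) powr (CARD('d) / 2)"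
      using gauss_moment_bounds(2)[OF ab, where 'd='d] unfolding D(2) by (intro mult_right_mono) auto
    moreover have cancel: "(pi / D) powr (CARD('d) / 2) * u * (D / pi) powr (CARD('d) / 2) = u" for u
      using one by (metis mult.assoc mult.commute mult_1)
    ultimately show ?case unfolding one cancel by (simp only: D_def simp_thms)
  qed
qed

section \<open>The sharp constant and its upper bound\<close>

lemma hyp_integrand_le:
  assumes "a \<ge> 0" "w \<le> 0"
  shows "beta_weight m n s * (1 - w * (4 * s * (1 - s))) powr (- a) \<le> beta_weight m n s"
proof (cases "0 < s \<and> s < 1")
  case True
  then have "w * (4 * s * (1 - s)) \<le> 0" using assms(2) by (intro mult_nonpos_nonneg) auto
  then have "(1 - w * (4 * s * (1 - s))) powr (- a) \<le> 1 powr (- a)"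
    using assms(1) by (intro powr_mono2') auto
  then show ?thesis using mult_left_mono[OF _ beta_weight_nonneg] by fastforce
qed (auto simp: beta_weight_def)

lemma hyp_integrand_integrable:
  assumes "a \<ge> 0" "w \<le> 0" "m > 0" "n > 0"
  shows "integrable lborel (\<lambda>s. beta_weight m n s * (1 - w * (4 * s * (1 - s))) powr (- a))"
proof (rule Bochner_Integration.integrable_bound)
  show "integrable lborel (beta_weight m n)"
    using beta_weight_integral[OF assms(3,4)] by (simp add: has_bochner_integral_iff)
  show "AE s in lborel. norm (beta_weight m n s * (1 - w * (4 * s * (1 - s))) powr (- a)) \<le> norm (beta_weight m n s)"
    using hyp_integrand_le[OF assms(1,2)] beta_weight_nonneg by (intro AE_I2) (simp add: abs_mult)
qed measurable

lemma hyp_integral_nonneg: "hyp_integral a m n w \<ge> 0"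
  unfolding hyp_integral_def by (intro integral_nonneg_AE AE_I2 mult_nonneg_nonneg beta_weight_nonneg) auto

text \<open>
  Of the exponent \<open>-a\<close>, the part \<open>-l\<close> compensates the growth of the factor in front, because
  \<open>1 + 4us(1-s) \<ge> s(1-s)(1 + 4u)\<close>; the rest is at most \<open>1\<close>. The price is that the parameters of the
  Beta weight decrease by \<open>l\<close>.
\<close>

lemma hyp_integral_growth:
  assumes l: "0 < l" "l < m" "l < n" "l \<le> a" and u: "u \<ge> 0"
  shows "(1 + 4 * u) powr l * hyp_integral a m n (- u) \<le> Beta (m - l) (n - l)"
proof -
  have le: "(1 + 4 * u) powr l * (beta_weight m n s * (1 - (- u) * (4 * s * (1 - s))) powr (- a)) \<le> beta_weight (m - l) (n - l) s" for s
  proof (cases "0 < s \<and> s < 1")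
    case True
    define p where "p = s * (1 - s)"
    have p: "0 < p" "4 * p \<le> 1" using four_s_bounds[of s] True by (simp_all add: p_def mult.assoc)
    let ?Q = "1 + 4 * u * p"
    have Q1: "?Q \<ge> 1" using p u by simp
    have "p * (1 + 4 * u) \<le> ?Q"
      using p by (simp add: distrib_left mult_ac)
    then have "?Q powr (- l) \<le> (p * (1 + 4 * u)) powr (- l)"
      using p u l by (intro powr_mono2') (auto intro!: mult_pos_pos)
    also have "\<dots> = p powr (- l) * (1 + 4 * u) powr (- l)"
      using p u by (simp add: powr_mult)
    finally have 1: "?Q powr (- l) \<le> p powr (- l) * (1 + 4 * u) powr (- l)" .
    have "?Q powr (- a) \<le> ?Q powr (- l)" using Q1 l by (intro powr_mono) auto
    with 1 have "(1 + 4 * u) powr l * ?Q powr (- a) \<le> (1 + 4 * u) powr l * (p powr (- l) * (1 + 4 * u) powr (- l))"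
      by (intro mult_left_mono) auto
    also have "\<dots> = p powr (- l)" using u by (simp add: powr_minus)
    finally have 2: "(1 + 4 * u) powr l * ?Q powr (- a) \<le> p powr (- l)" .
    have e: "s powr (m - 1) * s powr (- l) = s powr (m - l - 1)" "(1 - s) powr (n - 1) * (1 - s) powr (- l) = (1 - s) powr (n - l - 1)"
      unfolding powr_add[symmetric] by (rule arg_cong, simp)+
    have 3: "beta_weight m n s * p powr (- l) = beta_weight (m - l) (n - l) s"
    proof -
      have "beta_weight m n s * p powr (- l) = (s powr (m - 1) * s powr (- l)) * ((1 - s) powr (n - 1) * (1 - s) powr (- l))"
        using True by (simp add: beta_weight_def p_def powr_mult)
      then show ?thesis unfolding e using True by (simp add: beta_weight_def)
    qed
    have "1 - (- u) * (4 * s * (1 - s)) = ?Q" by (simp add: p_def)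
    then have "(1 + 4 * u) powr l * (beta_weight m n s * (1 - (- u) * (4 * s * (1 - s))) powr (- a)) = beta_weight m n s * ((1 + 4 * u) powr l * ?Q powr (- a))"
      by (simp only: mult_ac)
    also have "\<dots> \<le> beta_weight m n s * p powr (- l)"
      by (intro mult_left_mono 2 beta_weight_nonneg)
    finally show ?thesis unfolding 3 .
  qed (auto simp: beta_weight_def)
  have B: "integrable lborel (beta_weight (m - l) (n - l))" "integral\<^sup>L lborel (beta_weight (m - l) (n - l)) = Beta (m - l) (n - l)"
    using beta_weight_integral[of "m - l" "n - l"] l by (simp_all add: has_bochner_integral_iff)
  have "(1 + 4 * u) powr l * hyp_integral a m n (- u) = (LBINT s. (1 + 4 * u) powr l * (beta_weight m n s * (1 - (- u) * (4 * s * (1 - s))) powr (- a)))"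
    by (simp add: hyp_integral_def)
  also have "\<dots> \<le> (LBINT s. beta_weight (m - l) (n - l) s)"
    by (intro integral_mono integrable_mult_right hyp_integrand_integrable B le) (use l u in auto)
  finally show ?thesis by (simp add: B)
qed

lemma scrS_eq_integral:
  assumes m: "m > 0" and n: "n > 0" and d: "m + n > real d / 2" and u: "u \<ge> 0"
  shows "scrS l m n d u = Gamma (m + n - d / 2) / ((4 * pi) powr (d / 2) * (Gamma m * Gamma n)) * ((1 + 4 * u) powr l * hyp_integral (m + n - d / 2) m n (- u))"
proof -
  have G: "Gamma m > 0" "Gamma n > 0" "Gamma (m + n) > 0" using m n by (simp_all add: Gamma_real_pos)
  have "hyp3F2 (m + n - d / 2) m n ((m + n) / 2) ((m + n + 1) / 2) (- u) = hyp_integral (m + n - d / 2) m n (- u) / Beta m n"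
    by (rule hyp3F2_eq_integral) (use m n d u in auto)
  moreover have "x / (y * Gamma (m + n)) * z * (w / Beta m n) = x / (y * (Gamma m * Gamma n)) * (z * w)" for x y z w
    using G unfolding Beta_def by (simp add: field_simps)
  ultimately show ?thesis unfolding scrS_def by (simp only:)
qed

text \<open>
  The argument is \<open>|k|\<^sup>2 / 4\<close> because \<open>1 + 4u\<close> then equals the Sobolev weight at \<open>k\<close>.
\<close>

lemma conv_kernel_eq_scrS:
  fixes k :: "real^'d::finite"
  assumes m: "m > 0" and n: "n > 0" and d: "m + n > real CARD('d) / 2"
  shows "ennreal ((2 * pi) powr (- real CARD('d)) * (1 + (norm k)\<^sup>2) powr l) * conv_kernel m n k = ennreal (scrS l m n CARD('d) ((norm k)\<^sup>2 / 4))"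
proof -
  let ?D = "real CARD('d) / 2" and ?u = "(norm k)\<^sup>2 / 4"
  let ?a = "m + n - ?D" and ?I = "hyp_integral (m + n - ?D) m n (- ?u)"
  have G: "Gamma m > 0" "Gamma n > 0" "Gamma ?a > 0" using m n d by (simp_all add: Gamma_real_pos)
  have "1 + s * (1 - s) * (norm k)\<^sup>2 = 1 - (- ?u) * (4 * s * (1 - s))" for s by simp
  then have "(\<integral>\<^sup>+s. ennreal (beta_weight m n s * (1 + s * (1 - s) * (norm k)\<^sup>2) powr (- ?a)) \<partial>lborel)
     = (\<integral>\<^sup>+s. ennreal (beta_weight m n s * (1 - (- ?u) * (4 * s * (1 - s))) powr (- ?a)) \<partial>lborel)"
    by (simp only:)
  also have "\<dots> = ennreal ?I"
    unfolding hyp_integral_def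
    by (rule nn_integral_eq_integral[OF hyp_integrand_integrable]) (use m n d in \<open>auto intro!: AE_I2 mult_nonneg_nonneg beta_weight_nonneg\<close>)
  finally have "ennreal (Gamma m * Gamma n) * conv_kernel m n k = ennreal (pi powr ?D * Gamma ?a) * ennreal ?I"
    using conv_kernel_eq[OF m n d, of k] by simp
  then have J: "ennreal (Gamma m * Gamma n) * conv_kernel m n k = ennreal (pi powr ?D * Gamma ?a * ?I)"
    using G by (simp add: ennreal_mult' hyp_integral_nonneg)
  have "conv_kernel m n k = ennreal (inverse (Gamma m * Gamma n)) * (ennreal (Gamma m * Gamma n) * conv_kernel m n k)"
  proof -
    have "inverse (Gamma m * Gamma n) * (Gamma m * Gamma n) = 1"
      by (rule left_inverse) (use less_imp_neq[OF G(1)] less_imp_neq[OF G(2)] in simp)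
    then have "ennreal (inverse (Gamma m * Gamma n)) * ennreal (Gamma m * Gamma n) = 1"
      using G by (subst ennreal_mult'[symmetric]) auto
    then show ?thesis by (simp only: mult.assoc[symmetric] mult_1)
  qed
  also have "\<dots> = ennreal (inverse (Gamma m * Gamma n) * (pi powr ?D * Gamma ?a * ?I))"
    unfolding J using G by (simp add: ennreal_mult')
  finally have "ennreal ((2 * pi) powr (- real CARD('d)) * (1 + (norm k)\<^sup>2) powr l) * conv_kernel m n k =
    ennreal ((2 * pi) powr (- real CARD('d)) * (1 + (norm k)\<^sup>2) powr l * (inverse (Gamma m * Gamma n) * (pi powr ?D * Gamma ?a * ?I)))"
    by (simp only: ennreal_mult'[symmetric] mult_nonneg_nonneg powr_ge_zero)
  also have "(2 * pi) powr (- real CARD('d)) * (1 + (norm k)\<^sup>2) powr l * (inverse (Gamma m * Gamma n) * (pi powr ?D * Gamma ?a * ?I)) = scrS l m n CARD('d) ?u"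
  proof -
    have c: "(2 * pi) powr (- real CARD('d)) * pi powr ?D = 1 / (4 * pi) powr ?D"
    proof -
      have "(2 * pi) powr real CARD('d) = ((2 * pi)\<^sup>2) powr ?D"
      proof -
        have "(2 * pi) powr 2 = (2 * pi)\<^sup>2" by (rule powr_numeral) simp
        then show ?thesis by (simp only: powr_powr flip: \<open>(2 * pi) powr 2 = (2 * pi)\<^sup>2\<close>) simp
      qed
      also have "(2 * pi)\<^sup>2 = (4 * pi) * pi" by (simp add: power2_eq_square)
      also have "((4 * pi) * pi) powr ?D = (4 * pi) powr ?D * pi powr ?D" by (rule powr_mult)
      finally show ?thesis by (simp add: powr_minus field_simps)
    qed
    have "(2 * pi) powr (- real CARD('d)) * (1 + (norm k)\<^sup>2) powr l * (inverse (Gamma m * Gamma n) * (pi powr ?D * Gamma ?a * ?I)) =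
      ((2 * pi) powr (- real CARD('d)) * pi powr ?D) * Gamma ?a * inverse (Gamma m * Gamma n) * ((1 + (norm k)\<^sup>2) powr l * ?I)"
      by (simp only: mult_ac)
    also have "\<dots> = scrS l m n CARD('d) ?u"
    proof -
      have "?u \<ge> 0" "1 + 4 * ?u = 1 + (norm k)\<^sup>2" by simp_all
      then show ?thesis
        unfolding c scrS_eq_integral[OF m n d \<open>?u \<ge> 0\<close>]
        by (simp only: divide_inverse inverse_mult_distrib mult_1_left mult_ac)
    qed
    finally show ?thesis .
  qed
  finally show ?thesis .
qed

lemma scrS_nonneg:
  assumes "m > 0" "n > 0" "m + n > real d / 2" "u \<ge> 0"
  shows "scrS l m n d u \<ge> 0"
  unfolding scrS_eq_integral[OF assms] using assms
  by (intro mult_nonneg_nonneg divide_nonneg_nonneg hyp_integral_nonneg less_imp_le[OF Gamma_real_pos]) auto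

lemma scrS_bdd_above:
  assumes l: "0 < l" "l < m" "l < n" "l \<le> m + n - real d / 2"
  shows "bdd_above (scrS l m n d ` {0..})"
proof (rule bdd_aboveI2)
  fix u :: real assume "u \<in> {0..}"
  then have u: "u \<ge> 0" by simp
  have mn: "m > 0" "n > 0" "m + n > real d / 2" using l by auto
  show "scrS l m n d u \<le> Gamma (m + n - d / 2) / ((4 * pi) powr (d / 2) * (Gamma m * Gamma n)) * Beta (m - l) (n - l)"
    unfolding scrS_eq_integral[OF mn u] using mn
    by (intro mult_left_mono hyp_integral_growth l u divide_nonneg_nonneg mult_nonneg_nonneg less_imp_le[OF Gamma_real_pos]) auto
qed

text \<open>
  The constants of which \<open>sharp_const\<close> is the least one.
\<close>

definition product_bound :: "'d::finite itself \<Rightarrow> real \<Rightarrow> real \<Rightarrow> real \<Rightarrow> real \<Rightarrow> bool" where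
  "product_bound _ l m n K \<longleftrightarrow> 0 \<le> K \<and>
     (\<forall>F \<in> (sobolev m :: 'd distribution set). \<forall>G \<in> sobolev n.
        dist_times F G \<in> sobolev l \<and>
        sobolev_norm l (dist_times F G) \<le> K * sobolev_norm m F * sobolev_norm n G)"

lemma upper_KS_product_bound:
  assumes l: "0 < l" "l < m" "l < n" "l \<le> m + n - real CARD('d::finite) / 2"
    and d: "m \<ge> real CARD('d)" "n \<ge> real CARD('d)"
  shows "product_bound TYPE('d) l m n (upper_KS l m n CARD('d))"
proof -
  have mn: "m > 0" "n > 0" "m + n > real CARD('d) / 2" using l by auto
  let ?S = "SUP u\<in>{0..}. scrS l m n CARD('d) u"
  have le: "scrS l m n CARD('d) u \<le> ?S" if "u \<ge> 0" for u
    using that by (intro cSUP_upper scrS_bdd_above l) auto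
  have "0 \<le> scrS l m n CARD('d) 0" by (intro scrS_nonneg mn) simp
  also have "\<dots> \<le> ?S" by (rule le) simp
  finally have S0: "?S \<ge> 0" .
  then have K: "upper_KS l m n CARD('d) \<ge> 0" "(upper_KS l m n CARD('d))\<^sup>2 = ?S" by (simp_all add: upper_KS_def)
  have "ennreal ((2 * pi) powr (- real CARD('d)) * (1 + (norm k)\<^sup>2) powr l) * conv_kernel m n k \<le> ennreal ((upper_KS l m n CARD('d))\<^sup>2)" for k :: "real^'d"
    unfolding conv_kernel_eq_scrS[OF mn] K(2) by (intro ennreal_leI le) simp
  then show ?thesis
    unfolding product_bound_def using K(1) sobolev_product[OF _ _ d K(1)] by blast
qed

text \<open>
  All conditions on \<open>K\<close> are weak inequalities, so they pass to the infimum of the admissible constants.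
\<close>

lemma sharp_const_least:
  assumes "product_bound TYPE('d::finite) l m n K0"
  shows "product_bound TYPE('d) l m n (sharp_const TYPE('d) l m n)"
    and "\<And>K. product_bound TYPE('d) l m n K \<Longrightarrow> sharp_const TYPE('d) l m n \<le> K"
proof -
  let ?P = "product_bound TYPE('d) l m n"
  define I where "I = Inf {K. ?P K}"
  have bdd: "bdd_below {K. ?P K}" by (rule bdd_belowI[of _ 0]) (auto simp: product_bound_def)
  have ne: "{K. ?P K} \<noteq> {}" using assms by auto
  have le: "I \<le> K" if "?P K" for K unfolding I_def using that bdd by (intro cInf_lower) auto
  have "?P I"
    unfolding product_bound_def
  proof (intro conjI ballI)
    show "0 \<le> I" unfolding I_def using ne by (intro cInf_greatest) (auto simp: product_bound_def)
    fix F G :: "'d distribution" assume F: "F \<in> sobolev m" and G: "G \<in> sobolev n"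
    show "dist_times F G \<in> sobolev l" using assms F G by (auto simp: product_bound_def)
    let ?y = "sobolev_norm m F * sobolev_norm n G" and ?x = "sobolev_norm l (dist_times F G)"
    have xy: "?x \<le> K * ?y" if "?P K" for K using that F G by (auto simp: product_bound_def mult.assoc)
    have y0: "?y \<ge> 0" by (intro mult_nonneg_nonneg sobolev_norm_nonneg)
    have "?x \<le> I * ?y"
    proof (cases "?y = 0")
      case True
      show ?thesis using xy[OF assms] unfolding True by simp
    next
      case False
      have y: "?y > 0" by (rule le_neq_trans[OF y0 not_sym[OF False]])
      have "?x / ?y \<le> I" unfolding I_def using ne xy y by (intro cInf_greatest) (auto simp: divide_le_eq)
      then show ?thesis using y by (simp add: divide_le_eq)
    qed
    then show "?x \<le> I * sobolev_norm m F * sobolev_norm n G" by (simp add: mult.assoc)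
  qed
  moreover have "sharp_const TYPE('d) l m n = (LEAST K. ?P K)"
    unfolding sharp_const_def product_bound_def ..
  ultimately have "sharp_const TYPE('d) l m n = I" using le by (simp add: Least_equality)
  then show "?P (sharp_const TYPE('d) l m n)" "\<And>K. ?P K \<Longrightarrow> sharp_const TYPE('d) l m n \<le> K"
    using \<open>?P I\<close> le by auto
qed

section \<open>Gaussian trial functions\<close>

lemma gaussian_represents: 
  assumes "\<sigma> > 0" shows "is_fun_of (gaussian \<sigma>) (dist_of_fun (gaussian \<sigma> :: real^'d::finite \<Rightarrow> complex))"
  unfolding is_fun_of_def
  using assms by (auto intro!: integrable_L1_mult_schwartz gaussian_integrable)

text \<open>
  Only the action on Schwartz functions enters, so that the lemma covers both the distribution of a
  Gaussian and the product of two such distributions, which agrees with one on Schwartz functions.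
\<close>

lemma sobolev_norm_gaussian:
  fixes T :: "'d::finite distribution"
  assumes \<sigma>: "\<sigma> > 0" and l: "0 \<le> l" "l < 1 / \<sigma>"
    and T: "\<And>\<phi>. \<phi> \<in> schwartz \<Longrightarrow> T \<phi> = (LBINT x. gaussian \<sigma> x * \<phi> x)"
  shows "T \<in> sobolev l" and "sobolev_norm l T = sqrt (\<sigma> powr (- real CARD('d)) * gauss_moment TYPE('d) l (1 / \<sigma>))"
proof -
  let ?h = "fourier (gaussian \<sigma>) :: real^'d \<Rightarrow> complex"
  have he: "?h = (\<lambda>k. complex_of_real (\<sigma> powr (- real CARD('d) / 2)) * gaussian (1 / \<sigma>) k)"
    using fourier_gaussian[OF \<sigma>] by (intro ext)
  have temp: "T \<in> tempered"
    by (rule bounded_fun_tempered[of "gaussian \<sigma>" 1, OF _ _ T]) (use \<sigma> in \<open>auto intro!: norm_gaussian_le\<close>)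
  have hi: "integrable lborel ?h"
    unfolding he using \<sigma> by (intro integrable_mult_right gaussian_integrable) simp
  have g: "integrable lborel (gaussian \<sigma> :: real^'d \<Rightarrow> complex)" using \<sigma> by (rule gaussian_integrable)
  have rep: "is_fun_of ?h (fourier_dist T)"
  proof (rule fourier_dist_of_inverse_fourier[OF hi])
    fix \<phi> :: "real^'d \<Rightarrow> complex" assume \<phi>: "\<phi> \<in> schwartz"
    have "continuous_on UNIV (gaussian \<sigma> :: real^'d \<Rightarrow> complex)"
      unfolding gaussian_def by (intro continuous_intros) auto
    then have "fourier ?h (- x) = gaussian \<sigma> x" for x
      using fourier_inversion[OF g _ norm_gaussian_le hi, of "- x"] \<sigma> by simp
    then show "T \<phi> = (LBINT x. fourier ?h (- x) * \<phi> x)" by (simp add: T[OF \<phi>])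
  qed
  have sq: "(norm (?h k))\<^sup>2 = \<sigma> powr (- real CARD('d)) * exp (- (1 / \<sigma>) * (norm k)\<^sup>2)" for k
  proof -
    have "(\<sigma> powr (- real CARD('d) / 2))\<^sup>2 = \<sigma> powr (- real CARD('d))"
      by (simp add: power2_eq_square flip: powr_add)
    moreover have "(exp (- (1 / \<sigma> * (norm k)\<^sup>2 / 2)))\<^sup>2 = exp (- (1 / \<sigma>) * (norm k)\<^sup>2)"
      by (simp add: power2_eq_square flip: exp_add)
    ultimately show ?thesis unfolding he gaussian_def by (simp only: norm_mult norm_of_real power_mult_distrib power2_abs)
  qed
  have gm: "integrable lborel (\<lambda>k::real^'d. (1 + (norm k)\<^sup>2) powr l * exp (- (1 / \<sigma>) * (norm k)\<^sup>2))"
    by (rule gauss_moment_bounds(1)[OF l])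
  have "sobolev_energy l ?h = (\<integral>\<^sup>+k. ennreal (\<sigma> powr (- real CARD('d)) * ((1 + (norm (k::real^'d))\<^sup>2) powr l * exp (- (1 / \<sigma>) * (norm k)\<^sup>2))) \<partial>lborel)"
    unfolding sobolev_energy_def sq by (simp only: mult.left_commute)
  also have "\<dots> = ennreal (\<sigma> powr (- real CARD('d)) * gauss_moment TYPE('d) l (1 / \<sigma>))"
    unfolding gauss_moment_def
    by (subst nn_integral_eq_integral[OF integrable_mult_right[OF gm]]) auto
  finally have e: "sobolev_energy l ?h = ennreal (\<sigma> powr (- real CARD('d)) * gauss_moment TYPE('d) l (1 / \<sigma>))" .
  then have fin: "sobolev_energy l ?h < \<infinity>" by simp
  show "T \<in> sobolev l" by (rule sobolevI(1)[OF temp rep fin])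
  have "gauss_moment TYPE('d) l (1 / \<sigma>) \<ge> 0" unfolding gauss_moment_def by (intro integral_nonneg_AE AE_I2) auto
  then have "(sobolev_norm l T)\<^sup>2 = \<sigma> powr (- real CARD('d)) * gauss_moment TYPE('d) l (1 / \<sigma>)"
    using sobolevI(2)[OF temp rep fin] unfolding e by (subst (asm) ennreal_inj) auto
  then show "sobolev_norm l T = sqrt (\<sigma> powr (- real CARD('d)) * gauss_moment TYPE('d) l (1 / \<sigma>))"
    using sobolev_norm_nonneg[of l T] by (metis real_sqrt_unique)
qed

lemma gaussian_mult: "gaussian \<sigma> x * gaussian \<tau> x = gaussian (\<sigma> + \<tau>) x"
  by (simp add: gaussian_def distrib_right add_divide_distrib flip: exp_add of_real_mult)

lemma lower_KF_le_sharp_const: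
  assumes K0: "product_bound TYPE('d::finite) l m n K0"
    and \<sigma>: "\<sigma> > 0" and \<tau>: "\<tau> > 0" and l: "0 \<le> l" "l < 1 / (\<sigma> + \<tau>)" and m: "0 \<le> m" "m < 1 / \<sigma>" and n: "0 \<le> n" "n < 1 / \<tau>"
  shows "lower_KF TYPE('d) l m n \<sigma> \<tau> \<le> sharp_const TYPE('d) l m n"
proof -
  let ?g = "\<lambda>s. dist_of_fun (gaussian s :: real^'d \<Rightarrow> complex)"
  let ?K = "sharp_const TYPE('d) l m n"
  have d: "?g s \<phi> = (LBINT x. gaussian s x * \<phi> x)" for s \<phi> by (simp add: dist_of_fun_def)
  have F: "?g \<sigma> \<in> sobolev m" and G: "?g \<tau> \<in> sobolev n"
    using sobolev_norm_gaussian(1)[OF \<sigma> m d] sobolev_norm_gaussian(1)[OF \<tau> n d] by auto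
  have st: "\<sigma> + \<tau> > 0" using \<sigma> \<tau> by simp
  have P: "dist_times (?g \<sigma>) (?g \<tau>) \<phi> = (LBINT x. gaussian (\<sigma> + \<tau>) x * \<phi> x)" if "\<phi> \<in> schwartz" for \<phi>
    using dist_times_eq[OF gaussian_represents[OF \<sigma>] gaussian_represents[OF \<tau>] that] by (simp add: gaussian_mult)
  have eq: "sobolev_norm l (dist_times (?g \<sigma>) (?g \<tau>)) = sobolev_norm l (?g (\<sigma> + \<tau>))"
    using sobolev_norm_gaussian(2)[OF st l P] sobolev_norm_gaussian(2)[OF st l d] by simp
  have B: "product_bound TYPE('d) l m n ?K" by (rule sharp_const_least(1)[OF K0])
  then have "sobolev_norm l (?g (\<sigma> + \<tau>)) \<le> ?K * (sobolev_norm m (?g \<sigma>) * sobolev_norm n (?g \<tau>))"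
    using F G unfolding product_bound_def eq[symmetric] by (simp add: mult.assoc)
  moreover have "?K \<ge> 0" using B by (simp add: product_bound_def)
  moreover have "sobolev_norm m (?g \<sigma>) * sobolev_norm n (?g \<tau>) \<ge> 0" by (intro mult_nonneg_nonneg sobolev_norm_nonneg)
  moreover have "x / y \<le> K" if "x \<le> K * y" "K \<ge> 0" "y \<ge> 0" for x y K :: real
    using that by (cases "y = 0") (auto simp: divide_le_eq)
  ultimately show ?thesis unfolding lower_KF_def by blast
qed

section \<open>The bounds for \<open>(l, 2l, 3l)\<close>\<close>

lemma asymp_one_imp_quotient:
  assumes f: "asymp_one f" and e: "\<forall>\<^sub>F l in at_top. X l * P l = f l \<and> P l \<noteq> 0"
  shows "\<exists>\<epsilon>\<in>O[at_top](\<lambda>l::real. 1 / l). \<forall>\<^sub>F l in at_top. X l = (1 + \<epsilon> l) / P l"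
proof (rule bexI[of _ "\<lambda>l. f l - 1"])
  show "(\<lambda>l. f l - 1) \<in> O[at_top](\<lambda>l. 1 / l)" using f by (simp add: asymp_one_def)
  show "\<forall>\<^sub>F l in at_top. X l = (1 + (f l - 1)) / P l"
    using e by eventually_elim (auto simp: eq_divide_eq)
qed

text \<open>
  Apart from the supremum controlled by the condition, \<open>scrS\<close> consists of a Gamma quotient, which
  contributes \<open>(5l)\<close> to the power \<open>-d/2\<close>. Boundedness is needed to pull this factor out of the
  supremum, which is a meaningful number only for sets that are bounded above.
\<close>

lemma upper_KS_asymptotics:
  assumes c: "condition_S23 CARD('d::finite)"
  shows "\<exists>\<epsilon>\<in>O[at_top](\<lambda>l::real. 1 / l). \<forall>\<^sub>F l in at_top.
           upper_KS l (2 * l) (3 * l) CARD('d) = (1 + \<epsilon> l) / (20 * pi * l) powr (CARD('d) / 4)"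
proof -
  let ?D = "real CARD('d) / 2"
  define S where "S l = (SUP u\<in>{0..}. Sigma23 CARD('d) l u)" for l
  obtain \<epsilon> where \<epsilon>: "\<epsilon> \<in> O[at_top](\<lambda>l. 1 / l)" "\<forall>\<^sub>F l in at_top. S l = 1 + \<epsilon> l"
    using c unfolding condition_S23_def S_def by blast
  have S: "asymp_one S"
    by (rule asymp_one_cong[of "\<lambda>l. 1 + \<epsilon> l"]) (use \<epsilon> in \<open>auto simp: asymp_one_def elim: eventually_mono\<close>)
  have D: "?D > 0" by simp
  have A: "asymp_one (\<lambda>l. sqrt ((5 * l) powr ?D * (Gamma (5 * l - ?D) / Gamma (5 * l)) * S l))"
    by (rule asymp_one_sqrt[OF asymp_one_mult[OF asymp_one_Gamma_ratio[OF D] S]]) simp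
  show ?thesis
  proof (rule asymp_one_imp_quotient[OF A])
    show "\<forall>\<^sub>F l in at_top. upper_KS l (2 * l) (3 * l) CARD('d) * (20 * pi * l) powr (CARD('d) / 4) =
       sqrt ((5 * l) powr ?D * (Gamma (5 * l - ?D) / Gamma (5 * l)) * S l) \<and> (20 * pi * l) powr (CARD('d) / 4) \<noteq> 0"
      using eventually_gt_at_top[of "real CARD('d)"]
    proof eventually_elim
      case (elim l)
      have l0: "l > 0" using elim by (rule le_less_trans[rotated]) simp
      define C where "C = Gamma (5 * l - ?D) / ((4 * pi) powr ?D * Gamma (5 * l))"
      have C0: "C > 0" unfolding C_def using elim l0
        by (intro divide_pos_pos mult_pos_pos Gamma_real_pos) auto
      have scr: "scrS l (2 * l) (3 * l) CARD('d) u = C * Sigma23 CARD('d) l u" for u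
        unfolding scrS_def Sigma23_def C_def by simp
      have bdd: "bdd_above (scrS l (2 * l) (3 * l) CARD('d) ` {0..})"
        by (rule scrS_bdd_above) (use elim l0 in auto)
      have bS: "bdd_above (Sigma23 CARD('d) l ` {0..})"
      proof -
        obtain M where M: "\<And>u. u \<in> {0..} \<Longrightarrow> scrS l (2 * l) (3 * l) CARD('d) u \<le> M"
          using bdd by (auto simp: bdd_above_def)
        show ?thesis
        proof (rule bdd_aboveI2)
          fix u :: real assume "u \<in> {0..}"
          from M[OF this] show "Sigma23 CARD('d) l u \<le> M / C"
            unfolding scr using C0 by (simp add: le_divide_eq mult.commute)
        qed
      qed
      have "(SUP u\<in>{0..}. scrS l (2 * l) (3 * l) CARD('d) u) = C * S l"
      proof -
        have "C * Sup (Sigma23 CARD('d) l ` {0..}) = (SUP s\<in>Sigma23 CARD('d) l ` {0..}. C * s)"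
          using C0 bS by (intro continuous_at_Sup_mono monoI mult_left_mono continuous_mult_left continuous_ident) auto
        then show ?thesis by (simp add: S_def scr image_image)
      qed
      then have U: "upper_KS l (2 * l) (3 * l) CARD('d) = sqrt (C * S l)" by (simp add: upper_KS_def)
      have "(20 * pi * l) powr (CARD('d) / 4) = sqrt ((20 * pi * l) powr ?D)"
        using l0 by (simp add: powr_half_sqrt[symmetric] powr_powr)
      moreover have "(20 * pi * l) powr ?D = (4 * pi) powr ?D * (5 * l) powr ?D"
        using l0 powr_mult[of "4 * pi" "5 * l" ?D] by (simp add: mult_ac)
      ultimately have "upper_KS l (2 * l) (3 * l) CARD('d) * (20 * pi * l) powr (CARD('d) / 4) = sqrt (C * S l * ((4 * pi) powr ?D * (5 * l) powr ?D))"
        unfolding U by (simp only: real_sqrt_mult)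
      also have "C * S l * ((4 * pi) powr ?D * (5 * l) powr ?D) = (5 * l) powr ?D * (Gamma (5 * l - ?D) / Gamma (5 * l)) * S l"
        unfolding C_def by (simp add: field_simps)
      finally show ?case using l0 by simp
    qed
  qed
qed

text \<open>
  The three widths are \<open>1 / (b l)\<close> with \<open>b\<close> equal to \<open>5\<close>, \<open>7\<close> and \<open>35/12\<close>, and the Sobolev orders are
  \<open>a l\<close> with \<open>a\<close> equal to \<open>2\<close>, \<open>3\<close> and \<open>1\<close>. The differences \<open>b - a = 3, 4, 23/12\<close> are the rates of the
  Gaussian integrals, and \<open>12\<^sup>2 \<cdot> (23/12) / (3 \<cdot> 4) = 23\<close>.
\<close>

lemma lower_KF_asymptotics:
  "\<exists>\<epsilon>\<in>O[at_top](\<lambda>l::real. 1 / l). \<forall>\<^sub>F l in at_top.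
           lower_KF TYPE('d::finite) l (2 * l) (3 * l) (1 / (5 * l)) (1 / (7 * l))
             = (1 + \<epsilon> l) / (23 * pi * l) powr (CARD('d) / 4)"
proof -
  let ?D = "real CARD('d) / 2"
  let ?M = "\<lambda>a b l. gauss_moment TYPE('d) (a * l) (b * l)"
  define A where "A a b l = ?M a b l * ((b - a) * l / pi) powr ?D" for a b l :: real
  have A: "asymp_one (A a b)" if "0 < a" "a < b" for a b
    unfolding A_def using asymp_one_gauss_moment[OF that, where 'd='d] .
  have as: "asymp_one (\<lambda>l. sqrt (A 1 (35/12) l / (A 2 5 l * A 3 7 l)))"
    by (intro asymp_one_sqrt asymp_one_divide asymp_one_mult A) auto
  show ?thesis
  proof (rule asymp_one_imp_quotient[OF as])
    show "\<forall>\<^sub>F l in at_top. lower_KF TYPE('d) l (2 * l) (3 * l) (1 / (5 * l)) (1 / (7 * l)) * (23 * pi * l) powr (CARD('d) / 4) =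
       sqrt (A 1 (35/12) l / (A 2 5 l * A 3 7 l)) \<and> (23 * pi * l) powr (CARD('d) / 4) \<noteq> 0"
      using eventually_gt_at_top[of 0]
    proof eventually_elim
      case (elim l)
      let ?g = "\<lambda>s. dist_of_fun (gaussian s :: real^'d \<Rightarrow> complex)"
      have d: "?g s \<phi> = (LBINT x. gaussian s x * \<phi> x)" for s \<phi> by (simp add: dist_of_fun_def)
      have N: "sobolev_norm (a * l) (?g (1 / (b * l))) = sqrt ((b * l) powr real CARD('d) * ?M a b l)" if "0 < a" "a < b" for a b
      proof -
        have "sobolev_norm (a * l) (?g (1 / (b * l))) = sqrt ((1 / (b * l)) powr (- real CARD('d)) * gauss_moment TYPE('d) (a * l) (1 / (1 / (b * l))))"
          by (rule sobolev_norm_gaussian(2)[OF _ _ _ d]) (use that elim in auto)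
        moreover have "(1 / (b * l)) powr (- real CARD('d)) = (b * l) powr real CARD('d)"
          using that elim by (simp add: powr_minus powr_divide)
        ultimately show ?thesis by simp
      qed
      have sum: "1 / (5 * l) + 1 / (7 * l) = 1 / ((35/12) * l)" using elim by (simp add: field_simps)
      have "lower_KF TYPE('d) l (2 * l) (3 * l) (1 / (5 * l)) (1 / (7 * l)) =
        sqrt (((35/12) * l) powr real CARD('d) * ?M 1 (35/12) l) / (sqrt ((5 * l) powr real CARD('d) * ?M 2 5 l) * sqrt ((7 * l) powr real CARD('d) * ?M 3 7 l))"
        unfolding lower_KF_def sum using N[of 1 "35/12"] N[of 2 5] N[of 3 7] by simp
      moreover have "(23 * pi * l) powr (CARD('d) / 4) = sqrt ((23 * pi * l) powr ?D)"
        using elim by (simp add: powr_half_sqrt[symmetric] powr_powr)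
      ultimately have L: "lower_KF TYPE('d) l (2 * l) (3 * l) (1 / (5 * l)) (1 / (7 * l)) * (23 * pi * l) powr (CARD('d) / 4) =
        sqrt ((((35/12) * l) powr real CARD('d) * ?M 1 (35/12) l) / ((5 * l) powr real CARD('d) * ?M 2 5 l * ((7 * l) powr real CARD('d) * ?M 3 7 l)) * (23 * pi * l) powr ?D)"
        by (simp only: real_sqrt_mult real_sqrt_divide)
      have sq: "x powr real CARD('d) = (x\<^sup>2) powr ?D" if "x > 0" for x
        using that by (simp add: powr_powr flip: powr_numeral)
      define x1 x2 x3 where "x1 = ((35/12) * l)\<^sup>2" and "x2 = (5 * l)\<^sup>2" and "x3 = (7 * l)\<^sup>2"
      define y1 y2 y3 where "y1 = (35/12 - 1) * l / pi" and "y2 = (5 - 2) * l / pi" and "y3 = (7 - 3) * l / pi"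
      define z where "z = 23 * pi * l"
      have pos: "x1 > 0" "x2 > 0" "x3 > 0" "y1 > 0" "y2 > 0" "y3 > 0" "z > 0"
        using elim by (simp_all add: x1_def x2_def x3_def y1_def y2_def y3_def z_def)
      have xyz: "x1 * y2 * y3 * z = x2 * x3 * y1"
        using elim by (simp add: x1_def x2_def x3_def y1_def y2_def y3_def z_def field_simps power2_eq_square)
      have pw: "x1 powr ?D * y2 powr ?D * y3 powr ?D * z powr ?D = x2 powr ?D * x3 powr ?D * y1 powr ?D"
        using pos arg_cong[OF xyz, of "\<lambda>t. t powr ?D"] by (simp add: powr_mult)
      have gen: "X1 * M1 / (X2 * M2 * (X3 * M3)) * Z = M1 * Y1 / (M2 * Y2 * (M3 * Y3))"
        if "X1 * Y2 * Y3 * Z = X2 * X3 * Y1" "X2 > 0" "X3 > 0" "Y2 > 0" "Y3 > 0" for X1 X2 X3 Y1 Y2 Y3 Z M1 M2 M3 :: real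
      proof -
        have XZ: "X1 * Z = X2 * X3 * Y1 / (Y2 * Y3)"
          using that by (simp add: eq_divide_eq mult_ac)
        have "X1 * M1 / (X2 * M2 * (X3 * M3)) * Z = X1 * Z * (M1 / (X2 * X3 * (M2 * M3)))"
          by (simp add: mult_ac)
        also have "\<dots> = M1 * Y1 / (M2 * Y2 * (M3 * Y3))"
          unfolding XZ using that by (cases "M2 = 0 \<or> M3 = 0") (auto simp: field_simps)
        finally show ?thesis .
      qed
      have "(((35/12) * l) powr real CARD('d) * ?M 1 (35/12) l) / ((5 * l) powr real CARD('d) * ?M 2 5 l * ((7 * l) powr real CARD('d) * ?M 3 7 l)) * (23 * pi * l) powr ?D
         = A 1 (35/12) l / (A 2 5 l * A 3 7 l)"
      proof -
        have e: "((35/12) * l) powr real CARD('d) = x1 powr ?D" "(5 * l) powr real CARD('d) = x2 powr ?D" "(7 * l) powr real CARD('d) = x3 powr ?D"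
          unfolding x1_def x2_def x3_def using elim by (intro sq; simp)+
        show ?thesis
          unfolding e A_def y1_def[symmetric] y2_def[symmetric] y3_def[symmetric] z_def[symmetric]
          by (rule gen[OF pw]) (use pos in auto)
      qed
      then show ?case using L elim by simp
    qed
  qed
qed

theorem corollary4p9:
  shows
    "(condition_S23 CARD('d::finite) \<longrightarrow>
        (\<exists>\<epsilon>\<in>O[at_top](\<lambda>l::real. 1 / l). \<forall>\<^sub>F l in at_top.
           upper_KS l (2 * l) (3 * l) CARD('d) = (1 + \<epsilon> l) / (20 * pi * l) powr (CARD('d) / 4)))
   \<and> ((1 / 5, 1 / 7) \<in> Delta23 \<and> D23 (1 / 5) (1 / 7) = 23 \<and>
        (\<exists>\<epsilon>\<in>O[at_top](\<lambda>l::real. 1 / l). \<forall>\<^sub>F l in at_top.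
           lower_KF TYPE('d) l (2 * l) (3 * l) (1 / (5 * l)) (1 / (7 * l))
             = (1 + \<epsilon> l) / (23 * pi * l) powr (CARD('d) / 4)))
   \<and> (\<exists>\<epsilon>\<in>O[at_top](\<lambda>l::real. 1 / l). \<forall>\<^sub>F l in at_top.
        (1 + \<epsilon> l) / (23 * pi * l) powr (CARD('d) / 4) \<le> sharp_const TYPE('d) l (2 * l) (3 * l))
   \<and> (condition_S23 CARD('d::finite) \<longrightarrow>
        (\<exists>\<epsilon>\<in>O[at_top](\<lambda>l::real. 1 / l). \<forall>\<^sub>F l in at_top.
           sharp_const TYPE('d) l (2 * l) (3 * l) \<le> (1 + \<epsilon> l) / (20 * pi * l) powr (CARD('d) / 4)))"
proof -
  have bound: "\<forall>\<^sub>F l in at_top. product_bound TYPE('d) l (2 * l) (3 * l) (upper_KS l (2 * l) (3 * l) CARD('d))"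
    using eventually_gt_at_top[of "real CARD('d)"]
  proof eventually_elim
    case (elim l)
    then have "l > 0" by (rule le_less_trans[rotated]) simp
    with elim show ?case by (intro upper_KS_product_bound) auto
  qed
  have lower: "\<forall>\<^sub>F l in at_top. lower_KF TYPE('d) l (2 * l) (3 * l) (1 / (5 * l)) (1 / (7 * l)) \<le> sharp_const TYPE('d) l (2 * l) (3 * l)"
    using bound eventually_gt_at_top[of 0]
  proof eventually_elim
    case (elim l)
    have "1 / (5 * l) + 1 / (7 * l) = 1 / ((35/12) * l)" using elim by (simp add: field_simps)
    then have "l < 1 / (1 / (5 * l) + 1 / (7 * l))" using elim by simp
    then show ?case by (intro lower_KF_le_sharp_const[OF elim(1)]) (use elim in auto)
  qed
  have upper: "\<forall>\<^sub>F l in at_top. sharp_const TYPE('d) l (2 * l) (3 * l) \<le> upper_KS l (2 * l) (3 * l) CARD('d)"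
    using bound by eventually_elim (rule sharp_const_least(2))
  obtain \<epsilon> where \<epsilon>: "\<epsilon> \<in> O[at_top](\<lambda>l::real. 1 / l)" "\<forall>\<^sub>F l in at_top.
           lower_KF TYPE('d) l (2 * l) (3 * l) (1 / (5 * l)) (1 / (7 * l)) = (1 + \<epsilon> l) / (23 * pi * l) powr (CARD('d) / 4)"
    using lower_KF_asymptotics[where 'd='d] by blast
  have "\<forall>\<^sub>F l in at_top. (1 + \<epsilon> l) / (23 * pi * l) powr (CARD('d) / 4) \<le> sharp_const TYPE('d) l (2 * l) (3 * l)"
    using lower \<epsilon>(2) by eventually_elim simp
  then have 3: "\<exists>\<epsilon>\<in>O[at_top](\<lambda>l::real. 1 / l). \<forall>\<^sub>F l in at_top.
        (1 + \<epsilon> l) / (23 * pi * l) powr (CARD('d) / 4) \<le> sharp_const TYPE('d) l (2 * l) (3 * l)"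
    using \<epsilon>(1) by blast
  have 4: "\<exists>\<epsilon>\<in>O[at_top](\<lambda>l::real. 1 / l). \<forall>\<^sub>F l in at_top.
           sharp_const TYPE('d) l (2 * l) (3 * l) \<le> (1 + \<epsilon> l) / (20 * pi * l) powr (CARD('d) / 4)"
    if c: "condition_S23 CARD('d)"
  proof -
    obtain \<delta> where \<delta>: "\<delta> \<in> O[at_top](\<lambda>l::real. 1 / l)" "\<forall>\<^sub>F l in at_top.
           upper_KS l (2 * l) (3 * l) CARD('d) = (1 + \<delta> l) / (20 * pi * l) powr (CARD('d) / 4)"
      using upper_KS_asymptotics[OF c] by blast
    have "\<forall>\<^sub>F l in at_top. sharp_const TYPE('d) l (2 * l) (3 * l) \<le> (1 + \<delta> l) / (20 * pi * l) powr (CARD('d) / 4)"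
      using upper \<delta>(2) by eventually_elim simp
    then show ?thesis using \<delta>(1) by blast
  qed
  have "(1 / 5, 1 / 7) \<in> Delta23" by (simp add: Delta23_def)
  moreover have "D23 (1 / 5) (1 / 7) = 23" by (simp add: D23_def)
  ultimately show ?thesis
    using upper_KS_asymptotics[where 'd='d] lower_KF_asymptotics[where 'd='d] 3 4 by blast
qed

end
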